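(* Let $B_n^+$ be the braid monoid on $n$ strands with set of atoms $\mathcal{A}=\{\sigma_1,\ldots,\sigma_{n-1}\}$, let $\mathfrak{P}$ be the set of partitions of $n$, and let $T$, $\varphi$, $\psi$, $\widetilde{T}$, $P$, $Q$, $\widetilde{N}$, $C$, $S$ be as defined in the context. Then: (i) The matrix $S$ is invertible and $S^{-1}$ is the matrix given by $(S^{-1})_{X,Y}=(-1)^{|Y\setminus X|}$ if $X\subseteq Y$, and $(S^{-1})_{X,Y}=0$ otherwise. (ii) One has $T=S^{-1}CP^t\widetilde{N}P$ and $\widetilde{T}=PTQ=PS^{-1}CP^t\widetilde{N}$. (iii) Let $u\in\mathbb{Z}^{\mathcal{P}(\mathcal{A})\times1}$ and $v\in\mathbb{Z}^{1\times\mathcal{P}(\mathcal{A})}$ be defined by $u_X=1$ if $X=\mathcal{A}$ and $u_X=0$ otherwise, respectively $v_X=0$ if $X=\emptyset$ and $v_X=1$ otherwise. Let $\widetilde{u}\in\mathbb{Z}^{\mathfrak{P}\times1}$ and $\widetilde{v}\in\mathbb{Z}^{1\times\mathfrak{P}}$ be defined by $\widetilde{u}_\alpha=1$ if $\alpha=\varphi(\mathcal{A})=[1,\ldots,1]$ and $\widetilde{u}_\alpha=0$ otherwise, and $\widetilde{v}_\alpha=0$ if $\alpha=\varphi(\emptyset)=[n]$ and $\widetilde{v}_\alpha=1$ otherwise. Then for any $k\in\mathbb{N}$, one has $vT^ku=\widetilde{v}\widetilde{T}^k\widetilde{u}$. In particular, the growth function of $B_n^+$ can be computed using the matrix $\w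idetilde{T}$.
   Context: $B_n^+$ is the monoid with generators $\sigma_1,\ldots,\sigma_{n-1}$ and relations $\sigma_i\sigma_{i+1}\sigma_i=\sigma_{i+1}\sigma_i\sigma_{i+1}$ for $1\le i\le n-2$ and $\sigma_i\sigma_j=\sigma_j\sigma_i$ for $|i-j|\ge2$. For $x,y\in B_n^+$ write $x\preccurlyeq y$ if $xc=y$ for some $c\in B_n^+$, and $x\succcurlyeq y$ if $x=cy$ for some $c\in B_n^+$. The Garside element $\Delta$ is the $\preccurlyeq$-least common multiple of the atoms (equal to the $\succcurlyeq$-least common multiple of the atoms), and $D=\{s\mid s\preccurlyeq\Delta\}=\{s\mid\Delta\succcurlyeq s\}$ is the finite set of simple elements, which generates $B_n^+$. The starting set and finishing set of $x$ are $S(x)=\{a\in\mathcal{A}\mid a\preccurlyeq x\}$ and $F(x)=\{a\in\mathcal{A}\mid x\succcurlyeq a\}$. The growth function of $B_n^+$ is meant with respect to the generating set $D$: it is $\sum_{\ell\ge0}a_\ell t^\ell$, where $a_\ell$ is the number of elements $g\in B_n^+$ for which a shortest word over $D$ representing $g$ has length $\ell$. The canonical map $\pi:D\to\mathfrak{S}_n$, sending a simple element to the permutation it induces on the $n$ strands, with $\pi(\sigma_i)$ the transposition $(i\ \ i+1)$, is a bijection. A product $x_1\cdots x_k$ of simple elements is in (left) normal form if $x_k\ne1$ and, for $i=1,\ldots,k$, $x_i$ is the $\preccurlyeq$-greatest common divisor of $\Delta$ and $x_i\cdots x_k$; normal forms are unique and are shortest words over $D$ representing their elements. The automaton $\mathfrak{T}$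 recognising normal forms has state set $\mathcal{P}(\mathcal{A})$ (the power set of $\mathcal{A}$), alphabet $D$, initial state $\mathcal{A}$, accept states $\mathcal{P}(\mathcal{A})\setminus\{\emptyset\}$, and transition function $(X,s)\mapsto F(s)$ if $S(s)\subseteq X$ and $(X,s)\mapsto\emptyset$ otherwise. $T\in\mathbb{Z}^{\mathcal{P}(\mathcal{A})\times\mathcal{P}(\mathcal{A})}$ is its transition matrix: $T_{Y,X}$ is the number of transitions (elements $s\in D$) from state $X$ to state $Y$. For $Z\subseteq\mathcal{A}$, the orbits on $\{1,\ldots,n\}$ of the subgroup $\langle\pi(Z)\rangle\le\mathfrak{S}_n$ are sets of consecutive integers; if $O_1,\ldots,O_r$ are these orbits in their natural order, then $\deg(Z)=[|O_1|,\ldots,|O_r|]$. For sequences $A=[a_1,\ldots,a_r]$, $B=[b_1,\ldots,b_s]$ of non-negative integers with equal sums, $N_{A,B}$ is the number of simple vertex-labelled bipartite graphs $(U,V,E)$ with vertex classes $U=\{u_1,\ldots,u_r\}$, $V=\{v_1,\ldots,v_s\}$ such that $\deg(u_i)=a_i$ and $\deg(v_j)=b_j$ for all $i,j$. It is invariant under permuting the entries of $A$ and of $B$, so $N_{\alpha,\beta}$ makes sense for partitions $\alpha,\beta$ of $n$. $\varphi:\mathcal{P}(\mathcal{A})\to\mathfrak{P}$ sends $X$ to the partition of $n$ given by $\deg(\mathcal{A}\setminus X)$ (forgetting order), and $\psi:\mathfrak{P}\to\mathcal{P}(\mathcal{A})$ is a chosen map with $\varphi(\psi(\alpha))=\alpha$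 for all $\alpha\in\mathfrak{P}$. Define - $\widetilde{T}\in\mathbb{Z}^{\mathfrak{P}\times\mathfrak{P}}$ by $\widetilde{T}_{\beta,\alpha}=\sum_{Y\in\varphi^{-1}(\beta)}T_{Y,\psi(\alpha)}$ (this does not depend on the choice of $\psi$); - $P\in\mathbb{Z}^{\mathfrak{P}\times\mathcal{P}(\mathcal{A})}$ by $P_{\alpha,X}=1$ if $\alpha=\varphi(X)$ and $0$ otherwise; - $Q\in\mathbb{Z}^{\mathcal{P}(\mathcal{A})\times\mathfrak{P}}$ by $Q_{X,\alpha}=1$ if $X=\psi(\alpha)$ and $0$ otherwise; - $\widetilde{N}\in\mathbb{Z}^{\mathfrak{P}\times\mathfrak{P}}$ by $\widetilde{N}_{\alpha,\beta}=n!$ if $\alpha=[1,\ldots,1]$ and $\widetilde{N}_{\alpha,\beta}=N_{\alpha,\beta}$ otherwise; - $C\in\mathbb{Z}^{\mathcal{P}(\mathcal{A})\times\mathcal{P}(\mathcal{A})}$ by $C_{X,Y}=1$ if $X=\mathcal{A}\setminus Y$ and $0$ otherwise; - $S\in\mathbb{Z}^{\mathcal{P}(\mathcal{A})\times\mathcal{P}(\mathcal{A})}$ by $S_{X,Y}=1$ if $X\subseteq Y$ and $0$ otherwise. (The matrix $S$ is not to be confused with the starting set $S(x)$.) $P^t$ denotes the transpose of $P$.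
   Formalization: The growth function formula in (iii) is stated for n ≥ 2 only: for n = 1 there are no atoms, the single state is initial but not accepting, and the formula gives 0 instead of the growth function 1. *)

theory Defs
  imports
    "HOL-Computational_Algebra.Formal_Power_Series"
    "HOL-Library.Multiset"
    "HOL-Algebra.Divisibility"
    "HOL-Algebra.Group_Action"
    "HOL-Algebra.Generated_Groups"
    "HOL-Algebra.Sym_Groups"
begin

inductive_set word_cong :: "'a set \<Rightarrow> ('a list \<times> 'a list) set \<Rightarrow> ('a list \<times> 'a list) set"
  for A :: "'a set" and R :: "('a list \<times> 'a list) set" where
  rel: "(u, v) \<in> R \<Longrightarrow> u \<in> lists A \<Longrightarrow> v \<in> lists A \<Longrightarrow> (u, v) \<in> word_cong A R"
| refl: "u \<in> lists A \<Longrightarrow> (u, u) \<in> word_cong A R"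
| sym: "(u, v) \<in> word_cong A R \<Longrightarrow> (v, u) \<in> word_cong A R"
| trans: "(u, v) \<in> word_cong A R \<Longrightarrow> (v, w) \<in> word_cong A R \<Longrightarrow> (u, w) \<in> word_cong A R"
| ctxt: "(u, v) \<in> word_cong A R \<Longrightarrow> x \<in> lists A \<Longrightarrow> y \<in> lists A
           \<Longrightarrow> (x @ u @ y, x @ v @ y) \<in> word_cong A R"

definition presented_monoid :: "'a set \<Rightarrow> ('a list \<times> 'a list) set \<Rightarrow> 'a list set monoid" where
  "presented_monoid A R =
     \<lparr> carrier = lists A // word_cong A R,
       mult = (\<lambda>X Y. \<Union>u\<in>X. \<Union>v\<in>Y. word_cong A R `` {u @ v}),
       one = word_cong A R `` {[]} \<rparr>"

text \<open>The letter \<open>i\<close> stands for the generator \<open>\<sigma>\<^sub>i\<close>.\<close>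

definition braid_relations :: "nat \<Rightarrow> (nat list \<times> nat list) set" where
  "braid_relations n =
     {([i, i + 1, i], [i + 1, i, i + 1]) | i. 1 \<le> i \<and> i + 1 < n} \<union>
     {([i, j], [j, i]) | i j. i \<in> {1..<n} \<and> j \<in> {1..<n} \<and> (i + 2 \<le> j \<or> j + 2 \<le> i)}"

definition braid_monoid :: "nat \<Rightarrow> nat list set monoid" where
  "braid_monoid n = presented_monoid {1..<n} (braid_relations n)"

definition sigma :: "nat \<Rightarrow> nat \<Rightarrow> nat list set" where
  "sigma n i = word_cong {1..<n} (braid_relations n) `` {[i]}"

definition atoms :: "nat \<Rightarrow> nat list set set" where
  "atoms n = sigma n ` {1..<n}"

text \<open>The library relation \<open>x divides\<^bsub>G\<^esub> y\<close> means \<open>y = x c\<close> for some \<open>c\<close>, which is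
  \<open>x \<preccurlyeq> y\<close>. Its mirror image, \<open>x \<succcurlyeq> y\<close>, is the following relation.\<close>

definition rmultiple :: "'a monoid \<Rightarrow> 'a \<Rightarrow> 'a \<Rightarrow> bool" where
  "rmultiple G x y \<longleftrightarrow> (\<exists>c\<in>carrier G. x = c \<otimes>\<^bsub>G\<^esub> y)"

definition is_left_lcm :: "'a monoid \<Rightarrow> 'a set \<Rightarrow> 'a \<Rightarrow> bool" where
  "is_left_lcm G Z d \<longleftrightarrow> d \<in> carrier G \<and> (\<forall>a\<in>Z. a divides\<^bsub>G\<^esub> d) \<and>
     (\<forall>m\<in>carrier G. (\<forall>a\<in>Z. a divides\<^bsub>G\<^esub> m) \<longrightarrow> d divides\<^bsub>G\<^esub> m)"

definition garside :: "nat \<Rightarrow> nat list set" where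
  "garside n = (THE d. is_left_lcm (braid_monoid n) (atoms n) d)"

definition simples :: "nat \<Rightarrow> nat list set set" where
  "simples n = {s \<in> carrier (braid_monoid n). s divides\<^bsub>braid_monoid n\<^esub> garside n}"

definition start_set :: "nat \<Rightarrow> nat list set \<Rightarrow> nat list set set" where
  "start_set n x = {a \<in> atoms n. a divides\<^bsub>braid_monoid n\<^esub> x}"

definition finish_set :: "nat \<Rightarrow> nat list set \<Rightarrow> nat list set set" where
  "finish_set n x = {a \<in> atoms n. rmultiple (braid_monoid n) x a}"

definition word_prod :: "'a monoid \<Rightarrow> 'a list \<Rightarrow> 'a" where
  "word_prod G ws = foldr (\<lambda>x y. x \<otimes>\<^bsub>G\<^esub> y) ws \<one>\<^bsub>G\<^esub>"

definition simple_length :: "nat \<Rightarrow> nat list set \<Rightarrow> nat" where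
  "simple_length n g =
     (LEAST l. \<exists>ws. ws \<in> lists (simples n) \<and> length ws = l \<and> word_prod (braid_monoid n) ws = g)"

definition growth_function :: "nat \<Rightarrow> int fps" where
  "growth_function n =
     Abs_fps (\<lambda>l. int (card {g \<in> carrier (braid_monoid n). simple_length n g = l}))"

definition word_perm :: "nat list \<Rightarrow> nat \<Rightarrow> nat" where
  "word_perm w = foldr (\<lambda>i p. transpose i (i + 1) \<circ> p) w id"

text \<open>All words representing a given element induce the same permutation, so the image below
  is a singleton.\<close>

definition braid_perm :: "nat list set \<Rightarrow> nat \<Rightarrow> nat" where
  "braid_perm x = the_elem (word_perm ` x)"

definition perm_orbits :: "nat \<Rightarrow> nat list set set \<Rightarrow> nat set set" where
  "perm_orbits n Z =
     orbits (sym_group n \<lparr> carrier := generate (sym_group n) (braid_perm ` Z) \<rparr>) {1..n} (\<lambda>p. p)"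

text \<open>Natural order of the orbits: they are listed by increasing least element.\<close>

definition deg_seq :: "nat \<Rightarrow> nat list set set \<Rightarrow> nat list" where
  "deg_seq n Z =
     map (\<lambda>m. card (THE Ob. Ob \<in> perm_orbits n Z \<and> Min Ob = m))
       (sorted_list_of_set (Min ` perm_orbits n Z))"

definition partitions :: "nat \<Rightarrow> nat multiset set" where
  "partitions n = {\<alpha>. 0 \<notin># \<alpha> \<and> sum_mset \<alpha> = n}"

definition phi :: "nat \<Rightarrow> nat list set set \<Rightarrow> nat multiset" where
  "phi n X = mset (deg_seq n (atoms n - X))"

text \<open>The vertices \<open>u\<^sub>1, \<dots>, u\<^sub>r\<close> are \<open>Inl 0, \<dots>, Inl (r - 1)\<close> and the vertices
  \<open>v\<^sub>1, \<dots>, v\<^sub>s\<close> are \<open>Inr 0, \<dots>, Inr (s - 1)\<close>; a graph is given by its set of edges, an edge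
  being a two-element set of vertices.\<close>

definition bip_count :: "nat list \<Rightarrow> nat list \<Rightarrow> nat" where
  "bip_count A B = card {E :: (nat + nat) set set.
     E \<subseteq> {{Inl i, Inr j} | i j. i < length A \<and> j < length B} \<and>
     (\<forall>i < length A. card {e \<in> E. Inl i \<in> e} = A ! i) \<and>
     (\<forall>j < length B. card {e \<in> E. Inr j \<in> e} = B ! j)}"

text \<open>For partitions the entries are listed in increasing order; \<^const>\<open>bip_count\<close> does not
  depend on the order of the entries.\<close>

definition bip_count_part :: "nat multiset \<Rightarrow> nat multiset \<Rightarrow> nat" where
  "bip_count_part \<alpha> \<beta> =
     bip_count (sorted_list_of_multiset \<alpha>) (sorted_list_of_multiset \<beta>)"

text \<open>An \<open>I \<times> J\<close> matrix is a function of two arguments of which only the values on \<open>I \<times> J\<close>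
  matter.\<close>

type_synonym ('i, 'j) imat = "'i \<Rightarrow> 'j \<Rightarrow> int"

definition mat_eq :: "'i set \<Rightarrow> 'j set \<Rightarrow> ('i, 'j) imat \<Rightarrow> ('i, 'j) imat \<Rightarrow> bool" where
  "mat_eq I J M N \<longleftrightarrow> (\<forall>i\<in>I. \<forall>j\<in>J. M i j = N i j)"

definition mat_mul :: "('i, 'k) imat \<Rightarrow> 'k set \<Rightarrow> ('k, 'j) imat \<Rightarrow> ('i, 'j) imat"
    (\<open>_ \<cdot>\<^bsub>_\<^esub> _\<close> [70, 0, 71] 70) where
  "M \<cdot>\<^bsub>K\<^esub> N = (\<lambda>i j. \<Sum>k\<in>K. M i k * N k j)"

definition mat_id :: "('i, 'i) imat" where
  "mat_id = (\<lambda>i j. if i = j then 1 else 0)"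

primrec mat_pow :: "'i set \<Rightarrow> ('i, 'i) imat \<Rightarrow> nat \<Rightarrow> ('i, 'i) imat" where
  "mat_pow I M 0 = mat_id"
| "mat_pow I M (Suc k) = M \<cdot>\<^bsub>I\<^esub> mat_pow I M k"

definition mat_transpose :: "('i, 'j) imat \<Rightarrow> ('j, 'i) imat" where
  "mat_transpose M = (\<lambda>j i. M i j)"

definition is_mat_inverse :: "'i set \<Rightarrow> ('i, 'i) imat \<Rightarrow> ('i, 'i) imat \<Rightarrow> bool" where
  "is_mat_inverse I M N \<longleftrightarrow> mat_eq I I (M \<cdot>\<^bsub>I\<^esub> N) mat_id \<and> mat_eq I I (N \<cdot>\<^bsub>I\<^esub> M) mat_id"

definition mat_invertible :: "'i set \<Rightarrow> ('i, 'i) imat \<Rightarrow> bool" where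
  "mat_invertible I M \<longleftrightarrow> (\<exists>N. is_mat_inverse I M N)"

definition mat_inv :: "'i set \<Rightarrow> ('i, 'i) imat \<Rightarrow> ('i, 'i) imat" where
  "mat_inv I M = (SOME N. is_mat_inverse I M N)"

type_synonym state = "nat list set set"

definition states :: "nat \<Rightarrow> state set" where
  "states n = Pow (atoms n)"

definition transition :: "nat \<Rightarrow> state \<Rightarrow> nat list set \<Rightarrow> state" where
  "transition n X s = (if start_set n s \<subseteq> X then finish_set n s else {})"

definition T_mat :: "nat \<Rightarrow> (state, state) imat" where
  "T_mat n = (\<lambda>Y X. int (card {s \<in> simples n. transition n X s = Y}))"

definition T_tilde :: "nat \<Rightarrow> (nat multiset \<Rightarrow> state) \<Rightarrow> (nat multiset, nat multiset) imat" where
  "T_tilde n \<psi> = (\<lambda>\<beta> \<alpha>. \<Sum>Y\<in>{Y \<in> states n. phi n Y = \<beta>}. T_mat n Y (\<psi> \<alpha>))"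

definition P_mat :: "nat \<Rightarrow> (nat multiset, state) imat" where
  "P_mat n = (\<lambda>\<alpha> X. if \<alpha> = phi n X then 1 else 0)"

definition Q_mat :: "(nat multiset \<Rightarrow> state) \<Rightarrow> (state, nat multiset) imat" where
  "Q_mat \<psi> = (\<lambda>X \<alpha>. if X = \<psi> \<alpha> then 1 else 0)"

definition N_tilde :: "nat \<Rightarrow> (nat multiset, nat multiset) imat" where
  "N_tilde n = (\<lambda>\<alpha> \<beta>. if \<alpha> = replicate_mset n 1 then fact n else int (bip_count_part \<alpha> \<beta>))"

definition C_mat :: "nat \<Rightarrow> (state, state) imat" where
  "C_mat n = (\<lambda>X Y. if X = atoms n - Y then 1 else 0)"

definition S_mat :: "(state, state) imat" where
  "S_mat = (\<lambda>X Y. if X \<subseteq> Y then 1 else 0)"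

text \<open>Columns and rows are matrices with one of the index sets equal to \<open>UNIV :: unit set\<close>.\<close>

definition u_vec :: "nat \<Rightarrow> (state, unit) imat" where
  "u_vec n = (\<lambda>X _. if X = atoms n then 1 else 0)"

definition v_vec :: "(unit, state) imat" where
  "v_vec = (\<lambda>_ X. if X = {} then 0 else 1)"

definition u_tilde :: "nat \<Rightarrow> (nat multiset, unit) imat" where
  "u_tilde n = (\<lambda>\<alpha> _. if \<alpha> = phi n (atoms n) then 1 else 0)"

definition v_tilde :: "nat \<Rightarrow> (unit, nat multiset) imat" where
  "v_tilde n = (\<lambda>_ \<alpha>. if \<alpha> = phi n {} then 0 else 1)"

end

theory Submission
  imports Defs
begin

text \<open>
  The elements of \<open>D\<close> are identified with permutations, and divisibility of simple elements with the
  weak order, i.e. with inclusion of inversion sets. Since the transitive closure of a union of two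
  inversion sets is an inversion set, for permutations \<open>u\<close> and \<open>w\<close> there is a greatest prefix \<open>a\<close> of \<open>w\<close>
  such that the lengths of \<open>u\<close> and \<open>a\<close> add up in \<open>u a\<close>. Moving such prefixes from right to left lets a permutation
  act on sequences of permutations; these actions compose along reduced products, hence satisfy the
  braid relations, so \<open>B\<^sub>n\<^sup>+\<close> acts on sequences. The orbit of the empty sequence
  consists of the normal forms, which makes them unique and identifies \<open>\<Delta>\<close> with the longest permutation.

  By inclusion-exclusion, \<open>T\<close> is determined by the numbers of permutations whose right descents
  include a set \<open>Z\<close> and whose left descents are contained in a set \<open>X\<close>. Recording for each point the orbit it lies in
  and the orbit it is sent to turns such a permutation into a bipartite graph with degrees
  \<open>deg(Z)\<close> and \<open>deg(\<A> - X)\<close>. In particular \<open>T\<^bsub>Y,X\<^esub>\<close> depends on \<open>X\<close> only through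
  \<open>\<phi>(X)\<close>, so \<open>P T = T' P\<close> for the compressed matrix \<open>T'\<close>, and powers of \<open>T\<close> can be replaced by powers of \<open>T'\<close>.
\<close>

section \<open>Inversions and greedy prefixes of permutations\<close>

text \<open>The presentation gives no control over when two words represent the same element,
  whereas the gcd condition defining normal forms presupposes exactly that. An action has to be
  checked only on the defining relations, and letting the monoid act on its own candidate normal
  forms makes the form computable from any representative word. Statements about arbitrary elements,
  such as the least common multiple property of \<open>\<Delta>\<close>, are then read off from the
  first entry of the form.

  Permutations compose as functions, so left factors of \<open>w\<close> show in the inversions of
  \<open>inv' w\<close> and right factors in those of \<open>w\<close> itself. This is why starting
  sets and the weak order are phrased through inverses.

  The graphs come out simple because the two descent conditions pull in opposite directions: points
  with the same source orbit must be inverted, points with the same target orbit must not be, so no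
  two points produce the same edge.\<close>

definition inversions :: "(nat \<Rightarrow> nat) \<Rightarrow> (nat \<times> nat) set" where
  "inversions w = {(x, y). x < y \<and> w y < w x}"

definition perm_length :: "(nat \<Rightarrow> nat) \<Rightarrow> nat" where
  "perm_length w = card (inversions w)"

lemma mem_inversions: "(x, y) \<in> inversions w \<longleftrightarrow> x < y \<and> w y < w x"
  by (simp add: inversions_def)

lemma inversions_subset:
  assumes "w permutes {1..n}"
  shows "inversions w \<subseteq> {1..n} \<times> {1..n}"
proof (rule subrelI)
  fix x y assume "(x, y) \<in> inversions w"
  then have xy: "x < y" "w y < w x" by (auto simp: mem_inversions)
  have in_iff: "w z \<in> {1..n} \<longleftrightarrow> z \<in> {1..n}" and out: "z \<notin> {1..n} \<Longrightarrow> w z = z" for z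
    using assms permutes_in_image permutes_not_in by metis+
  show "(x, y) \<in> {1..n} \<times> {1..n}"
    using in_iff[of x] in_iff[of y] out[of x] out[of y] xy by (cases "x \<in> {1..n}"; cases "y \<in> {1..n}") auto
qed

lemma finite_inversions: "w permutes {1..n} \<Longrightarrow> finite (inversions w)"
  using inversions_subset[of w n] finite_subset by blast

text \<open>Sorting the images of a pair under \<open>v\<close> gives the map \<open>f\<close>. The
  composite inverts a pair exactly when one, but not both, of \<open>v\<close> at the pair and
  \<open>u\<close> at the sorted image inverts it. So \<open>inversions (u \<circ> v)\<close> is the
  symmetric difference of \<open>inversions v\<close> and the pullback \<open>B\<close>, and their
  overlap, which is lost twice, is matched by \<open>f\<close> with
  \<open>inversions (inv' v) \<inter> inversions u\<close>.\<close>

lemma perm_length_compose: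
  assumes u: "u permutes {1..n}" and v: "v permutes {1..n}"
  shows "perm_length (u \<circ> v) + 2 * card (inversions (inv' v) \<inter> inversions u)
       = perm_length u + perm_length v"
proof -
  define f where "f = (\<lambda>p. (min (v (fst p)) (v (snd p)), max (v (fst p)) (v (snd p))))"
  define g where "g = (\<lambda>p. (min (inv' v (fst p)) (inv' v (snd p)), max (inv' v (fst p)) (inv' v (snd p))))"
  define B where "B = {p. fst p < snd p \<and> f p \<in> inversions u}"
  note injv = permutes_inj[OF v]
  have vv: "v (inv' v x) = x" "inv' v (v x) = x" for x
    using permutes_inverses[OF v] by auto
  have ne: "v x = v y \<longleftrightarrow> x = y" for x y using injv by (auto dest: injD)
  have ne': "inv' v x = inv' v y \<longleftrightarrow> x = y" for x y by (metis vv(1))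
  have gf: "g (f p) = p" if "fst p < snd p" for p
    using that by (cases p) (auto simp: f_def g_def min_def max_def vv)
  have fg: "f (g p) = p" if "fst p < snd p" for p
    using that by (cases p) (auto simp: f_def g_def min_def max_def vv)
  have fl: "fst (f p) < snd (f p)" if "fst p < snd p" for p
    using that ne[of "fst p" "snd p"] by (auto simp: f_def min_def max_def)
  have gl: "fst (g p) < snd (g p)" if "fst p < snd p" for p
    using that ne'[of "fst p" "snd p"] by (auto simp: g_def min_def max_def)
  have lt: "p \<in> inversions w \<Longrightarrow> fst p < snd p" for p w by (auto simp: inversions_def)
  have bB: "bij_betw f B (inversions u)"
  proof (rule bij_betw_byWitness[where f' = g])
    show "g ` inversions u \<subseteq> B"
    proof (rule image_subsetI)
      fix p assume "p \<in> inversions u"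
      then show "g p \<in> B" using fg[of p] gl[of p] lt[of p] by (simp add: B_def)
    qed
  qed (use lt in \<open>auto simp: B_def gf fg\<close>)
  have bAB: "bij_betw f (inversions v \<inter> B) (inversions (inv' v) \<inter> inversions u)"
  proof (rule bij_betw_byWitness[where f' = g])
    show "f ` (inversions v \<inter> B) \<subseteq> inversions (inv' v) \<inter> inversions u"
    proof (rule image_subsetI)
      fix p assume "p \<in> inversions v \<inter> B"
      then show "f p \<in> inversions (inv' v) \<inter> inversions u"
        by (cases p) (auto simp: B_def f_def inversions_def vv)
    qed
    show "g ` (inversions (inv' v) \<inter> inversions u) \<subseteq> inversions v \<inter> B"
    proof (rule image_subsetI)
      fix p assume p: "p \<in> inversions (inv' v) \<inter> inversions u"
      then have "g p \<in> inversions v" by (cases p) (auto simp: g_def inversions_def vv)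
      moreover have "g p \<in> B" using p fg[of p] gl[of p] lt[of p u] by (auto simp: B_def)
      ultimately show "g p \<in> inversions v \<inter> B" by simp
    qed
  qed (auto simp: B_def gf fg mem_inversions)
  have eq: "inversions (u \<circ> v) = (inversions v - B) \<union> (B - inversions v)"
  proof -
    have "(x, y) \<in> inversions (u \<circ> v) \<longleftrightarrow> (x, y) \<in> (inversions v - B) \<union> (B - inversions v)" for x y
    proof (cases "x < y")
      case True
      have "u (v x) \<noteq> u (v y)" using True ne permutes_inj[OF u] by (auto dest: injD)
      then show ?thesis using True ne[of x y]
        by (auto simp: B_def f_def inversions_def min_def max_def)
    qed (auto simp: B_def inversions_def)
    then show ?thesis by auto
  qed
  have fin: "finite (inversions v)" "finite B"
    using finite_inversions[OF v] finite_inversions[OF u] bij_betw_finite[OF bB] by auto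
  have "perm_length (u \<circ> v) = card (inversions v - B) + card (B - inversions v)"
    unfolding perm_length_def eq by (rule card_Un_disjoint) (use fin in auto)
  moreover have "card (inversions v) = card (inversions v - B) + card (inversions v \<inter> B)"
    using fin(1) by (metis card_Int_Diff add.commute)
  moreover have "card B = card (B - inversions v) + card (inversions v \<inter> B)"
    using fin(2) by (metis card_Int_Diff add.commute Int_commute)
  ultimately show ?thesis
    using bij_betw_same_card[OF bB] bij_betw_same_card[OF bAB] by (simp add: perm_length_def)
qed

text \<open>Additivity of lengths is used instead of disjointness of inversion sets because
  associativity then becomes arithmetic.\<close>

definition reduced_prod :: "(nat \<Rightarrow> nat) \<Rightarrow> (nat \<Rightarrow> nat) \<Rightarrow> bool" where
  "reduced_prod u v \<longleftrightarrow> perm_length (u \<circ> v) = perm_length u + perm_length v"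

lemma perm_length_compose_le:
  "u permutes {1..n} \<Longrightarrow> v permutes {1..n} \<Longrightarrow> perm_length (u \<circ> v) \<le> perm_length u + perm_length v"
  using perm_length_compose[of u n v] by linarith

lemma reduced_prod_iff:
  assumes "u permutes {1..n}" and "v permutes {1..n}"
  shows "reduced_prod u v \<longleftrightarrow> inversions (inv' v) \<inter> inversions u = {}"
  using perm_length_compose[OF assms] finite_inversions[OF assms(1)]
  by (auto simp: reduced_prod_def)

text \<open>By subadditivity, either side says that the length of
  \<open>u \<circ> v \<circ> w\<close> is the sum of the three lengths.\<close>

lemma reduced_prod_assoc:
  assumes "u permutes {1..n}" and "v permutes {1..n}" and "w permutes {1..n}"
  shows "reduced_prod u v \<and> reduced_prod (u \<circ> v) w \<longleftrightarrow> reduced_prod v w \<and> reduced_prod u (v \<circ> w)"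
proof -
  note perm_length_compose_le[OF assms(1,2)] perm_length_compose_le[OF assms(2,3)]
    perm_length_compose_le[OF permutes_compose[OF assms(2,1)] assms(3)]
    perm_length_compose_le[OF assms(1) permutes_compose[OF assms(3,2)]]
  then show ?thesis by (auto simp: reduced_prod_def comp_assoc)
qed

text \<open>An inversion \<open>(p, q)\<close> of \<open>inv' a\<close> corresponds to the inversion
  \<open>(inv' a q, inv' a p)\<close> of \<open>a\<close>. The remainder
  \<open>inv' a \<circ> w\<close> has inverse \<open>inv' w \<circ> a\<close>, which leaves that
  pair in order exactly when \<open>inv' w\<close> inverts \<open>(p, q)\<close>.\<close>

lemma reduced_prod_prefix_iff:
  assumes a: "a permutes {1..n}" and w: "w permutes {1..n}"
  shows "reduced_prod a (inv' a \<circ> w) \<longleftrightarrow> inversions (inv' a) \<subseteq> inversions (inv' w)"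
proof -
  have aa: "a (inv' a x) = x" "inv' a (a x) = x" for x
    using permutes_inverses[OF a] by auto
  have i: "inv' (inv' a \<circ> w) = inv' w \<circ> a"
    using o_inv_distrib[OF permutes_bij[OF permutes_inv[OF a]] permutes_bij[OF w]] permutes_inv_inv[OF a] by simp
  have ne: "inv' w x = inv' w y \<longleftrightarrow> x = y" for x y
    using permutes_inj[OF permutes_inv[OF w]] by (auto dest: injD)
  have "reduced_prod a (inv' a \<circ> w) \<longleftrightarrow> inversions (inv' w \<circ> a) \<inter> inversions a = {}"
    using reduced_prod_iff[OF a permutes_compose[OF w permutes_inv[OF a]]] by (simp add: i)
  also have "\<dots> \<longleftrightarrow> inversions (inv' a) \<subseteq> inversions (inv' w)"
  proof
    assume l: "inversions (inv' w \<circ> a) \<inter> inversions a = {}"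
    show "inversions (inv' a) \<subseteq> inversions (inv' w)"
    proof clarify
      fix p q assume pq: "(p, q) \<in> inversions (inv' a)"
      then have "(inv' a q, inv' a p) \<in> inversions a" by (auto simp: mem_inversions aa)
      with l have "(inv' a q, inv' a p) \<notin> inversions (inv' w \<circ> a)" by auto
      with pq ne[of p q] show "(p, q) \<in> inversions (inv' w)" by (auto simp: mem_inversions aa)
    qed
  next
    assume r: "inversions (inv' a) \<subseteq> inversions (inv' w)"
    have False if "(x, y) \<in> inversions (inv' w \<circ> a)" "(x, y) \<in> inversions a" for x y
    proof -
      have "(a y, a x) \<in> inversions (inv' a)" using that by (auto simp: mem_inversions aa)
      with r have "(a y, a x) \<in> inversions (inv' w)" by blast
      with that show False by (auto simp: mem_inversions)
    qed
    then show "inversions (inv' w \<circ> a) \<inter> inversions a = {}" by auto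
  qed
  finally show ?thesis .
qed

lemma inversions_id [simp]: "inversions id = {}" "perm_length id = 0"
proof -
  show "inversions id = {}" by (auto simp: inversions_def)
  then show "perm_length id = 0" by (simp add: perm_length_def)
qed

lemma reduced_prod_id [simp]: "reduced_prod id w" "reduced_prod w id"
  by (auto simp: reduced_prod_def)

lemma permutes_id_if_ascending:
  assumes w: "w permutes {1..n}" and asc: "\<And>i. i \<in> {1..<n} \<Longrightarrow> w i < w (Suc i)"
  shows "w = id"
proof -
  have ge: "i \<in> {1..n} \<Longrightarrow> i \<le> w i" for i
  proof (induction i)
    case (Suc i)
    show ?case
    proof (cases "i = 0")
      case True then show ?thesis using permutes_in_image[OF w, of 1] Suc by auto
    next
      case False
      then show ?thesis using Suc asc[of i] by auto
    qed
  qed simp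
  show ?thesis
  proof
    fix x show "w x = id x"
      using permutes_natset_ge[OF w] ge by simp
  qed
qed

lemma perm_length_eq_0:
  assumes w: "w permutes {1..n}"
  shows "perm_length w = 0 \<longleftrightarrow> w = id"
proof
  assume "perm_length w = 0"
  then have e: "inversions w = {}" using finite_inversions[OF w] by (simp add: perm_length_def)
  show "w = id"
  proof (rule permutes_id_if_ascending[OF w])
    fix i assume "i \<in> {1..<n}"
    have "w i \<noteq> w (Suc i)" using permutes_inj[OF w] by (metis injD n_not_Suc_n)
    moreover have "\<not> w (Suc i) < w i" using e by (auto simp: inversions_def)
    ultimately show "w i < w (Suc i)" by simp
  qed
qed simp

text \<open>\<open>I\<close> and its complement glue to a total order, whose rank function is the permutation.\<close>

lemma inversions_realise:
  fixes I :: "(nat \<times> nat) set"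
  assumes sub: "\<And>x y. (x, y) \<in> I \<Longrightarrow> x < y"
    and tr: "\<And>x y z. x \<in> {1..n} \<Longrightarrow> z \<in> {1..n} \<Longrightarrow> (x, y) \<in> I \<Longrightarrow> (y, z) \<in> I \<Longrightarrow> (x, z) \<in> I"
    and cotr: "\<And>x y z. x \<in> {1..n} \<Longrightarrow> z \<in> {1..n} \<Longrightarrow> x < y \<Longrightarrow> y < z \<Longrightarrow> (x, z) \<in> I \<Longrightarrow> (x, y) \<in> I \<or> (y, z) \<in> I"
  obtains p where "p permutes {1..n}" "inversions p = I \<inter> {1..n} \<times> {1..n}"
proof -
  define R where "R x y \<longleftrightarrow> (x < y \<and> (x, y) \<notin> I) \<or> (y < x \<and> (y, x) \<in> I)" for x y
  have irr: "\<not> R x x" for x by (auto simp: R_def)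
  have tot: "x \<noteq> y \<Longrightarrow> R x y \<or> R y x" for x y by (auto simp: R_def)
  have Rtr: "R x z" if "R x y" "R y z" "x \<in> {1..n}" "y \<in> {1..n}" "z \<in> {1..n}" for x y z
  proof (cases "x < y")
    case True
    then have xy: "(x, y) \<notin> I" using that sub by (fastforce simp: R_def)
    show ?thesis
    proof (cases "y < z")
      case True
      then have "(y, z) \<notin> I" using that sub by (fastforce simp: R_def)
      with xy True \<open>x < y\<close> cotr[OF that(3,5), of y] show ?thesis by (auto simp: R_def)
    next
      case False
      with that have yz: "z < y" "(z, y) \<in> I" by (auto simp: R_def)
      with xy \<open>x < y\<close> tr[OF that(3,4), of z] cotr[OF that(5,4), of x] show ?thesis
        by (cases x z rule: linorder_cases) (auto simp: R_def)
    qed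
  next
    case False
    with that have xy: "y < x" "(y, x) \<in> I" by (auto simp: R_def)
    show ?thesis
    proof (cases "y < z")
      case True
      then have "(y, z) \<notin> I" using that sub by (fastforce simp: R_def)
      with xy True tr[OF that(4,5), of x] cotr[OF that(4,3), of z] show ?thesis
        by (cases x z rule: linorder_cases) (auto simp: R_def)
    next
      case False
      with that have yz: "z < y" "(z, y) \<in> I" by (auto simp: R_def)
      with xy tr[OF that(5,3), of y] show ?thesis by (auto simp: R_def)
    qed
  qed
  define p where "p x = (if x \<in> {1..n} then Suc (card {y \<in> {1..n}. R y x}) else x)" for x
  have mono: "p x < p y" if "R x y" "x \<in> {1..n}" "y \<in> {1..n}" for x y
  proof -
    have "{z \<in> {1..n}. R z x} \<subset> {z \<in> {1..n}. R z y}"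
      using that Rtr irr by blast
    then have "card {z \<in> {1..n}. R z x} < card {z \<in> {1..n}. R z y}"
      by (intro psubset_card_mono) auto
    then show ?thesis using that by (simp add: p_def)
  qed
  have inj: "inj_on p {1..n}"
  proof (rule inj_onI)
    fix x y assume "x \<in> {1..n}" "y \<in> {1..n}" "p x = p y"
    then show "x = y" using tot[of x y] mono[of x y] mono[of y x] by auto
  qed
  have into: "p ` {1..n} \<subseteq> {1..n}"
  proof clarify
    fix x assume x: "x \<in> {1..n}"
    have "{y \<in> {1..n}. R y x} \<subset> {1..n}" using x irr by blast
    then have "card {y \<in> {1..n}. R y x} < card {1..n}" by (intro psubset_card_mono) auto
    then show "p x \<in> {1..n}" using x by (simp add: p_def)
  qed
  have "p permutes {1..n}"
    using bij_betw_imageI[OF inj] endo_inj_surj[OF _ into inj] 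
    by (auto simp: permutes_altdef p_def)
  moreover have "inversions p = I \<inter> {1..n} \<times> {1..n}"
  proof -
    have "(x, y) \<in> inversions p \<longleftrightarrow> (x, y) \<in> I" if "x \<in> {1..n}" "y \<in> {1..n}" for x y
      using mono[of x y] mono[of y x] tot[of x y] irr[of x] sub[of x y] that
      unfolding mem_inversions R_def by (metis less_imp_not_less less_irrefl)
    then show ?thesis using inversions_subset[OF \<open>p permutes {1..n}\<close>] by auto
  qed
  ultimately show ?thesis using that by blast
qed

text \<open>The point \<open>y\<close> sits at a node of the chain from \<open>x\<close> to
  \<open>z\<close> or strictly inside one of its steps, and cotransitivity of \<open>r\<close>
  splits that step.\<close>

lemma trancl_cotransitive:
  fixes r :: "('a :: linorder \<times> 'a) set"
  assumes sub: "\<And>x y. (x, y) \<in> r \<Longrightarrow> x < y"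
    and cotr: "\<And>x y z. x < y \<Longrightarrow> y < z \<Longrightarrow> (x, z) \<in> r \<Longrightarrow> (x, y) \<in> r \<or> (y, z) \<in> r"
    and "(x, z) \<in> r\<^sup>+" and "x < y" and "y < z"
  shows "(x, y) \<in> r\<^sup>+ \<or> (y, z) \<in> r\<^sup>+"
  using assms(3-5)
proof (induction z rule: trancl_induct)
  case (base z)
  then show ?case using cotr by blast
next
  case (step w z)
  show ?case
  proof (cases y w rule: linorder_cases)
    case less then show ?thesis using step trancl_into_trancl by metis
  next
    case equal then show ?thesis using step by auto
  next
    case greater
    then have "(w, y) \<in> r \<or> (y, z) \<in> r" using cotr step by blast
    then show ?thesis using step trancl_into_trancl by (metis r_into_trancl)
  qed
qed

text \<open>\<open>reduced_prod b (inv' b \<circ> w)\<close> says that \<open>b\<close> is a prefix of \<open>w\<close>, i.e. that \<open>b \<le> w\<close> in the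
  weak order.\<close>

definition is_greedy_prefix :: "nat \<Rightarrow> (nat \<Rightarrow> nat) \<Rightarrow> (nat \<Rightarrow> nat) \<Rightarrow> (nat \<Rightarrow> nat) \<Rightarrow> bool" where
  "is_greedy_prefix n u w a \<longleftrightarrow> a permutes {1..n} \<and> reduced_prod a (inv' a \<circ> w) \<and> reduced_prod u a \<and>
     (\<forall>b. b permutes {1..n} \<longrightarrow> reduced_prod b (inv' b \<circ> w) \<longrightarrow> reduced_prod u b
        \<longrightarrow> reduced_prod b (inv' b \<circ> a))"

text \<open>The pairs that are forbidden as inversions of the prefix generate a transitive and
  cotransitive relation; its complement is the inversion set of the greedy prefix.\<close>

lemma greedy_prefix_exists:
  assumes u: "u permutes {1..n}" and w: "w permutes {1..n}"
  shows "\<exists>a. is_greedy_prefix n u w a"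
proof -
  define D where "D = {(x, y). x \<in> {1..n} \<and> y \<in> {1..n} \<and> x < y}"
  \<comment> \<open>A pair is forbidden if \<open>inv' w\<close> does not invert it, since then the
    inverse of no prefix of \<open>w\<close> does, or if \<open>u\<close> inverts it, since then the
    lengths would not add up.\<close>
  define r where "r = (D - inversions (inv' w)) \<union> inversions u"
  have iw: "inv' w permutes {1..n}" by (rule permutes_inv[OF w])
  have sub: "(x, y) \<in> r \<Longrightarrow> x < y" for x y by (auto simp: r_def D_def mem_inversions)
  have rD: "r \<subseteq> D" using inversions_subset[OF u] by (auto simp: r_def D_def mem_inversions)
  have cotr: "(x, y) \<in> r \<or> (y, z) \<in> r" if "x < y" "y < z" "(x, z) \<in> r" for x y z
    using that rD by (auto simp: r_def D_def mem_inversions)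
  have tD: "(x, y) \<in> r\<^sup>+ \<Longrightarrow> (x, y) \<in> D" for x y
  proof (induction rule: trancl_induct)
    case (step y z) then show ?case using rD by (auto simp: D_def)
  qed (use rD in auto)
  have co: "(x, y) \<in> D - r\<^sup>+ \<or> (y, z) \<in> D - r\<^sup>+" if "x < y" "y < z" "(x, z) \<in> D - r\<^sup>+" for x y z
  proof -
    have "(x, y) \<in> D" "(y, z) \<in> D" using that by (auto simp: D_def)
    then show ?thesis using that by (auto intro: trancl_trans)
  qed
  \<comment> \<open>The two closure properties trade places under complement: cotransitivity of
    \<open>r\<^sup>+\<close> makes \<open>D - r\<^sup>+\<close> transitive, and transitivity makes
    it cotransitive.\<close>
  obtain p where p: "p permutes {1..n}" "inversions p = (D - r\<^sup>+) \<inter> {1..n} \<times> {1..n}"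
  proof (rule inversions_realise[of "D - r\<^sup>+" n])
    fix x y z assume xyz: "(x, y) \<in> D - r\<^sup>+" "(y, z) \<in> D - r\<^sup>+"
    then have lt: "x < y" "y < z" and xz: "(x, z) \<in> D" by (auto simp: D_def)
    have "(x, z) \<notin> r\<^sup>+"
    proof
      assume "(x, z) \<in> r\<^sup>+"
      from trancl_cotransitive[OF sub cotr this lt] xyz show False by blast
    qed
    with xz show "(x, z) \<in> D - r\<^sup>+" by blast
  next
    fix x y assume "(x, y) \<in> D - r\<^sup>+" then show "x < y" by (simp add: D_def)
  next
    fix x y z assume "x < y" "y < z" "(x, z) \<in> D - r\<^sup>+"
    then show "(x, y) \<in> D - r\<^sup>+ \<or> (y, z) \<in> D - r\<^sup>+" using co by blast
  qed
  have "D \<subseteq> {1..n} \<times> {1..n}" by (auto simp: D_def)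
  then have "(D - r\<^sup>+) \<inter> {1..n} \<times> {1..n} = D - r\<^sup>+" by fast
  with p(2) have ip: "inversions p = D - r\<^sup>+" by simp
  define a where "a = inv' p"
  have a: "a permutes {1..n}" "inv' a = p"
    using p(1) by (auto simp: a_def permutes_inv permutes_inv_inv)
  have rs: "D - inversions (inv' w) \<subseteq> r\<^sup>+" "inversions u \<subseteq> r\<^sup>+" by (auto simp: r_def)
  have "is_greedy_prefix n u w a"
    unfolding is_greedy_prefix_def
  proof (intro conjI allI impI)
    show "reduced_prod a (inv' a \<circ> w)"
      using reduced_prod_prefix_iff[OF a(1) w] rs(1) unfolding a(2) ip by blast
    show "reduced_prod u a"
      using reduced_prod_iff[OF u a(1)] rs(2) unfolding a(2) ip by blast
    fix b assume b: "b permutes {1..n}" "reduced_prod b (inv' b \<circ> w)" "reduced_prod u b"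
    have 1: "inversions (inv' b) \<subseteq> inversions (inv' w)" "inversions (inv' b) \<inter> inversions u = {}"
      using b reduced_prod_prefix_iff[OF b(1) w] reduced_prod_iff[OF u b(1)] by auto
    have nb: "inv' b x \<noteq> inv' b y" if "x \<noteq> y" for x y
      using permutes_inj[OF permutes_inv[OF b(1)]] that by (auto dest: injD)
    \<comment> \<open>For an admissible \<open>b\<close>, \<open>inv' b\<close> is increasing along
      every pair of \<open>r\<close>, hence along every chain of such pairs.\<close>
    have "(x, y) \<in> r\<^sup>+ \<Longrightarrow> (x, y) \<notin> inversions (inv' b)" for x y
    proof -
      have r: "inv' b x < inv' b y" if xy: "(x, y) \<in> r" for x y
      proof -
        have "x < y" by (rule sub[OF xy])
        moreover have "(x, y) \<notin> inversions (inv' b)" using xy 1 unfolding r_def by blast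
        ultimately show ?thesis using nb[of x y] by (simp add: mem_inversions)
      qed
      assume "(x, y) \<in> r\<^sup>+"
      then have "inv' b x < inv' b y"
      proof (induction rule: trancl_induct)
        case (base y) then show ?case by (rule r)
      next
        case (step y z) then show ?case using r[of y z] by simp
      qed
      then show ?thesis by (auto simp: mem_inversions)
    qed
    moreover have "inversions (inv' b) \<subseteq> D"
      using inversions_subset[OF permutes_inv[OF b(1)]] by (auto simp: D_def mem_inversions)
    ultimately have "inversions (inv' b) \<subseteq> D - r\<^sup>+" by (intro subrelI) blast
    then show "reduced_prod b (inv' b \<circ> a)"
      using reduced_prod_prefix_iff[OF b(1) a(1)] unfolding a(2) ip by simp
  qed (rule a)
  then show ?thesis by blast
qed

section \<open>Normal forms of sequences of permutations\<close>

lemma permutes_cancel: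
  assumes "b permutes S"
  shows "inv' b \<circ> (b \<circ> d) = d" "b \<circ> (inv' b \<circ> d) = d"
  using permutes_inv_o[OF assms] by (simp_all add: comp_assoc[symmetric])

lemma permutes_left_cancel: "b permutes S \<Longrightarrow> b \<circ> d = b \<circ> e \<longleftrightarrow> d = e"
  by (metis permutes_cancel(1))

definition greedy_prefix :: "nat \<Rightarrow> (nat \<Rightarrow> nat) \<Rightarrow> (nat \<Rightarrow> nat) \<Rightarrow> nat \<Rightarrow> nat" where
  "greedy_prefix n u w = (SOME a. is_greedy_prefix n u w a)"

text \<open>Prefixes are rephrased as left factors in reduced factorisations
  \<open>w = b \<circ> d\<close>, the form to which \<open>reduced_prod_assoc\<close>
  applies.\<close>

lemma greedy_prefixE:
  assumes u: "u permutes {1..n}" and w: "w permutes {1..n}"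
  obtains a c where "greedy_prefix n u w = a" "inv' a \<circ> w = c" "a permutes {1..n}" "c permutes {1..n}"
    "w = a \<circ> c" "reduced_prod a c" "reduced_prod u a"
    "\<forall>b d. b permutes {1..n} \<longrightarrow> w = b \<circ> d \<longrightarrow> reduced_prod b d \<longrightarrow> reduced_prod u b
       \<longrightarrow> (\<exists>e. e permutes {1..n} \<and> a = b \<circ> e \<and> reduced_prod b e)"
proof
  let ?a = "greedy_prefix n u w"
  have g: "is_greedy_prefix n u w ?a"
    unfolding greedy_prefix_def by (rule someI_ex[OF greedy_prefix_exists[OF u w]])
  show a: "?a permutes {1..n}" and "reduced_prod ?a (inv' ?a \<circ> w)" "reduced_prod u ?a"
    using g by (auto simp: is_greedy_prefix_def)
  show "w = ?a \<circ> (inv' ?a \<circ> w)" by (simp add: permutes_cancel[OF a])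
  show "inv' ?a \<circ> w permutes {1..n}" by (intro permutes_compose w permutes_inv a)
  show "\<forall>b d. b permutes {1..n} \<longrightarrow> w = b \<circ> d \<longrightarrow> reduced_prod b d \<longrightarrow> reduced_prod u b
      \<longrightarrow> (\<exists>e. e permutes {1..n} \<and> ?a = b \<circ> e \<and> reduced_prod b e)"
  proof (intro allI impI)
    fix b d assume b: "b permutes {1..n}" "w = b \<circ> d" "reduced_prod b d" "reduced_prod u b"
    then have "reduced_prod b (inv' b \<circ> ?a)"
      using g by (auto simp: is_greedy_prefix_def permutes_cancel)
    then show "\<exists>e. e permutes {1..n} \<and> ?a = b \<circ> e \<and> reduced_prod b e"
      using permutes_cancel(2)[OF b(1)] permutes_compose[OF a permutes_inv[OF b(1)]] by metis
  qed
qed (rule HOL.refl)+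

text \<open>The test at the end of the list discards a remainder that has become trivial, because a
  normal form must not end in the identity.\<close>

primrec perm_act :: "nat \<Rightarrow> (nat \<Rightarrow> nat) \<Rightarrow> (nat \<Rightarrow> nat) list \<Rightarrow> (nat \<Rightarrow> nat) list" where
  "perm_act n u [] = (if u = id then [] else [u])"
| "perm_act n u (w # L) = (u \<circ> greedy_prefix n u w) # perm_act n (inv' (greedy_prefix n u w) \<circ> w) L"

declare perm_act.simps(2) [simp del]

abbreviation perms :: "nat \<Rightarrow> (nat \<Rightarrow> nat) set" where
  "perms n \<equiv> {p. p permutes {1..n}}"

lemma perm_act_Cons:
  assumes u: "u permutes {1..n}" and w: "w permutes {1..n}"
  obtains a c where "perm_act n u (w # L) = (u \<circ> a) # perm_act n c L"
    "a permutes {1..n}" "c permutes {1..n}"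
    "w = a \<circ> c" "reduced_prod a c" "reduced_prod u a"
    "\<forall>b d. b permutes {1..n} \<longrightarrow> w = b \<circ> d \<longrightarrow> reduced_prod b d \<longrightarrow> reduced_prod u b
       \<longrightarrow> (\<exists>e. e permutes {1..n} \<and> a = b \<circ> e \<and> reduced_prod b e)"
  by (rule greedy_prefixE[OF u w]) (metis perm_act.simps(2))

lemma perm_act_lists:
  assumes "u permutes {1..n}" "L \<in> lists (perms n)"
  shows "perm_act n u L \<in> lists (perms n)"
  using assms
proof (induction L arbitrary: u)
  case (Cons w L)
  then have w: "w permutes {1..n}" by simp
  show ?case
    by (rule perm_act_Cons[OF Cons.prems(1) w, of L])
      (use Cons in \<open>auto intro: permutes_compose\<close>)
qed auto

lemma reduced_prod_length_0:
  assumes "u permutes {1..n}" "v permutes {1..n}" "reduced_prod u v" "perm_length (u \<circ> v) \<le> perm_length u"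
  shows "v = id"
  using assms perm_length_eq_0[of v n] by (auto simp: reduced_prod_def)

text \<open>Both sides multiply \<open>u v\<close> by the same greedy prefix: the one for \<open>u\<close> and the head \<open>v a\<close> of the inner
  result contains \<open>v\<close>, and what it has beyond \<open>v\<close> is the greedy prefix for \<open>u v\<close>.\<close>

lemma perm_act_compose:
  assumes "u permutes {1..n}" "v permutes {1..n}" "reduced_prod u v" "L \<in> lists (perms n)"
  shows "perm_act n u (perm_act n v L) = perm_act n (u \<circ> v) L"
  using assms
proof (induction L arbitrary: u v)
  case Nil
  show ?case
  proof (cases "v = id")
    case False
    \<comment> \<open>Here \<open>v\<close> itself is an admissible prefix of \<open>v\<close>, so
      the greedy prefix is all of \<open>v\<close> and nothing remains.\<close>
    obtain a c where ac: "perm_act n u [v] = (u \<circ> a) # perm_act n c []"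
      "a permutes {1..n}" "c permutes {1..n}" "v = a \<circ> c" "reduced_prod a c" "reduced_prod u a"
      and mx: "\<forall>b d. b permutes {1..n} \<longrightarrow> v = b \<circ> d \<longrightarrow> reduced_prod b d \<longrightarrow> reduced_prod u b
       \<longrightarrow> (\<exists>e. e permutes {1..n} \<and> a = b \<circ> e \<and> reduced_prod b e)"
      by (rule perm_act_Cons[OF Nil.prems(1,2), of "[]"]) (rule that)
    obtain e where e: "e permutes {1..n}" "a = v \<circ> e" "reduced_prod v e"
      using mx[rule_format, of v id] Nil.prems by auto
    have "perm_length v \<le> perm_length a" using e(2,3) by (simp add: reduced_prod_def)
    then have "c = id" using reduced_prod_length_0[OF ac(2,3,5)] ac(4) by simp
    moreover have "u \<circ> v \<noteq> id"
      using Nil.prems False perm_length_eq_0[of v n] by (auto simp: reduced_prod_def)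
    moreover have "a = v" using ac(4) \<open>c = id\<close> by simp
    ultimately show ?thesis using ac(1) False unfolding perm_act.simps(1) by metis
  next
    case True
    show ?thesis unfolding True perm_act.simps(1) by simp
  qed
next
  case (Cons w L)
  note u = Cons.prems(1) and v = Cons.prems(2) and uv = Cons.prems(3)
  from Cons.prems have w: "w permutes {1..n}" and L: "L \<in> lists (perms n)" by auto
  note cl = permutes_compose[where S = "{1..n}"]
  have uvp: "u \<circ> v permutes {1..n}" by (rule cl[OF v u])
  obtain a c where act1: "perm_act n v (w # L) = (v \<circ> a) # perm_act n c L"
    and ac: "a permutes {1..n}" "c permutes {1..n}" "w = a \<circ> c" "reduced_prod a c" "reduced_prod v a"
    and mx1: "\<forall>b d. b permutes {1..n} \<longrightarrow> w = b \<circ> d \<longrightarrow> reduced_prod b d \<longrightarrow> reduced_prod v b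
       \<longrightarrow> (\<exists>e. e permutes {1..n} \<and> a = b \<circ> e \<and> reduced_prod b e)"
    by (rule perm_act_Cons[OF v w, of L]) (rule that)
  have va: "v \<circ> a permutes {1..n}" by (rule cl[OF ac(1) v])
  obtain b c2 where act2: "perm_act n u ((v \<circ> a) # perm_act n c L) = (u \<circ> b) # perm_act n c2 (perm_act n c L)"
    and b: "b permutes {1..n}" "c2 permutes {1..n}" "v \<circ> a = b \<circ> c2" "reduced_prod b c2" "reduced_prod u b"
    and mx2: "\<forall>b' d. b' permutes {1..n} \<longrightarrow> v \<circ> a = b' \<circ> d \<longrightarrow> reduced_prod b' d \<longrightarrow> reduced_prod u b'
       \<longrightarrow> (\<exists>e. e permutes {1..n} \<and> b = b' \<circ> e \<and> reduced_prod b' e)"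
    by (rule perm_act_Cons[OF u va, of "perm_act n c L"]) (rule that)
  obtain d c3 where act3: "perm_act n (u \<circ> v) (w # L) = (u \<circ> v \<circ> d) # perm_act n c3 L"
    and d: "d permutes {1..n}" "c3 permutes {1..n}" "w = d \<circ> c3" "reduced_prod d c3" "reduced_prod (u \<circ> v) d"
    and mx3: "\<forall>b' e. b' permutes {1..n} \<longrightarrow> w = b' \<circ> e \<longrightarrow> reduced_prod b' e \<longrightarrow> reduced_prod (u \<circ> v) b'
       \<longrightarrow> (\<exists>e. e permutes {1..n} \<and> d = b' \<circ> e \<and> reduced_prod b' e)"
    by (rule perm_act_Cons[OF uvp w, of L]) (rule that)
  have vd: "reduced_prod v d" "reduced_prod u (v \<circ> d)"
    using reduced_prod_assoc[OF u v d(1)] uv d(5) by auto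
  \<comment> \<open>Since \<open>d\<close> is a prefix of \<open>w\<close> whose length adds to that
    of \<open>v\<close>, the greatest such prefix \<open>a\<close> begins with \<open>d\<close>.
    Likewise \<open>b\<close> begins with \<open>v \<circ> d\<close>.\<close>
  obtain e where e: "e permutes {1..n}" "a = d \<circ> e" "reduced_prod d e"
    using mx1[rule_format, OF d(1,3,4) vd(1)] by blast
  have "reduced_prod (v \<circ> d) e"
    using reduced_prod_assoc[OF v d(1) e(1)] e ac vd by auto
  then obtain f where f: "f permutes {1..n}" "b = v \<circ> d \<circ> f" "reduced_prod (v \<circ> d) f"
    using mx2[rule_format, of "v \<circ> d" e] vd cl[OF d(1) v] e by (auto simp: comp_assoc)
  have a_eq: "a = d \<circ> f \<circ> c2"
    using b(3) f(2) by (simp add: comp_assoc permutes_left_cancel[OF v])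
  have df: "d \<circ> f permutes {1..n}" by (rule cl[OF f(1) d(1)])
  have v_df: "reduced_prod d f" "reduced_prod v (d \<circ> f)"
    using reduced_prod_assoc[OF v d(1) f(1)] vd f by auto
  have 1: "reduced_prod (d \<circ> f) c2"
    using reduced_prod_assoc[OF v df b(2)] b(4) f(2) v_df by (simp add: comp_assoc)
  have 2: "reduced_prod (d \<circ> f) (c2 \<circ> c)"
    using reduced_prod_assoc[OF df b(2) ac(2)] 1 ac(4) a_eq by auto
  have 3: "reduced_prod (u \<circ> v) (d \<circ> f)"
    using reduced_prod_assoc[OF u v df] uv v_df b(5) f(2) by (simp add: comp_assoc)
  \<comment> \<open>Conversely \<open>d \<circ> f\<close> is admissible for
    \<open>u \<circ> v\<close>, so the greatest prefix \<open>d\<close> begins with it; comparing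
    lengths leaves \<open>f = id\<close>.\<close>
  obtain g where g: "g permutes {1..n}" "d = d \<circ> f \<circ> g" "reduced_prod (d \<circ> f) g"
    using mx3[rule_format, OF df _ 2 3] ac(3) a_eq by (auto simp: comp_assoc)
  have "perm_length (d \<circ> f) \<le> perm_length d"
    using g(3) unfolding reduced_prod_def g(2)[symmetric] by simp
  then have "f = id" by (rule reduced_prod_length_0[OF d(1) f(1) v_df(1)])
  then have bd: "b = v \<circ> d" and c2e: "c2 = e"
    using f(2) a_eq e(2) by (auto simp: permutes_left_cancel[OF d(1)])
  have c3: "c3 = e \<circ> c"
    using d(3) ac(3) e(2) by (simp add: comp_assoc permutes_left_cancel[OF d(1)])
  have "reduced_prod e c"
    using reduced_prod_assoc[OF d(1) e(1) ac(2)] e ac by auto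
  from Cons.IH[OF e(1) ac(2) this L] show ?case
    unfolding act1 act2 act3 unfolding bd c2e c3 comp_assoc by (rule arg_cong)
qed

text \<open>Every prefix is admissible for \<open>id\<close>, so the greedy prefix is the whole
  entry and the remainder \<open>id\<close> is passed on.\<close>

lemma perm_act_id: "L \<in> lists (perms n) \<Longrightarrow> perm_act n id L = L"
proof (induction L)
  case (Cons w L)
  then have w: "w permutes {1..n}" by simp
  obtain a c where ac: "perm_act n id (w # L) = (id \<circ> a) # perm_act n c L"
    "a permutes {1..n}" "c permutes {1..n}" "w = a \<circ> c" "reduced_prod a c"
    and mx: "\<forall>b d. b permutes {1..n} \<longrightarrow> w = b \<circ> d \<longrightarrow> reduced_prod b d \<longrightarrow> reduced_prod id b
       \<longrightarrow> (\<exists>e. e permutes {1..n} \<and> a = b \<circ> e \<and> reduced_prod b e)"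
    by (rule perm_act_Cons[OF permutes_id w, of L]) (rule that)
  obtain e where e: "e permutes {1..n}" "a = w \<circ> e" "reduced_prod w e"
    using mx[rule_format, of w id] w by auto
  have "perm_length w \<le> perm_length a" using e(2,3) by (simp add: reduced_prod_def)
  then have "c = id" using reduced_prod_length_0[OF ac(2,3,5)] ac(4) by simp
  then have "a = w" using ac(4) by simp
  moreover have "perm_act n id L = L" by (rule Cons.IH) (use Cons.prems in simp)
  ultimately show ?case using ac(1) \<open>c = id\<close> by (metis id_comp)
qed simp

lemma length_perm_act_le: "length (perm_act n u L) \<le> Suc (length L)"
  by (induction L arbitrary: u) (auto simp: perm_act.simps)

text \<open>The gcd condition is encoded as a fixed point: the head, acting on the tail, merely
  prepends itself. Preservation of normality can then be derived from the composition law.\<close>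

primrec normal_list :: "nat \<Rightarrow> (nat \<Rightarrow> nat) list \<Rightarrow> bool" where
  "normal_list n [] \<longleftrightarrow> True"
| "normal_list n (w # L) \<longleftrightarrow> w permutes {1..n} \<and> w \<noteq> id \<and> normal_list n L \<and> perm_act n w L = w # L"

lemma normal_list_lists: "normal_list n L \<Longrightarrow> L \<in> lists (perms n)"
  by (induction L) auto

text \<open>The new head \<open>u \<circ> a\<close> acting on the new tail is \<open>u\<close>
  acting after \<open>a\<close> after \<open>c\<close> on \<open>L\<close>. As
  \<open>a \<circ> c = w\<close> and \<open>w\<close> acting on \<open>L\<close> gives
  \<open>w # L\<close>, this is \<open>u\<close> acting on \<open>w # L\<close>, the list in
  question.\<close>

lemma normal_list_perm_act:
  assumes "u permutes {1..n}" "normal_list n L"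
  shows "normal_list n (perm_act n u L)"
  using assms
proof (induction L arbitrary: u)
  case (Cons w L)
  note u = Cons.prems(1)
  from Cons.prems have w: "w permutes {1..n}" "w \<noteq> id" "normal_list n L" "perm_act n w L = w # L" by auto
  note L = normal_list_lists[OF w(3)]
  obtain a c where act: "perm_act n u (w # L) = (u \<circ> a) # perm_act n c L"
    and ac: "a permutes {1..n}" "c permutes {1..n}" "w = a \<circ> c" "reduced_prod a c" "reduced_prod u a"
    and mx: "\<forall>b d. b permutes {1..n} \<longrightarrow> w = b \<circ> d \<longrightarrow> reduced_prod b d \<longrightarrow> reduced_prod u b
       \<longrightarrow> (\<exists>e. e permutes {1..n} \<and> a = b \<circ> e \<and> reduced_prod b e)"
    by (rule perm_act_Cons[OF u w(1), of L]) (rule that)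
  have "perm_act n (u \<circ> a) (perm_act n c L) = perm_act n u (perm_act n a (perm_act n c L))"
    using perm_act_compose[OF u ac(1,5) perm_act_lists[OF ac(2) L]] by simp
  also have "\<dots> = perm_act n u (w # L)"
    using perm_act_compose[OF ac(1,2,4) L] ac(3) w(4) by simp
  finally have "perm_act n (u \<circ> a) (perm_act n c L) = (u \<circ> a) # perm_act n c L" using act by simp
  \<comment> \<open>Lengths add, so both \<open>u\<close> and \<open>a\<close> would be
    \<open>id\<close>. But for \<open>u = id\<close> all of \<open>w\<close> is admissible, so
    \<open>a\<close> is at least as long as \<open>w\<close>, which is nontrivial.\<close>
  moreover have "u \<circ> a \<noteq> id"
  proof
    assume "u \<circ> a = id"
    then have "u = id" "a = id"
      using ac(5) perm_length_eq_0[OF u] perm_length_eq_0[OF ac(1)] by (auto simp: reduced_prod_def)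
    moreover obtain e where "e permutes {1..n}" "a = w \<circ> e" "reduced_prod w e"
      using mx[rule_format, of w id] w(1) \<open>u = id\<close> by auto
    ultimately show False using w(1,2) perm_length_eq_0[OF w(1)] by (auto simp: reduced_prod_def)
  qed
  ultimately show ?case
    using act Cons.IH[OF ac(2) w(3)] permutes_compose[OF ac(1) u] by simp
qed (auto simp: perm_act.simps)

text \<open>The head takes nothing exactly when the greedy prefix of its neighbour is
  \<open>id\<close>, and an untouched neighbour leaves the rest untouched. So only adjacent entries
  interact, which is what a finite automaton can check.\<close>

lemma normal_list_Cons_iff:
  assumes w: "w permutes {1..n}" and v: "v permutes {1..n}"
  shows "normal_list n (w # v # L) \<longleftrightarrow> w \<noteq> id \<and> normal_list n (v # L) \<and>
    (\<forall>b d. b permutes {1..n} \<longrightarrow> v = b \<circ> d \<longrightarrow> reduced_prod b d \<longrightarrow> reduced_prod w b \<longrightarrow> b = id)"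
    (is "_ \<longleftrightarrow> _ \<and> _ \<and> ?M")
proof -
  obtain a c where act: "perm_act n w (v # L) = (w \<circ> a) # perm_act n c L"
    and ac: "a permutes {1..n}" "c permutes {1..n}" "v = a \<circ> c" "reduced_prod a c" "reduced_prod w a"
    and mx: "\<forall>b d. b permutes {1..n} \<longrightarrow> v = b \<circ> d \<longrightarrow> reduced_prod b d \<longrightarrow> reduced_prod w b
       \<longrightarrow> (\<exists>e. e permutes {1..n} \<and> a = b \<circ> e \<and> reduced_prod b e)"
    by (rule perm_act_Cons[OF w v, of L]) (rule that)
  have "perm_act n w (v # L) = w # v # L \<longleftrightarrow> a = id" if "normal_list n (v # L)"
  proof
    assume "perm_act n w (v # L) = w # v # L"
    then have "w \<circ> a = w" using act by simp
    then show "a = id" using permutes_left_cancel[OF w, of a id] by simp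
  qed (use act ac that in simp)
  moreover have "a = id \<longleftrightarrow> ?M"
  proof
    assume "a = id"
    show ?M
    proof (intro allI impI)
      fix b d assume b: "b permutes {1..n}" "v = b \<circ> d" "reduced_prod b d" "reduced_prod w b"
      then obtain e where e: "b \<circ> e = id" "reduced_prod b e"
        using mx[rule_format, OF b] \<open>a = id\<close> by metis
      have "perm_length b = 0" using e(2) unfolding reduced_prod_def e(1) by simp
      then show "b = id" using perm_length_eq_0[OF b(1)] by simp
    qed
  next
    assume m: ?M
    show "a = id" by (rule m[rule_format, OF ac(1,3,4,5)])
  qed
  ultimately show ?thesis using w by auto
qed

section \<open>Reduced words\<close>

declare One_nat_def [simp del]

abbreviation adj :: "nat \<Rightarrow> nat \<Rightarrow> nat" where
  "adj i \<equiv> transpose i (Suc i)"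

lemma word_perm_simps [simp]:
  "word_perm [] = id" "word_perm (i # w) = adj i \<circ> word_perm w"
  by (simp_all add: word_perm_def One_nat_def)

lemma word_perm_append: "word_perm (u @ v) = word_perm u \<circ> word_perm v"
  by (induction u) (simp_all add: comp_assoc)

lemma adj_permutes: "i \<in> {1..<n} \<Longrightarrow> adj i permutes {1..n}"
  by (intro permutes_swap_id) auto

lemma adj_neq_id: "adj i \<noteq> id"
  by (metis id_apply n_not_Suc_n transpose_apply_first)

lemma word_perm_permutes: "w \<in> lists {1..<n} \<Longrightarrow> word_perm w permutes {1..n}"
proof (induction w)
  case (Cons i w)
  have "adj i \<circ> word_perm w permutes {1..n}"
    by (rule permutes_compose[OF Cons.IH adj_permutes]) (use Cons.prems in auto)
  then show "word_perm (i # w) permutes {1..n}" by simp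
qed simp

lemma inversions_adj: "inversions (adj i) = {(i, Suc i)}"
  by (auto simp: inversions_def transpose_def split: if_splits)

lemma perm_length_adj [simp]: "perm_length (adj i) = 1"
  by (simp add: perm_length_def inversions_adj)

lemma inv_adj_comp: "w permutes S \<Longrightarrow> inv' (adj i \<circ> w) = inv' w \<circ> adj i"
  by (simp add: o_inv_distrib permutes_bij)

lemma inv_neq: "w permutes S \<Longrightarrow> inv' w i \<noteq> inv' w (Suc i)"
  by (metis n_not_Suc_n permutes_inverses(1))

lemma reduced_prod_adj_left_iff:
  assumes "i \<in> {1..<n}" and w: "w permutes {1..n}"
  shows "reduced_prod (adj i) w \<longleftrightarrow> inv' w i < inv' w (Suc i)"
  using reduced_prod_iff[OF adj_permutes[OF assms(1)] w] inv_neq[OF w, of i]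
  by (auto simp: inversions_adj mem_inversions)

lemma reduced_prod_adj_right_iff:
  assumes "i \<in> {1..<n}" and w: "w permutes {1..n}"
  shows "reduced_prod w (adj i) \<longleftrightarrow> w i < w (Suc i)"
proof -
  have "w i \<noteq> w (Suc i)" using permutes_inj[OF w] by (metis injD n_not_Suc_n)
  then show ?thesis
    using reduced_prod_iff[OF w adj_permutes[OF assms(1)]]
    by (auto simp: inversions_adj mem_inversions)
qed

lemma adj_cancel [simp]: "adj i \<circ> (adj i \<circ> w) = w" "w \<circ> adj i \<circ> adj i = w"
  by (simp_all add: comp_assoc[symmetric]) (simp add: comp_assoc)

lemma reduced_prod_adj_left_cancel:
  assumes "i \<in> {1..<n}" and w: "w permutes {1..n}"
  shows "reduced_prod (adj i) (adj i \<circ> w) \<longleftrightarrow> inv' w (Suc i) < inv' w i"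
  using reduced_prod_adj_left_iff[OF assms(1) permutes_compose[OF w adj_permutes[OF assms(1)]]]
  by (simp add: inv_adj_comp[OF w])

lemma reduced_prod_adj_right_cancel:
  assumes "i \<in> {1..<n}" and w: "w permutes {1..n}"
  shows "reduced_prod (w \<circ> adj i) (adj i) \<longleftrightarrow> w (Suc i) < w i"
  using reduced_prod_adj_right_iff[OF assms(1) permutes_compose[OF adj_permutes[OF assms(1)] w]]
  by simp

lemma left_descent_iff:
  assumes "i \<in> {1..<n}" and w: "w permutes {1..n}"
  shows "inv' w (Suc i) < inv' w i \<longleftrightarrow> (\<exists>c. c permutes {1..n} \<and> w = adj i \<circ> c \<and> reduced_prod (adj i) c)"
proof
  assume "inv' w (Suc i) < inv' w i"
  then show "\<exists>c. c permutes {1..n} \<and> w = adj i \<circ> c \<and> reduced_prod (adj i) c"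
    using reduced_prod_adj_left_cancel[OF assms] permutes_compose[OF w adj_permutes[OF assms(1)]]
    by (intro exI[of _ "adj i \<circ> w"]) simp
next
  assume "\<exists>c. c permutes {1..n} \<and> w = adj i \<circ> c \<and> reduced_prod (adj i) c"
  then show "inv' w (Suc i) < inv' w i" using reduced_prod_adj_left_cancel[OF assms] by auto
qed

lemma exists_left_descent:
  assumes w: "w permutes {1..n}" and "w \<noteq> id"
  obtains i where "i \<in> {1..<n}" "inv' w (Suc i) < inv' w i"
proof -
  have "inv' w \<noteq> id" using assms(2) permutes_inv_inv[OF w] by (metis inv_id)
  then obtain i where "i \<in> {1..<n}" "\<not> inv' w i < inv' w (Suc i)"
    using permutes_id_if_ascending[OF permutes_inv[OF w]] by blast
  with inv_neq[OF w, of i] that show ?thesis by (meson linorder_neqE_nat)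
qed

definition reduced_word :: "nat list \<Rightarrow> bool" where
  "reduced_word w \<longleftrightarrow> perm_length (word_perm w) = length w"

lemma perm_length_word_perm_le:
  "w \<in> lists {1..<n} \<Longrightarrow> perm_length (word_perm w) \<le> length w"
proof (induction w)
  case (Cons i w)
  then have "perm_length (adj i \<circ> word_perm w) \<le> 1 + length w"
    using perm_length_compose_le[OF adj_permutes word_perm_permutes, of i n w] by simp
  then show "perm_length (word_perm (i # w)) \<le> length (i # w)" by simp
qed simp

lemma reduced_word_append_iff:
  assumes u: "u \<in> lists {1..<n}" and v: "v \<in> lists {1..<n}"
  shows "reduced_word (u @ v) \<longleftrightarrow>
    reduced_word u \<and> reduced_word v \<and> reduced_prod (word_perm u) (word_perm v)"
  using perm_length_word_perm_le[OF u] perm_length_word_perm_le[OF v]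
    perm_length_compose_le[OF word_perm_permutes[OF u] word_perm_permutes[OF v]]
  by (auto simp: reduced_word_def word_perm_append reduced_prod_def)

lemma reduced_word_Cons_iff:
  assumes "i \<in> {1..<n}" and "v \<in> lists {1..<n}"
  shows "reduced_word (i # v) \<longleftrightarrow> reduced_word v \<and> reduced_prod (adj i) (word_perm v)"
  using reduced_word_append_iff[of "[i]" n v] assms by (simp add: reduced_word_def)

lemma reduced_word_Nil [simp]: "reduced_word []"
  by (simp add: reduced_word_def)

lemma reduced_word_exists:
  "w permutes {1..n} \<Longrightarrow> \<exists>z \<in> lists {1..<n}. word_perm z = w \<and> reduced_word z"
proof (induction "perm_length w" arbitrary: w rule: less_induct)
  case less
  show ?case
  proof (cases "w = id")
    case True
    then show ?thesis by (intro bexI[of _ "[]"]) auto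
  next
    case False
    obtain i where i: "i \<in> {1..<n}" "inv' w (Suc i) < inv' w i"
      using exists_left_descent[OF less.prems False] by blast
    then obtain c where c: "c permutes {1..n}" "w = adj i \<circ> c" "reduced_prod (adj i) c"
      using left_descent_iff[OF i(1) less.prems] by blast
    then obtain z where z: "z \<in> lists {1..<n}" "word_perm z = c" "reduced_word z"
      using less.hyps[OF _ c(1)] by (auto simp: reduced_prod_def)
    then show ?thesis
      using c i reduced_word_Cons_iff[OF i(1) z(1)] by (intro bexI[of _ "i # z"]) auto
  qed
qed

section \<open>The braid congruence, its invariants, and the action of words\<close>

abbreviation braid_cong :: "nat \<Rightarrow> (nat list \<times> nat list) set" where
  "braid_cong n \<equiv> word_cong {1..<n} (braid_relations n)"

lemma word_cong_lists: "(u, v) \<in> word_cong A R \<Longrightarrow> u \<in> lists A \<and> v \<in> lists A"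
  by (induction rule: word_cong.induct) auto

lemma equiv_word_cong: "equiv (lists A) (word_cong A R)"
proof (rule equivI)
  show "word_cong A R \<subseteq> lists A \<times> lists A" using word_cong_lists by (intro subrelI) blast
  show "refl_on (lists A) (word_cong A R)" by (auto simp: refl_on_def intro: word_cong.refl)
  show "sym (word_cong A R)" by (rule symI) (rule word_cong.sym)
  show "trans (word_cong A R)" by (rule transI) (rule word_cong.trans)
qed

lemma word_cong_append:
  assumes "(u, u') \<in> word_cong A R" "(v, v') \<in> word_cong A R"
  shows "(u @ v, u' @ v') \<in> word_cong A R"
proof -
  have "u \<in> lists A" "v' \<in> lists A" "v \<in> lists A" "u' \<in> lists A" using assms word_cong_lists by blast+
  then show ?thesis
    using word_cong.ctxt[OF assms(1), of "[]" v] word_cong.ctxt[OF assms(2), of u' "[]"]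
    by (auto intro: word_cong.trans)
qed

lemma reduced_word_two:
  assumes i: "i \<in> {1..<n}" and j: "j \<in> {1..<n}" and "i \<noteq> j"
  shows "reduced_word [i, j]"
proof -
  have "reduced_word [j]" by (simp add: reduced_word_def)
  moreover have "reduced_prod (adj i) (adj j)"
    unfolding reduced_prod_adj_left_iff[OF i adj_permutes[OF j]] using \<open>i \<noteq> j\<close>
    by (auto simp: transpose_def)
  ultimately show ?thesis using reduced_word_Cons_iff[OF i, of "[j]"] j by simp
qed

lemma reduced_word_three:
  assumes i: "i \<in> {1..<n}" and j: "j \<in> {1..<n}" and ij: "j = Suc i \<or> i = Suc j"
  shows "reduced_word [i, j, i]"
proof -
  have "reduced_prod (adj i) (adj j \<circ> adj i)"
    unfolding reduced_prod_adj_left_iff[OF i permutes_compose[OF adj_permutes[OF i] adj_permutes[OF j]]]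
      inv_adj_comp[OF adj_permutes[OF i]] using ij by (auto simp: transpose_def)
  then show ?thesis
    using reduced_word_Cons_iff[OF i, of "[j, i]"] reduced_word_two[OF j i] i j ij by auto
qed

text \<open>That both sides are reduced words for one permutation is what allows the relations to be
  checked against the action on sequences.\<close>

lemma braid_relation_words:
  assumes "(u, v) \<in> braid_relations n"
  shows "u \<in> lists {1..<n} \<and> v \<in> lists {1..<n} \<and> word_perm u = word_perm v \<and> length u = length v
    \<and> reduced_word u \<and> reduced_word v"
  using assms unfolding braid_relations_def
proof (elim UnE CollectE exE conjE)
  fix i assume "(u, v) = ([i, i + 1, i], [i + 1, i, i + 1])" and i: "1 \<le> i" "i + 1 < n"
  then have uv: "u = [i, Suc i, i]" "v = [Suc i, i, Suc i]" by auto
  have mem: "i \<in> {1..<n}" "Suc i \<in> {1..<n}" using i by auto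
  have p: "word_perm u = word_perm v"
    by (rule ext) (simp add: uv transpose_def)
  have r: "reduced_word u" "reduced_word v"
    using reduced_word_three[OF mem] reduced_word_three[OF mem(2,1)] by (auto simp: uv)
  show ?thesis using mem p r by (simp add: uv)
next
  fix i j assume "(u, v) = ([i, j], [j, i])" and ij: "i \<in> {1..<n}" "j \<in> {1..<n}" "i + 2 \<le> j \<or> j + 2 \<le> i"
  then have uv: "u = [i, j]" "v = [j, i]" by auto
  have p: "word_perm u = word_perm v"
    by (rule ext) (use ij in \<open>auto simp: uv transpose_def\<close>)
  have r: "reduced_word u" "reduced_word v"
    using reduced_word_two[OF ij(1,2)] reduced_word_two[OF ij(2,1)] ij(3) by (auto simp: uv)
  show ?thesis using ij p r by (simp add: uv)
qed

text \<open>The permutation yields the map \<open>\<pi>\<close>, and the length grades the monoid.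
  Together they show that only reduced words are congruent to a reduced word.\<close>

lemma braid_cong_invariants:
  "(u, v) \<in> braid_cong n \<Longrightarrow> word_perm u = word_perm v \<and> length u = length v"
  by (induction rule: word_cong.induct) (auto dest: braid_relation_words simp: word_perm_append)

lemma braid_relation_cong:
  assumes "(u, v) \<in> braid_relations n \<or> (v, u) \<in> braid_relations n"
  shows "u \<in> lists {1..<n} \<and> v \<in> lists {1..<n} \<and> word_perm u = word_perm v
    \<and> reduced_word u \<and> reduced_word v \<and> (u, v) \<in> braid_cong n"
  using assms
proof
  assume r: "(u, v) \<in> braid_relations n"
  note b = braid_relation_words[OF r]
  then have "(u, v) \<in> braid_cong n" by (blast intro: word_cong.rel[OF r])
  with b show ?thesis by simp
next
  assume r: "(v, u) \<in> braid_relations n"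
  note b = braid_relation_words[OF r]
  then have "(u, v) \<in> braid_cong n" by (blast intro: word_cong.sym[OF word_cong.rel[OF r]])
  with b show ?thesis by simp
qed

definition word_act :: "nat \<Rightarrow> nat list \<Rightarrow> (nat \<Rightarrow> nat) list \<Rightarrow> (nat \<Rightarrow> nat) list" where
  "word_act n w L = foldr (\<lambda>i. perm_act n (adj i)) w L"

lemma word_act_simps [simp]:
  "word_act n [] L = L" "word_act n (i # w) L = perm_act n (adj i) (word_act n w L)"
  "word_act n (u @ v) L = word_act n u (word_act n v L)"
  by (simp_all add: word_act_def)

lemma word_act_normal:
  "w \<in> lists {1..<n} \<Longrightarrow> normal_list n L \<Longrightarrow> normal_list n (word_act n w L)"
  by (induction w) (auto intro!: normal_list_perm_act adj_permutes)

lemma word_act_lists: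
  "w \<in> lists {1..<n} \<Longrightarrow> L \<in> lists (perms n) \<Longrightarrow> word_act n w L \<in> lists (perms n)"
proof (induction w)
  case (Cons i w)
  then have "perm_act n (adj i) (word_act n w L) \<in> lists (perms n)"
    by (intro perm_act_lists adj_permutes Cons.IH) auto
  then show "word_act n (i # w) L \<in> lists (perms n)" by (simp only: word_act_simps)
qed simp

lemma word_act_reduced:
  "w \<in> lists {1..<n} \<Longrightarrow> reduced_word w \<Longrightarrow> L \<in> lists (perms n)
    \<Longrightarrow> word_act n w L = perm_act n (word_perm w) L"
proof (induction w)
  case Nil
  then show "word_act n [] L = perm_act n (word_perm []) L"
    using perm_act_id[of L n] by (simp del: in_lists_conv_set)
next
  case (Cons i w)
  then have i: "i \<in> {1..<n}" and w: "w \<in> lists {1..<n}" by auto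
  from Cons.prems(2) reduced_word_Cons_iff[OF i w]
  have r: "reduced_word w" "reduced_prod (adj i) (word_perm w)" by auto
  show "word_act n (i # w) L = perm_act n (word_perm (i # w)) L"
    using perm_act_compose[OF adj_permutes[OF i] word_perm_permutes[OF w] r(2) Cons.prems(3)]
      Cons.IH[OF w r(1) Cons.prems(3)] by simp
qed

text \<open>Either side of a defining relation acts as the one permutation it represents. The list
  \<open>L\<close> is kept arbitrary because a right context acts before the words that are
  compared.\<close>

lemma word_act_cong:
  "(u, v) \<in> braid_cong n \<Longrightarrow> L \<in> lists (perms n) \<Longrightarrow> word_act n u L = word_act n v L"
proof (induction arbitrary: L rule: word_cong.induct)
  case (rel u v)
  from braid_relation_words[OF rel(1)] show "word_act n u L = word_act n v L"
    using word_act_reduced[OF rel(2) _ rel(4)] word_act_reduced[OF rel(3) _ rel(4)] by simp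
next
  case (ctxt u v x y)
  show "word_act n (x @ u @ y) L = word_act n (x @ v @ y) L"
    using ctxt.IH[OF word_act_lists[OF ctxt(3) ctxt.prems]] by simp
qed auto

lemma inversions_transpose_two:
  "inversions (transpose m (Suc (Suc m))) \<subseteq> {(m, Suc m), (Suc m, Suc (Suc m)), (m, Suc (Suc m))}"
proof (rule subrelI)
  fix x y assume "(x, y) \<in> inversions (transpose m (Suc (Suc m)))"
  then have xy: "x < y" "transpose m (Suc (Suc m)) y < transpose m (Suc (Suc m)) x"
    by (auto simp: mem_inversions)
  then have "x = m \<and> y = Suc m \<or> x = Suc m \<and> y = Suc (Suc m) \<or> x = m \<and> y = Suc (Suc m)"
    unfolding transpose_def by presburger
  then show "(x, y) \<in> {(m, Suc m), (Suc m, Suc (Suc m)), (m, Suc (Suc m))}" by blast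
qed

lemma adj_commute: "i + 2 \<le> j \<Longrightarrow> adj i \<circ> adj j = adj j \<circ> adj i"
  by (auto simp: fun_eq_iff transpose_def)

lemma inversions_adj_adj_far:
  assumes "i + 2 \<le> j"
  shows "inversions (adj i \<circ> adj j) \<subseteq> {(i, Suc i), (j, Suc j)}"
proof (rule subrelI)
  fix x y assume "(x, y) \<in> inversions (adj i \<circ> adj j)"
  then have xy: "x < y" "adj i (adj j y) < adj i (adj j x)" by (auto simp: mem_inversions)
  show "(x, y) \<in> {(i, Suc i), (j, Suc j)}"
  proof (cases "adj j y < adj j x")
    case True
    then have "(x, y) \<in> inversions (adj j)" using xy by (simp add: mem_inversions)
    then show ?thesis by (simp add: inversions_adj)
  next
    case False
    have "adj j x \<noteq> adj j y" using xy(2) by auto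
    with False xy(2) have "(adj j x, adj j y) \<in> inversions (adj i)" by (simp add: mem_inversions)
    then have "adj j x = i" "adj j y = Suc i" by (simp_all add: inversions_adj)
    then have "x = adj j i" "y = adj j (Suc i)" by (metis transpose_involutory)+
    then show ?thesis using assms by (simp add: transpose_def)
  qed
qed

text \<open>With two left descents \<open>i\<close> and \<open>j\<close>, the permutation begins
  with the longest element of the subgroup generated by \<open>adj i\<close> and
  \<open>adj j\<close>. The two sides of a braid relation are reduced words of that element, so it
  remains to check that its inversions are contained in those of \<open>w\<close>, after passing to
  inverses.\<close>

lemma two_left_descents:
  assumes w: "w permutes {1..n}" and i: "i \<in> {1..<n}" and j: "j \<in> {1..<n}" and "i \<noteq> j"
    and "inv' w (Suc i) < inv' w i" and "inv' w (Suc j) < inv' w j"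
  obtains x y c where "(i # x, j # y) \<in> braid_relations n \<or> (j # y, i # x) \<in> braid_relations n"
    "c permutes {1..n}" "w = word_perm (i # x) \<circ> c" "reduced_prod (word_perm (i # x)) c"
proof -
  note T = that
  have prefix: thesis if rel: "(i # x, j # y) \<in> braid_relations n \<or> (j # y, i # x) \<in> braid_relations n"
      and sub: "inversions (inv' (word_perm (i # x))) \<subseteq> inversions (inv' w)" for x y
  proof -
    let ?a = "word_perm (i # x)"
    have a: "?a permutes {1..n}" using rel braid_relation_words word_perm_permutes by metis
    have "w = ?a \<circ> (inv' ?a \<circ> w)" by (simp only: permutes_cancel(2)[OF a])
    moreover have "reduced_prod ?a (inv' ?a \<circ> w)" using sub reduced_prod_prefix_iff[OF a w] by simp
    ultimately show thesis
      by (rule T[OF rel permutes_compose[OF w permutes_inv[OF a]]])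
  qed
  have inv2: "inv' (word_perm [k, l]) = adj l \<circ> adj k" for k l
    by (simp add: o_inv_distrib)
  have inv3: "inv' (word_perm [k, l, m]) = adj m \<circ> adj l \<circ> adj k" for k l m
    by (simp add: o_inv_distrib bij_comp)
  show thesis
  proof (cases "j = Suc i \<or> i = Suc j")
    case True
    have inv: "inversions (inv' (word_perm [i, j, i])) \<subseteq> {(i, Suc i), (j, Suc j), (min i j, Suc (max i j))}"
      using True
    proof
      assume j: "j = Suc i"
      have "adj i \<circ> adj j \<circ> adj i = transpose i (Suc (Suc i))"
        by (auto simp: fun_eq_iff transpose_def j)
      then show ?thesis unfolding inv3 using inversions_transpose_two[of i] by (simp add: j)
    next
      assume i: "i = Suc j"
      have "adj i \<circ> adj j \<circ> adj i = transpose j (Suc (Suc j))"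
        by (auto simp: fun_eq_iff transpose_def i)
      then show ?thesis unfolding inv3 using inversions_transpose_two[of j] by (simp add: i insert_commute)
    qed
    \<comment> \<open>\<open>inv' w\<close> descends at two successive positions, so it also inverts
      the outer pair of the three points.\<close>
    have "(min i j, Suc (max i j)) \<in> inversions (inv' w)"
      using True assms by (auto simp: mem_inversions)
    with inv have "inversions (inv' (word_perm [i, j, i])) \<subseteq> inversions (inv' w)"
      using assms by (auto simp: mem_inversions)
    moreover have "([i, j, i], [j, i, j]) \<in> braid_relations n \<or> ([j, i, j], [i, j, i]) \<in> braid_relations n"
      using True i j by (auto simp: braid_relations_def)
    ultimately show thesis using prefix by blast
  next
    case False
    then have far: "i + 2 \<le> j \<or> j + 2 \<le> i" using \<open>i \<noteq> j\<close> by linarith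
    have "inversions (inv' (word_perm [i, j])) \<subseteq> {(i, Suc i), (j, Suc j)}"
      using far
    proof
      assume "i + 2 \<le> j"
      then show ?thesis unfolding inv2 using inversions_adj_adj_far[of i j] adj_commute[of i j] by simp
    next
      assume "j + 2 \<le> i"
      then show ?thesis unfolding inv2 using inversions_adj_adj_far[of j i] by auto
    qed
    then have "inversions (inv' (word_perm [i, j])) \<subseteq> inversions (inv' w)"
      using assms by (auto simp: mem_inversions)
    moreover have "([i, j], [j, i]) \<in> braid_relations n"
      using far i j by (auto simp: braid_relations_def)
    ultimately show thesis using prefix by blast
  qed
qed

text \<open>This is Matsumoto's theorem for the symmetric group. If the first letters differ, the
  permutation begins with both sides of the relation between them. Completing these by a reduced
  word \<open>z\<close> gives two words that start like \<open>u\<close> and \<open>v\<close> and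
  differ by that relation; after removal of the first letter the induction hypothesis links them to
  \<open>u\<close> and \<open>v\<close>.\<close>

lemma reduced_words_cong:
  "u \<in> lists {1..<n} \<Longrightarrow> v \<in> lists {1..<n} \<Longrightarrow> reduced_word u \<Longrightarrow> reduced_word v
    \<Longrightarrow> word_perm u = word_perm v \<Longrightarrow> (u, v) \<in> braid_cong n"
proof (induction "length u" arbitrary: u v rule: less_induct)
  case less
  have len: "length u = length v" using less.prems by (auto simp: reduced_word_def)
  show ?case
  proof (cases u)
    case Nil
    with len show ?thesis by (auto intro: word_cong.refl)
  next
    case (Cons i x)
    then obtain j y where v: "v = j # y" using len by (cases v) auto
    from less.prems Cons v have ij: "i \<in> {1..<n}" "j \<in> {1..<n}" and xy: "x \<in> lists {1..<n}" "y \<in> lists {1..<n}"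
      by auto
    have rx: "reduced_word x" "reduced_prod (adj i) (word_perm x)"
      using less.prems(3) Cons reduced_word_Cons_iff[OF ij(1) xy(1)] by auto
    have ry: "reduced_word y" "reduced_prod (adj j) (word_perm y)"
      using less.prems(4) v reduced_word_Cons_iff[OF ij(2) xy(2)] by auto
    have step: "(k # a, k # b) \<in> braid_cong n" if "(a, b) \<in> braid_cong n" "k \<in> {1..<n}" for k a b
      using word_cong.ctxt[OF that(1), of "[k]" "[]"] that(2) by simp
    let ?w = "word_perm u"
    have w: "?w permutes {1..n}" by (rule word_perm_permutes[OF less.prems(1)])
    show ?thesis
    proof (cases "i = j")
      case True
      have "word_perm x = word_perm y"
        using less.prems(5) Cons v True by (simp add: permutes_left_cancel[OF adj_permutes[OF ij(2)]])
      then have "(x, y) \<in> braid_cong n"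
        using less.hyps[of x y] Cons xy rx ry by simp
      then show ?thesis using step[OF _ ij(1)] Cons v True by simp
    next
      case False
      have d: "inv' ?w (Suc i) < inv' ?w i" "inv' ?w (Suc j) < inv' ?w j"
        using left_descent_iff[OF ij(1) w] left_descent_iff[OF ij(2) w] rx(2) ry(2) Cons v less.prems(5)
          word_perm_permutes[OF xy(1)] word_perm_permutes[OF xy(2)] by auto
      obtain x' y' c where rel: "(i # x', j # y') \<in> braid_relations n \<or> (j # y', i # x') \<in> braid_relations n"
        and c: "c permutes {1..n}" "?w = word_perm (i # x') \<circ> c" "reduced_prod (word_perm (i # x')) c"
        by (rule two_left_descents[OF w ij False d]) (rule that)
      from rel have L: "i # x' \<in> lists {1..<n}" "j # y' \<in> lists {1..<n}"
        and p: "word_perm (i # x') = word_perm (j # y')"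
        and r: "reduced_word (i # x')" "reduced_word (j # y')"
        and relc: "(i # x', j # y') \<in> braid_cong n"
        using braid_relation_cong[OF rel] by blast+
      obtain z where z: "z \<in> lists {1..<n}" "word_perm z = c" "reduced_word z"
        using reduced_word_exists[OF c(1)] by blast
      have xz: "x' @ z \<in> lists {1..<n}" "y' @ z \<in> lists {1..<n}" using L z by auto
      have rxz: "reduced_word (i # x' @ z)" "reduced_word (j # y' @ z)"
        using reduced_word_append_iff[OF L(1) z(1)] reduced_word_append_iff[OF L(2) z(1)] r z c(3) p
        by (auto simp del: word_perm_simps)
      have 1: "word_perm x = word_perm (x' @ z)"
        using c(2) Cons z(2) permutes_left_cancel[OF adj_permutes[OF ij(1)], of "word_perm x" "word_perm (x' @ z)"]
        by (simp add: word_perm_append comp_assoc)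
      have "word_perm (j # y) = word_perm (j # y') \<circ> c" using c(2) less.prems(5) v p by metis
      then have 2: "word_perm y = word_perm (y' @ z)"
        using z(2) permutes_left_cancel[OF adj_permutes[OF ij(2)], of "word_perm y" "word_perm (y' @ z)"]
        by (simp add: word_perm_append comp_assoc)
      have "(x, x' @ z) \<in> braid_cong n"
        using less.hyps[OF _ xy(1) xz(1) rx(1) _ 1] Cons rxz(1) reduced_word_Cons_iff[OF ij(1) xz(1)] by simp
      then have A: "(u, i # x' @ z) \<in> braid_cong n" using step ij Cons by simp
      have "(y, y' @ z) \<in> braid_cong n"
        using less.hyps[OF _ xy(2) xz(2) ry(1) _ 2] v len rxz(2) reduced_word_Cons_iff[OF ij(2) xz(2)] by simp
      then have B: "(v, j # y' @ z) \<in> braid_cong n" using step ij v by simp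
      have C: "(i # x' @ z, j # y' @ z) \<in> braid_cong n"
        using word_cong.ctxt[OF relc, of "[]" z] z(1) by simp
      show ?thesis by (rule word_cong.trans[OF A word_cong.trans[OF C word_cong.sym[OF B]]])
    qed
  qed
qed

section \<open>The braid monoid\<close>

abbreviation braid_class :: "nat \<Rightarrow> nat list \<Rightarrow> nat list set" where
  "braid_class n u \<equiv> braid_cong n `` {u}"

lemma braid_class_eq_iff:
  "u \<in> lists {1..<n} \<Longrightarrow> v \<in> lists {1..<n} \<Longrightarrow> braid_class n u = braid_class n v \<longleftrightarrow> (u, v) \<in> braid_cong n"
  by (rule eq_equiv_class_iff[OF equiv_word_cong])

lemma braid_carrier_iff:
  "x \<in> carrier (braid_monoid n) \<longleftrightarrow> (\<exists>u \<in> lists {1..<n}. x = braid_class n u)"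
  by (auto simp: braid_monoid_def presented_monoid_def quotient_def simp del: in_lists_conv_set)

lemma braid_class_carrier: "u \<in> lists {1..<n} \<Longrightarrow> braid_class n u \<in> carrier (braid_monoid n)"
  unfolding braid_carrier_iff by blast

lemma braid_mult_class:
  assumes u: "u \<in> lists {1..<n}" and v: "v \<in> lists {1..<n}"
  shows "braid_class n u \<otimes>\<^bsub>braid_monoid n\<^esub> braid_class n v = braid_class n (u @ v)"
proof -
  have eq: "braid_class n (u' @ v') = braid_class n (u @ v)"
    if "u' \<in> braid_class n u" "v' \<in> braid_class n v" for u' v'
    using that word_cong_append[of u u' _ _ v v']
    by (intro equiv_class_eq[OF equiv_word_cong]) (auto intro: word_cong.sym)
  have "u \<in> braid_class n u" "v \<in> braid_class n v" using u v by (auto intro: word_cong.refl)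
  with eq show ?thesis
    unfolding braid_monoid_def presented_monoid_def monoid.simps by blast
qed

lemma braid_one: "\<one>\<^bsub>braid_monoid n\<^esub> = braid_class n []"
  by (simp add: braid_monoid_def presented_monoid_def)

lemma braid_monoid_monoid: "monoid (braid_monoid n)"
proof (rule monoidI)
  fix x y z
  assume "x \<in> carrier (braid_monoid n)" "y \<in> carrier (braid_monoid n)" "z \<in> carrier (braid_monoid n)"
  then obtain u v w where "u \<in> lists {1..<n}" "x = braid_class n u" "v \<in> lists {1..<n}" "y = braid_class n v"
    "w \<in> lists {1..<n}" "z = braid_class n w"
    unfolding braid_carrier_iff by blast
  then show "x \<otimes>\<^bsub>braid_monoid n\<^esub> y \<otimes>\<^bsub>braid_monoid n\<^esub> z = x \<otimes>\<^bsub>braid_monoid n\<^esub> (y \<otimes>\<^bsub>braid_monoid n\<^esub> z)"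
    by (simp add: braid_mult_class del: in_lists_conv_set)
next
  fix x y assume "x \<in> carrier (braid_monoid n)" "y \<in> carrier (braid_monoid n)"
  then obtain u v where "u \<in> lists {1..<n}" "x = braid_class n u" "v \<in> lists {1..<n}" "y = braid_class n v"
    unfolding braid_carrier_iff by blast
  then show "x \<otimes>\<^bsub>braid_monoid n\<^esub> y \<in> carrier (braid_monoid n)"
    using braid_class_carrier[of "u @ v" n] by (simp add: braid_mult_class del: in_lists_conv_set)
next
  fix x assume "x \<in> carrier (braid_monoid n)"
  then obtain u where "u \<in> lists {1..<n}" "x = braid_class n u" unfolding braid_carrier_iff by blast
  then show "\<one>\<^bsub>braid_monoid n\<^esub> \<otimes>\<^bsub>braid_monoid n\<^esub> x = x" "x \<otimes>\<^bsub>braid_monoid n\<^esub> \<one>\<^bsub>braid_monoid n\<^esub> = x"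
    using braid_mult_class[of "[]" n u] braid_mult_class[of u n "[]"] by (simp_all add: braid_one)
next
  show "\<one>\<^bsub>braid_monoid n\<^esub> \<in> carrier (braid_monoid n)"
    unfolding braid_one by (rule braid_class_carrier) simp
qed

lemma braid_perm_class:
  assumes "u \<in> lists {1..<n}"
  shows "braid_perm (braid_class n u) = word_perm u"
proof -
  have "word_perm ` braid_class n u = {word_perm u}"
    using braid_cong_invariants word_cong.refl[OF assms] by (fastforce simp: image_iff)
  then show ?thesis by (simp add: braid_perm_def)
qed

text \<open>This is the inverse of \<open>\<pi>\<close>. By \<open>reduced_words_cong\<close> the
  choice of the reduced word is immaterial.\<close>

definition perm_braid :: "nat \<Rightarrow> (nat \<Rightarrow> nat) \<Rightarrow> nat list set" where
  "perm_braid n w = braid_class n (SOME z. z \<in> lists {1..<n} \<and> word_perm z = w \<and> reduced_word z)"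

lemma perm_braid_word:
  assumes "z \<in> lists {1..<n}" and "reduced_word z"
  shows "perm_braid n (word_perm z) = braid_class n z"
proof -
  let ?y = "SOME y. y \<in> lists {1..<n} \<and> word_perm y = word_perm z \<and> reduced_word y"
  have y: "?y \<in> lists {1..<n} \<and> word_perm ?y = word_perm z \<and> reduced_word ?y"
    by (rule someI[of _ z]) (use assms in simp)
  then have "(?y, z) \<in> braid_cong n" using assms by (intro reduced_words_cong) auto
  then show ?thesis unfolding perm_braid_def by (rule equiv_class_eq[OF equiv_word_cong])
qed

lemma perm_braidE:
  assumes "w permutes {1..n}"
  obtains z where "z \<in> lists {1..<n}" "word_perm z = w" "reduced_word z" "perm_braid n w = braid_class n z"
  using reduced_word_exists[OF assms] perm_braid_word by blast

lemma perm_braid_carrier: "w permutes {1..n} \<Longrightarrow> perm_braid n w \<in> carrier (braid_monoid n)"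
  by (metis perm_braidE braid_class_carrier)

lemma braid_perm_perm_braid: "w permutes {1..n} \<Longrightarrow> braid_perm (perm_braid n w) = w"
  by (metis perm_braidE braid_perm_class)

lemma perm_braid_inj: "inj_on (perm_braid n) (perms n)"
  by (rule inj_on_inverseI[of _ braid_perm]) (simp add: braid_perm_perm_braid)

lemma perm_braid_id: "perm_braid n id = \<one>\<^bsub>braid_monoid n\<^esub>"
  using perm_braid_word[of "[]" n] by (simp add: braid_one)

lemma perm_braid_adj: "i \<in> {1..<n} \<Longrightarrow> perm_braid n (adj i) = sigma n i"
  using perm_braid_word[of "[i]" n] by (simp add: sigma_def reduced_word_def)

lemma perm_braid_mult:
  assumes u: "u permutes {1..n}" and v: "v permutes {1..n}" and "reduced_prod u v"
  shows "perm_braid n u \<otimes>\<^bsub>braid_monoid n\<^esub> perm_braid n v = perm_braid n (u \<circ> v)"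
proof -
  obtain y where y: "y \<in> lists {1..<n}" "word_perm y = u" "reduced_word y" "perm_braid n u = braid_class n y"
    by (rule perm_braidE[OF u])
  obtain z where z: "z \<in> lists {1..<n}" "word_perm z = v" "reduced_word z" "perm_braid n v = braid_class n z"
    by (rule perm_braidE[OF v])
  have "reduced_word (y @ z)" using reduced_word_append_iff[OF y(1) z(1)] y z assms(3) by simp
  moreover have "y @ z \<in> lists {1..<n}" using y z by simp
  ultimately have "perm_braid n (word_perm (y @ z)) = braid_class n (y @ z)" by (intro perm_braid_word)
  then show ?thesis using y z by (simp add: braid_mult_class word_perm_append del: in_lists_conv_set)
qed

text \<open>Concatenating words of the two factors gives a word congruent to a reduced one. It has
  the same length and permutation, so it is reduced, and so are its two pieces. Hence factors of
  simple elements are simple.\<close>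

lemma perm_braid_mult_eqD:
  assumes x: "x \<in> carrier (braid_monoid n)" and y: "y \<in> carrier (braid_monoid n)"
    and w: "w permutes {1..n}" and eq: "perm_braid n w = x \<otimes>\<^bsub>braid_monoid n\<^esub> y"
  obtains a c where "a permutes {1..n}" "c permutes {1..n}" "x = perm_braid n a" "y = perm_braid n c"
    "w = a \<circ> c" "reduced_prod a c"
proof -
  obtain u v where u: "u \<in> lists {1..<n}" "x = braid_class n u" and v: "v \<in> lists {1..<n}" "y = braid_class n v"
    using x y unfolding braid_carrier_iff by blast
  obtain z where z: "z \<in> lists {1..<n}" "word_perm z = w" "reduced_word z" "perm_braid n w = braid_class n z"
    by (rule perm_braidE[OF w])
  have uv: "u @ v \<in> lists {1..<n}" using u v by simp
  have "braid_class n z = braid_class n (u @ v)" using eq z u v braid_mult_class[OF u(1) v(1)] by simp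
  then have "(z, u @ v) \<in> braid_cong n" using braid_class_eq_iff[OF z(1) uv] by simp
  then have e: "word_perm z = word_perm (u @ v)" "length z = length (u @ v)"
    using braid_cong_invariants by blast+
  then have "reduced_word (u @ v)" using z(3) by (simp add: reduced_word_def)
  then have r: "reduced_word u" "reduced_word v" "reduced_prod (word_perm u) (word_perm v)"
    using reduced_word_append_iff[OF u(1) v(1)] by auto
  show thesis
    by (rule that[OF word_perm_permutes[OF u(1)] word_perm_permutes[OF v(1)] _ _ _ r(3)])
      (use u v r e z perm_braid_word in \<open>auto simp: word_perm_append simp del: in_lists_conv_set\<close>)
qed

definition perms_prod :: "nat \<Rightarrow> (nat \<Rightarrow> nat) list \<Rightarrow> nat list set" where
  "perms_prod n L = word_prod (braid_monoid n) (map (perm_braid n) L)"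

lemma perms_prod_simps [simp]:
  "perms_prod n [] = \<one>\<^bsub>braid_monoid n\<^esub>"
  "perms_prod n (w # L) = perm_braid n w \<otimes>\<^bsub>braid_monoid n\<^esub> perms_prod n L"
  by (simp_all add: perms_prod_def word_prod_def)

lemma perms_prod_carrier: "L \<in> lists (perms n) \<Longrightarrow> perms_prod n L \<in> carrier (braid_monoid n)"
proof (induction L)
  case Nil
  then show ?case using monoid.one_closed[OF braid_monoid_monoid] by simp
next
  case (Cons w L)
  then show ?case
    using monoid.m_closed[OF braid_monoid_monoid, of "perm_braid n w" n "perms_prod n L"]
    by (simp add: perm_braid_carrier)
qed

text \<open>Moving a prefix from an entry to its left neighbour does not change the product, so the
  action on sequences models left multiplication.\<close>

lemma perms_prod_perm_act:
  "u permutes {1..n} \<Longrightarrow> L \<in> lists (perms n)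
    \<Longrightarrow> perms_prod n (perm_act n u L) = perm_braid n u \<otimes>\<^bsub>braid_monoid n\<^esub> perms_prod n L"
proof (induction L arbitrary: u)
  case Nil
  show ?case
  proof (cases "u = id")
    case True
    show ?thesis unfolding True by (simp add: perm_braid_id monoid.r_one[OF braid_monoid_monoid]
        monoid.one_closed[OF braid_monoid_monoid])
  qed simp
next
  case (Cons w L)
  note m = braid_monoid_monoid[of n]
  from Cons.prems have w: "w permutes {1..n}" and L: "L \<in> lists (perms n)" by auto
  obtain a c where act: "perm_act n u (w # L) = (u \<circ> a) # perm_act n c L"
    and ac: "a permutes {1..n}" "c permutes {1..n}" "w = a \<circ> c" "reduced_prod a c" "reduced_prod u a"
    by (rule perm_act_Cons[OF Cons.prems(1) w, of L]) (rule that)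
  note C = perm_braid_carrier[OF Cons.prems(1)] perm_braid_carrier[OF ac(1)] perm_braid_carrier[OF ac(2)]
    perms_prod_carrier[OF L]
  have "perms_prod n (perm_act n u (w # L)) =
      perm_braid n u \<otimes>\<^bsub>braid_monoid n\<^esub> perm_braid n a \<otimes>\<^bsub>braid_monoid n\<^esub>
      (perm_braid n c \<otimes>\<^bsub>braid_monoid n\<^esub> perms_prod n L)"
    using act Cons.IH[OF ac(2) L] perm_braid_mult[OF Cons.prems(1) ac(1,5)] by simp
  also have "\<dots> = perm_braid n u \<otimes>\<^bsub>braid_monoid n\<^esub> (perm_braid n a \<otimes>\<^bsub>braid_monoid n\<^esub> perm_braid n c
      \<otimes>\<^bsub>braid_monoid n\<^esub> perms_prod n L)"
    using C monoid.m_assoc[OF m] monoid.m_closed[OF m] by simp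
  also have "perm_braid n a \<otimes>\<^bsub>braid_monoid n\<^esub> perm_braid n c = perm_braid n w"
    using perm_braid_mult[OF ac(1,2,4)] ac(3) by simp
  finally show "perms_prod n (perm_act n u (w # L)) = perm_braid n u \<otimes>\<^bsub>braid_monoid n\<^esub> perms_prod n (w # L)"
    by simp
qed

text \<open>Any representative word gives the same list by \<open>word_act_cong\<close>, hence the
  \<open>SOME\<close>.\<close>

definition normal_form :: "nat \<Rightarrow> nat list set \<Rightarrow> (nat \<Rightarrow> nat) list" where
  "normal_form n x = word_act n (SOME u. u \<in> x) []"

lemma normal_form_class:
  assumes "u \<in> lists {1..<n}"
  shows "normal_form n (braid_class n u) = word_act n u []"
proof -
  have "(u, SOME v. v \<in> braid_class n u) \<in> braid_cong n"
    using someI[of "\<lambda>v. v \<in> braid_class n u" u] word_cong.refl[OF assms] by simp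
  from word_act_cong[OF this, of "[]"] show ?thesis by (simp add: normal_form_def)
qed

lemma normal_form_normal:
  assumes "x \<in> carrier (braid_monoid n)"
  shows "normal_list n (normal_form n x)"
proof -
  obtain u where u: "u \<in> lists {1..<n}" "x = braid_class n u" using assms unfolding braid_carrier_iff by blast
  show ?thesis
    unfolding u(2) normal_form_class[OF u(1)] by (rule word_act_normal[OF u(1)]) simp
qed

lemma normal_form_mult:
  assumes w: "w permutes {1..n}" and x: "x \<in> carrier (braid_monoid n)"
  shows "normal_form n (perm_braid n w \<otimes>\<^bsub>braid_monoid n\<^esub> x) = perm_act n w (normal_form n x)"
proof -
  obtain z where z: "z \<in> lists {1..<n}" "word_perm z = w" "reduced_word z" "perm_braid n w = braid_class n z"
    by (rule perm_braidE[OF w])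
  obtain u where u: "u \<in> lists {1..<n}" "x = braid_class n u" using x unfolding braid_carrier_iff by blast
  have zu: "z @ u \<in> lists {1..<n}" using z u by simp
  have "normal_form n (perm_braid n w \<otimes>\<^bsub>braid_monoid n\<^esub> x) = word_act n z (word_act n u [])"
    using normal_form_class[OF zu] z u braid_mult_class[OF z(1) u(1)] by simp
  also have "\<dots> = perm_act n w (word_act n u [])"
    using word_act_reduced[OF z(1,3) word_act_lists[OF u(1)]] z(2) by simp
  finally show ?thesis using normal_form_class[OF u(1)] u(2) by simp
qed

lemma perms_prod_normal_form:
  assumes "x \<in> carrier (braid_monoid n)"
  shows "perms_prod n (normal_form n x) = x"
proof -
  have "perms_prod n (word_act n u []) = braid_class n u" if "u \<in> lists {1..<n}" for u
    using that
  proof (induction u)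
    case Nil
    then show ?case by (simp add: braid_one)
  next
    case (Cons i u)
    then have i: "i \<in> {1..<n}" and u: "u \<in> lists {1..<n}" by auto
    show ?case
      using perms_prod_perm_act[OF adj_permutes[OF i] word_act_lists[OF u, of "[]"]] Cons.IH
        perm_braid_adj[OF i] braid_mult_class[of "[i]" n u] i u by (simp add: sigma_def)
  qed
  moreover obtain u where u: "u \<in> lists {1..<n}" "x = braid_class n u"
    using assms unfolding braid_carrier_iff by blast
  ultimately show ?thesis unfolding u(2) normal_form_class[OF u(1)] by blast
qed

text \<open>In a normal list every head acts on its tail by prepending itself, so the action
  rebuilds the list entry by entry. Together with \<open>perms_prod_normal_form\<close> this gives
  existence and uniqueness of normal forms.\<close>

lemma normal_form_perms_prod:
  "normal_list n L \<Longrightarrow> normal_form n (perms_prod n L) = L"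
proof (induction L)
  case Nil
  then show ?case using normal_form_class[of "[]" n] by (simp add: braid_one)
next
  case (Cons w L)
  then show ?case
    using normal_form_mult[of w n "perms_prod n L"] perms_prod_carrier[OF normal_list_lists] by simp
qed

section \<open>The Garside element and the simple elements\<close>

definition longest_perm :: "nat \<Rightarrow> nat \<Rightarrow> nat" where
  "longest_perm n x = (if x \<in> {1..n} then Suc n - x else x)"

lemma longest_perm_permutes: "longest_perm n permutes {1..n}"
proof -
  have inv: "longest_perm n (longest_perm n x) = x" for x by (auto simp: longest_perm_def)
  have "bij_betw (longest_perm n) {1..n} {1..n}"
    by (rule bij_betw_byWitness[where f' = "longest_perm n"]) (auto simp: inv longest_perm_def)
  then show ?thesis by (auto simp: permutes_altdef longest_perm_def)
qed

lemma longest_perm_inv: "inv' (longest_perm n) = longest_perm n"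
  by (rule inv_unique_comp) (auto simp: longest_perm_def fun_eq_iff)

lemma longest_perm_prefix:
  assumes w: "w permutes {1..n}"
  shows "reduced_prod w (inv' w \<circ> longest_perm n)"
  unfolding reduced_prod_prefix_iff[OF w longest_perm_permutes] longest_perm_inv
proof (rule subrelI)
  fix a b assume ab: "(a, b) \<in> inversions (inv' w)"
  with inversions_subset[OF permutes_inv[OF w]] have "a \<in> {1..n}" "b \<in> {1..n}" by auto
  with ab show "(a, b) \<in> inversions (longest_perm n)"
    by (auto simp: mem_inversions longest_perm_def)
qed

text \<open>Reversal turns the descents of \<open>inv' w\<close> into ascents, and an everywhere
  ascending permutation is \<open>id\<close>.\<close>

lemma longest_perm_if_descending:
  assumes w: "w permutes {1..n}" and desc: "\<And>i. i \<in> {1..<n} \<Longrightarrow> inv' w (Suc i) < inv' w i"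
  shows "w = longest_perm n"
proof -
  have "longest_perm n \<circ> inv' w = id"
  proof (rule permutes_id_if_ascending)
    show "longest_perm n \<circ> inv' w permutes {1..n}"
      by (intro permutes_compose permutes_inv w longest_perm_permutes)
    fix i assume i: "i \<in> {1..<n}"
    have "inv' w i \<in> {1..n}" "inv' w (Suc i) \<in> {1..n}"
      using i permutes_in_image[OF permutes_inv[OF w]] by auto
    with desc[OF i] show "(longest_perm n \<circ> inv' w) i < (longest_perm n \<circ> inv' w) (Suc i)"
      by (auto simp: longest_perm_def)
  qed
  then have "longest_perm n \<circ> inv' w \<circ> w = w" by simp
  then show ?thesis using permutes_inv_o(2)[OF w] by (simp add: comp_assoc)
qed

lemma braid_divides_perm_braid:
  assumes "a permutes {1..n}" "c permutes {1..n}" "reduced_prod a c"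
  shows "perm_braid n a divides\<^bsub>braid_monoid n\<^esub> perm_braid n (a \<circ> c)"
  unfolding factor_def using perm_braid_mult[OF assms] perm_braid_carrier[OF assms(2)] by (intro bexI[of _ "perm_braid n c"]) auto

lemma divides_perm_braid_iff:
  assumes x: "x \<in> carrier (braid_monoid n)" and w: "w permutes {1..n}"
  shows "x divides\<^bsub>braid_monoid n\<^esub> perm_braid n w \<longleftrightarrow>
    (\<exists>a c. a permutes {1..n} \<and> c permutes {1..n} \<and> x = perm_braid n a \<and> w = a \<circ> c \<and> reduced_prod a c)"
proof
  assume "x divides\<^bsub>braid_monoid n\<^esub> perm_braid n w"
  then obtain y where y: "y \<in> carrier (braid_monoid n)" "perm_braid n w = x \<otimes>\<^bsub>braid_monoid n\<^esub> y"
    unfolding factor_def by blast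
  obtain a c where "a permutes {1..n}" "c permutes {1..n}" "x = perm_braid n a" "y = perm_braid n c"
    "w = a \<circ> c" "reduced_prod a c"
    by (rule perm_braid_mult_eqD[OF x y(1) w y(2)])
  then show "\<exists>a c. a permutes {1..n} \<and> c permutes {1..n} \<and> x = perm_braid n a \<and> w = a \<circ> c \<and> reduced_prod a c"
    by (intro exI[of _ a] exI[of _ c] conjI)
next
  assume "\<exists>a c. a permutes {1..n} \<and> c permutes {1..n} \<and> x = perm_braid n a \<and> w = a \<circ> c \<and> reduced_prod a c"
  then obtain a c where ac: "a permutes {1..n}" "c permutes {1..n}" "x = perm_braid n a" "w = a \<circ> c" "reduced_prod a c"
    by (elim exE conjE)
  show "x divides\<^bsub>braid_monoid n\<^esub> perm_braid n w"
    unfolding ac(3,4) by (rule braid_divides_perm_braid[OF ac(1,2,5)])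
qed

lemma sigma_carrier: "i \<in> {1..<n} \<Longrightarrow> sigma n i \<in> carrier (braid_monoid n)"
  unfolding sigma_def by (rule braid_class_carrier) simp

lemma inj_sigma: "inj_on (sigma n) {1..<n}"
proof (rule inj_onI)
  fix i j assume i: "i \<in> {1..<n}" and j: "j \<in> {1..<n}" and "sigma n i = sigma n j"
  then have "([i], [j]) \<in> braid_cong n"
    unfolding sigma_def using braid_class_eq_iff[of "[i]" n "[j]"] by simp
  then have "word_perm [i] = word_perm [j]" by (blast dest: braid_cong_invariants)
  then have "adj i = adj j" by simp
  then have "adj i j = Suc j" by simp
  then show "i = j" unfolding transpose_def by presburger
qed

lemma sigma_divides_perm_braid_iff:
  assumes i: "i \<in> {1..<n}" and w: "w permutes {1..n}"
  shows "sigma n i divides\<^bsub>braid_monoid n\<^esub> perm_braid n w \<longleftrightarrow> inv' w (Suc i) < inv' w i"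
proof -
  have "sigma n i = perm_braid n a \<longleftrightarrow> a = adj i" if "a permutes {1..n}" for a
    using that adj_permutes[OF i] inj_on_eq_iff[OF perm_braid_inj, of a n "adj i"]
    by (auto simp: perm_braid_adj[OF i, symmetric])
  then show ?thesis
    unfolding left_descent_iff[OF i w] divides_perm_braid_iff[OF sigma_carrier[OF i] w]
    using adj_permutes[OF i] by metis
qed

lemma rmultiple_sigma_perm_braid_iff:
  assumes i: "i \<in> {1..<n}" and w: "w permutes {1..n}"
  shows "rmultiple (braid_monoid n) (perm_braid n w) (sigma n i) \<longleftrightarrow> w (Suc i) < w i"
proof
  assume "rmultiple (braid_monoid n) (perm_braid n w) (sigma n i)"
  then obtain c where "c \<in> carrier (braid_monoid n)" "perm_braid n w = c \<otimes>\<^bsub>braid_monoid n\<^esub> sigma n i"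
    unfolding rmultiple_def by blast
  then obtain a b where ab: "a permutes {1..n}" "b permutes {1..n}" "sigma n i = perm_braid n b"
    "w = a \<circ> b" "reduced_prod a b"
    using perm_braid_mult_eqD[OF _ sigma_carrier[OF i] w] by metis
  then have "b = adj i"
    using inj_onD[OF perm_braid_inj, of n b "adj i"] adj_permutes[OF i] perm_braid_adj[OF i] by simp
  then show "w (Suc i) < w i"
    using ab reduced_prod_adj_right_cancel[OF i w] by simp
next
  assume "w (Suc i) < w i"
  then have r: "reduced_prod (w \<circ> adj i) (adj i)" using reduced_prod_adj_right_cancel[OF i w] by simp
  have p: "w \<circ> adj i permutes {1..n}" by (rule permutes_compose[OF adj_permutes[OF i] w])
  have "perm_braid n w = perm_braid n (w \<circ> adj i) \<otimes>\<^bsub>braid_monoid n\<^esub> sigma n i"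
    using perm_braid_mult[OF p adj_permutes[OF i] r] perm_braid_adj[OF i] by simp
  then show "rmultiple (braid_monoid n) (perm_braid n w) (sigma n i)"
    unfolding rmultiple_def using perm_braid_carrier[OF p] by blast
qed

text \<open>If every generator divides \<open>m\<close>, each of them gives a left descent of the
  first entry of its normal form. A permutation with all left descents is the reversal, so this
  first entry is the required left divisor.\<close>

lemma longest_perm_lcm: "is_left_lcm (braid_monoid n) (atoms n) (perm_braid n (longest_perm n))"
  unfolding is_left_lcm_def
proof (intro conjI ballI impI)
  note w0 = longest_perm_permutes[of n]
  show "perm_braid n (longest_perm n) \<in> carrier (braid_monoid n)" by (rule perm_braid_carrier[OF w0])
  fix a assume "a \<in> atoms n"
  then obtain i where i: "i \<in> {1..<n}" "a = sigma n i" by (auto simp: atoms_def)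
  then show "a divides\<^bsub>braid_monoid n\<^esub> perm_braid n (longest_perm n)"
    using sigma_divides_perm_braid_iff[OF i(1) w0] by (auto simp: longest_perm_inv longest_perm_def)
next
  fix m assume m: "m \<in> carrier (braid_monoid n)" and div: "\<forall>a \<in> atoms n. a divides\<^bsub>braid_monoid n\<^esub> m"
  let ?L = "normal_form n m"
  \<comment> \<open>The form of \<open>m\<close> arises from that of its quotient by acting with
    \<open>adj i\<close>, and the resulting head begins with \<open>adj i\<close> in a reduced
    product.\<close>
  have head: "\<exists>a M. ?L = (adj i \<circ> a) # M \<and> a permutes {1..n} \<and> reduced_prod (adj i) a" if i: "i \<in> {1..<n}" for i
  proof -
    obtain x where x: "x \<in> carrier (braid_monoid n)" "m = sigma n i \<otimes>\<^bsub>braid_monoid n\<^esub> x"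
      using div i unfolding atoms_def factor_def by blast
    have L: "?L = perm_act n (adj i) (normal_form n x)"
      using normal_form_mult[OF adj_permutes[OF i] x(1)] x(2) perm_braid_adj[OF i] by simp
    show ?thesis
    proof (cases "normal_form n x")
      case Nil
      then have "?L = (adj i \<circ> id) # []" using L adj_neq_id by simp
      then show ?thesis using permutes_id reduced_prod_id by blast
    next
      case (Cons w M)
      then have w: "w permutes {1..n}" using normal_list_lists[OF normal_form_normal[OF x(1)]] by simp
      obtain a c where ac: "perm_act n (adj i) (w # M) = (adj i \<circ> a) # perm_act n c M"
        "a permutes {1..n}" "reduced_prod (adj i) a"
        by (rule perm_act_Cons[OF adj_permutes[OF i] w, of M]) (rule that)
      show ?thesis
        by (intro exI[of _ a] exI[of _ "perm_act n c M"] conjI ac(2,3)) (simp only: L Cons ac(1))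
    qed
  qed
  obtain h y where h: "h permutes {1..n}" "y \<in> carrier (braid_monoid n)" "m = perm_braid n h \<otimes>\<^bsub>braid_monoid n\<^esub> y"
    and desc: "\<And>i. i \<in> {1..<n} \<Longrightarrow> inv' h (Suc i) < inv' h i"
  proof (cases ?L)
    case Nil
    \<comment> \<open>The form is empty only if there are no generators; then \<open>id\<close>
      serves as the head, with no descents to check.\<close>
    with head have "\<And>i. i \<in> {1..<n} \<Longrightarrow> inv' id (Suc i) < inv' id i" by fastforce
    moreover have "m = perm_braid n id \<otimes>\<^bsub>braid_monoid n\<^esub> m"
      using m monoid.l_one[OF braid_monoid_monoid] by (simp add: perm_braid_id)
    ultimately show thesis using that[OF permutes_id m] by blast
  next
    case (Cons h M)
    have hM: "h permutes {1..n}" "M \<in> lists (perms n)"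
      using normal_list_lists[OF normal_form_normal[OF m]] Cons by auto
    have "m = perm_braid n h \<otimes>\<^bsub>braid_monoid n\<^esub> perms_prod n M"
      using perms_prod_normal_form[OF m] Cons by simp
    moreover have "inv' h (Suc i) < inv' h i" if "i \<in> {1..<n}" for i
      unfolding left_descent_iff[OF that hM(1)] using head[OF that] Cons by auto
    ultimately show thesis using that[OF hM(1) perms_prod_carrier[OF hM(2)]] by blast
  qed
  have "h = longest_perm n" by (rule longest_perm_if_descending[OF h(1) desc])
  with h show "perm_braid n (longest_perm n) divides\<^bsub>braid_monoid n\<^esub> m"
    unfolding factor_def by blast
qed

lemma braid_dividesE:
  assumes "x divides\<^bsub>braid_monoid n\<^esub> y"
  obtains v where "v \<in> lists {1..<n}" "y = x \<otimes>\<^bsub>braid_monoid n\<^esub> braid_class n v"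
proof -
  from assms obtain c where c: "c \<in> carrier (braid_monoid n)" "y = x \<otimes>\<^bsub>braid_monoid n\<^esub> c"
    unfolding factor_def by (rule bexE)
  from c(1) obtain v where "v \<in> lists {1..<n}" "c = braid_class n v"
    unfolding braid_carrier_iff by (rule bexE)
  with c(2) show thesis by (intro that) simp_all
qed

text \<open>Word length is invariant under the relations, so the quotients have length 0. This makes
  the least common multiple unique and \<open>garside\<close> well defined.\<close>

lemma braid_divides_antisym:
  assumes x: "x \<in> carrier (braid_monoid n)"
    and "x divides\<^bsub>braid_monoid n\<^esub> y" "y divides\<^bsub>braid_monoid n\<^esub> x"
  shows "x = y"
proof -
  obtain u where u: "u \<in> lists {1..<n}" "x = braid_class n u" using x unfolding braid_carrier_iff by blast
  obtain v where v: "v \<in> lists {1..<n}" "y = x \<otimes>\<^bsub>braid_monoid n\<^esub> braid_class n v"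
    by (rule braid_dividesE[OF assms(2)])
  obtain w where w: "w \<in> lists {1..<n}" "x = y \<otimes>\<^bsub>braid_monoid n\<^esub> braid_class n w"
    by (rule braid_dividesE[OF assms(3)])
  have l: "u @ v \<in> lists {1..<n}" "(u @ v) @ w \<in> lists {1..<n}" using u(1) v(1) w(1) by simp_all
  have y: "y = braid_class n (u @ v)" unfolding v(2) u(2) by (rule braid_mult_class[OF u(1) v(1)])
  have "braid_class n u = braid_class n ((u @ v) @ w)"
    using w(2) unfolding y braid_mult_class[OF l(1) w(1)] u(2) .
  then have "(u, (u @ v) @ w) \<in> braid_cong n" using braid_class_eq_iff[OF u(1) l(2)] by simp
  then have "length u = length ((u @ v) @ w)" by (blast dest: braid_cong_invariants)
  then have "v = []" by simp
  then show ?thesis using y u by simp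
qed

lemma garside_eq: "garside n = perm_braid n (longest_perm n)"
  unfolding garside_def
proof (rule the_equality)
  show "is_left_lcm (braid_monoid n) (atoms n) (perm_braid n (longest_perm n))" by (rule longest_perm_lcm)
  fix d assume "is_left_lcm (braid_monoid n) (atoms n) d"
  with longest_perm_lcm[of n] show "d = perm_braid n (longest_perm n)"
    unfolding is_left_lcm_def by (intro braid_divides_antisym) auto
qed

text \<open>Divisors of the lift of the reversal are themselves lifts of permutations, and the
  reversal inverts every pair, so each permutation is a prefix of it.\<close>

lemma simples_eq: "simples n = perm_braid n ` perms n"
proof
  show "simples n \<subseteq> perm_braid n ` perms n"
    unfolding simples_def garside_eq using divides_perm_braid_iff[OF _ longest_perm_permutes] by blast
  show "perm_braid n ` perms n \<subseteq> simples n"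
  proof clarify
    fix w assume w: "w permutes {1..n}"
    have "perm_braid n w divides\<^bsub>braid_monoid n\<^esub> perm_braid n (w \<circ> (inv' w \<circ> longest_perm n))"
      using braid_divides_perm_braid[OF w permutes_compose[OF longest_perm_permutes permutes_inv[OF w]] longest_perm_prefix[OF w]] .
    then show "perm_braid n w \<in> simples n"
      unfolding simples_def garside_eq permutes_cancel(2)[OF w] using perm_braid_carrier[OF w] by simp
  qed
qed

lemma start_set_perm_braid:
  assumes w: "w permutes {1..n}"
  shows "start_set n (perm_braid n w) = sigma n ` {i \<in> {1..<n}. inv' w (Suc i) < inv' w i}"
  unfolding start_set_def atoms_def using sigma_divides_perm_braid_iff[OF _ w] by blast

lemma finish_set_perm_braid:
  assumes w: "w permutes {1..n}"
  shows "finish_set n (perm_braid n w) = sigma n ` {i \<in> {1..<n}. w (Suc i) < w i}"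
  unfolding finish_set_def atoms_def using rmultiple_sigma_perm_braid_iff[OF _ w] by blast

text \<open>If the head can take a nontrivial prefix of \<open>v\<close>, it can take the first
  generator of that prefix. So testing generators suffices, and these tests compare a starting set
  with a finishing set.\<close>

lemma normal_list_Cons_Cons_iff:
  assumes w: "w permutes {1..n}" and v: "v permutes {1..n}"
  shows "normal_list n (w # v # L) \<longleftrightarrow> w \<noteq> id \<and> normal_list n (v # L) \<and>
    start_set n (perm_braid n v) \<subseteq> finish_set n (perm_braid n w)"
proof -
  have "(\<forall>b d. b permutes {1..n} \<longrightarrow> v = b \<circ> d \<longrightarrow> reduced_prod b d \<longrightarrow> reduced_prod w b \<longrightarrow> b = id)
    \<longleftrightarrow> (\<forall>i \<in> {1..<n}. inv' v (Suc i) < inv' v i \<longrightarrow> w (Suc i) < w i)" (is "?M \<longleftrightarrow> ?D")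
  proof
    assume M: ?M
    show ?D
    proof (intro ballI impI)
      fix i assume i: "i \<in> {1..<n}" "inv' v (Suc i) < inv' v i"
      then obtain c where c: "c permutes {1..n}" "v = adj i \<circ> c" "reduced_prod (adj i) c"
        using left_descent_iff[OF i(1) v] by blast
      then have "\<not> reduced_prod w (adj i)" using M adj_permutes[OF i(1)] adj_neq_id by blast
      then show "w (Suc i) < w i"
        unfolding reduced_prod_adj_right_iff[OF i(1) w]
        using permutes_inj[OF w] by (metis injD linorder_neqE_nat n_not_Suc_n)
    qed
  next
    assume D: ?D
    show ?M
    proof (intro allI impI, rule ccontr)
      fix b d assume b: "b permutes {1..n}" "v = b \<circ> d" "reduced_prod b d" "reduced_prod w b" "b \<noteq> id"
      then obtain i where i: "i \<in> {1..<n}" "inv' b (Suc i) < inv' b i"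
        using exists_left_descent by blast
      then obtain c where c: "c permutes {1..n}" "b = adj i \<circ> c" "reduced_prod (adj i) c"
        using left_descent_iff[OF i(1) b(1)] by blast
      have d: "d permutes {1..n}"
        using permutes_cancel(1)[OF b(1), of d] permutes_compose[OF v permutes_inv[OF b(1)]] b(2) by simp
      have "reduced_prod (adj i) (c \<circ> d)"
        using reduced_prod_assoc[OF adj_permutes[OF i(1)] c(1) d] b c by simp
      moreover have "v = adj i \<circ> (c \<circ> d)" using b(2) c(2) by (simp add: comp_assoc)
      ultimately have "inv' v (Suc i) < inv' v i"
        using left_descent_iff[OF i(1) v] permutes_compose[OF d c(1)] by blast
      then have "w (Suc i) < w i" using D i by blast
      moreover have "reduced_prod w (adj i)"
        using reduced_prod_assoc[OF w adj_permutes[OF i(1)] c(1)] b(4) c by simp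
      ultimately show False using reduced_prod_adj_right_iff[OF i(1) w] by simp
    qed
  qed
  also have "?D \<longleftrightarrow> start_set n (perm_braid n v) \<subseteq> finish_set n (perm_braid n w)"
  proof -
    have sub: "sigma n ` A \<subseteq> sigma n ` B \<longleftrightarrow> A \<subseteq> B" if "A \<subseteq> {1..<n}" "B \<subseteq> {1..<n}" for A B
      using that inj_onD[OF inj_sigma[of n]] by blast
    have "?D \<longleftrightarrow> {i \<in> {1..<n}. inv' v (Suc i) < inv' v i} \<subseteq> {i \<in> {1..<n}. w (Suc i) < w i}"
      by blast
    also have "\<dots> \<longleftrightarrow> start_set n (perm_braid n v) \<subseteq> finish_set n (perm_braid n w)"
      unfolding start_set_perm_braid[OF v] finish_set_perm_braid[OF w]
      by (rule sub[symmetric]) blast+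
    finally show ?thesis .
  qed
  finally show ?thesis using normal_list_Cons_iff[OF w v] by simp
qed

text \<open>A simple factor acting on a list lengthens it by at most one, so no word over
  \<open>D\<close> for \<open>x\<close> is shorter than its normal form.\<close>

lemma simple_length_eq:
  assumes x: "x \<in> carrier (braid_monoid n)"
  shows "simple_length n x = length (normal_form n x)"
  unfolding simple_length_def
proof (rule Least_equality)
  let ?L = "normal_form n x"
  have L: "?L \<in> lists (perms n)" by (rule normal_list_lists[OF normal_form_normal[OF x]])
  show "\<exists>ws. ws \<in> lists (simples n) \<and> length ws = length ?L \<and> word_prod (braid_monoid n) ws = x"
    using perms_prod_normal_form[OF x] L unfolding perms_prod_def simples_eq
    by (intro exI[of _ "map (perm_braid n) ?L"]) auto
next
  fix l assume "\<exists>ws. ws \<in> lists (simples n) \<and> length ws = l \<and> word_prod (braid_monoid n) ws = x"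
  then obtain ws where ws: "ws \<in> lists (simples n)" "length ws = l" "word_prod (braid_monoid n) ws = x"
    by blast
  then have "ws \<in> map (perm_braid n) ` lists (perms n)"
    unfolding simples_eq by (simp add: lists_image del: in_lists_conv_set)
  then obtain L where L: "L \<in> lists (perms n)" "ws = map (perm_braid n) L" by blast
  have "length (normal_form n (perms_prod n L)) \<le> length L"
    using L(1)
  proof (induction L)
    case Nil
    then show ?case using normal_form_perms_prod[of n "[]"] by simp
  next
    case (Cons w L)
    then have w: "w permutes {1..n}" and L: "L \<in> lists (perms n)" by auto
    show ?case
      using normal_form_mult[OF w perms_prod_carrier[OF L]] Cons.IH
        length_perm_act_le[of n w "normal_form n (perms_prod n L)"] by simp
  qed
  then show "length (normal_form n x) \<le> l" using ws L by (simp add: perms_prod_def)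
qed

section \<open>Permutations and bipartite graphs\<close>

text \<open>Edges become pairs and the vertex sets are arbitrary, so that orbits, through their
  numbers, can serve as vertices.\<close>

definition bipartite_relations ::
    "'a set \<Rightarrow> 'b set \<Rightarrow> ('a \<Rightarrow> nat) \<Rightarrow> ('b \<Rightarrow> nat) \<Rightarrow> ('a \<times> 'b) set set" where
  "bipartite_relations U V f g = {R. R \<subseteq> U \<times> V \<and>
     (\<forall>u\<in>U. card {v \<in> V. (u, v) \<in> R} = f u) \<and> (\<forall>v\<in>V. card {u \<in> U. (u, v) \<in> R} = g v)}"

text \<open>A renaming that is injective on all possible edges induces an injection on edge sets.
  This serves both the change of encoding and the relabelling of vertices.\<close>

lemma card_image_family:
  assumes inj: "inj_on F D"
    and X: "\<And>E. E \<in> X \<Longrightarrow> E \<subseteq> F ` D"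
    and Y: "\<And>R. R \<in> Y \<Longrightarrow> R \<subseteq> D"
    and iff: "\<And>R. R \<subseteq> D \<Longrightarrow> F ` R \<in> X \<longleftrightarrow> R \<in> Y"
  shows "card X = card Y"
proof -
  have "X = (`) F ` Y"
  proof
    show "X \<subseteq> (`) F ` Y"
    proof
      fix E assume E: "E \<in> X"
      then obtain R where "R \<subseteq> D" "E = F ` R" using X subset_imageE by metis
      then show "E \<in> (`) F ` Y" using iff E by blast
    qed
    show "(`) F ` Y \<subseteq> X" using iff Y by blast
  qed
  moreover have "inj_on ((`) F) Y"
    using Y by (intro inj_onI) (metis inj inj_on_image_eq_iff)
  ultimately show ?thesis by (simp add: card_image)
qed

lemma bip_count_relations:
  "bip_count A B = card (bipartite_relations {..<length A} {..<length B} ((!) A) ((!) B))"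
  unfolding bip_count_def
proof (rule card_image_family)
  let ?F = "\<lambda>(i, j). {Inl i, Inr j} :: (nat + nat) set"
  let ?D = "{..<length A} \<times> {..<length B}"
  have eq: "{{Inl i, Inr j} | i j. i < length A \<and> j < length B} = ?F ` ?D" by auto
  show "inj_on ?F ?D" by (auto simp: inj_on_def doubleton_eq_iff)
  show "E \<subseteq> ?F ` ?D" if "E \<in> {E. E \<subseteq> {{Inl i, Inr j} | i j. i < length A \<and> j < length B} \<and>
      (\<forall>i < length A. card {e \<in> E. Inl i \<in> e} = A ! i) \<and>
      (\<forall>j < length B. card {e \<in> E. Inr j \<in> e} = B ! j)}" for E
    using that unfolding eq by blast
  show "R \<subseteq> ?D" if "R \<in> bipartite_relations {..<length A} {..<length B} ((!) A) ((!) B)" for R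
    using that unfolding bipartite_relations_def by blast
  fix R assume R: "R \<subseteq> ?D"
  have l: "card {e \<in> ?F ` R. Inl i \<in> e} = card {j \<in> {..<length B}. (i, j) \<in> R}" for i
  proof -
    have "{e \<in> ?F ` R. Inl i \<in> e} = (\<lambda>j. {Inl i, Inr j}) ` {j \<in> {..<length B}. (i, j) \<in> R}"
      using R by (auto simp: image_iff)
    moreover have "inj_on (\<lambda>j. {Inl i, Inr j} :: (nat + nat) set) X" for X
      by (auto simp: inj_on_def doubleton_eq_iff)
    ultimately show ?thesis by (simp add: card_image)
  qed
  have r: "card {e \<in> ?F ` R. Inr j \<in> e} = card {i \<in> {..<length A}. (i, j) \<in> R}" for j
  proof -
    have "{e \<in> ?F ` R. Inr j \<in> e} = (\<lambda>i. {Inl i, Inr j}) ` {i \<in> {..<length A}. (i, j) \<in> R}"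
      using R by (auto simp: image_iff)
    moreover have "inj_on (\<lambda>i. {Inl i, Inr j} :: (nat + nat) set) X" for X
      by (auto simp: inj_on_def doubleton_eq_iff)
    ultimately show ?thesis by (simp add: card_image)
  qed
  show "?F ` R \<in> {E. E \<subseteq> {{Inl i, Inr j} | i j. i < length A \<and> j < length B} \<and>
      (\<forall>i < length A. card {e \<in> E. Inl i \<in> e} = A ! i) \<and>
      (\<forall>j < length B. card {e \<in> E. Inr j \<in> e} = B ! j)} \<longleftrightarrow>
    R \<in> bipartite_relations {..<length A} {..<length B} ((!) A) ((!) B)"
    unfolding eq bipartite_relations_def mem_Collect_eq l r using R by (auto simp: image_mono)
qed

lemma Collect_image: "{y \<in> f ` A. P y} = f ` {x \<in> A. P (f x)}"
  by blast

lemma card_bipartite_relations_bij: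
  assumes h: "bij_betw h I U" and k: "bij_betw k J V"
  shows "card (bipartite_relations U V f g) = card (bipartite_relations I J (f \<circ> h) (g \<circ> k))"
proof (rule card_image_family)
  have hi: "inj_on h I" "h ` I = U" and ki: "inj_on k J" "k ` J = V"
    using h k by (auto simp: bij_betw_def)
  show inj: "inj_on (map_prod h k) (I \<times> J)" by (rule map_prod_inj_on[OF hi(1) ki(1)])
  show "E \<subseteq> map_prod h k ` (I \<times> J)" if "E \<in> bipartite_relations U V f g" for E
    using that hi ki unfolding bipartite_relations_def by (simp add: map_prod_surj_on)
  show "R \<subseteq> I \<times> J" if "R \<in> bipartite_relations I J (f \<circ> h) (g \<circ> k)" for R
    using that unfolding bipartite_relations_def by blast
  fix R assume R: "R \<subseteq> I \<times> J"
  have m: "(h i, k j) \<in> map_prod h k ` R \<longleftrightarrow> (i, j) \<in> R" if "i \<in> I" "j \<in> J" for i j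
    using inj_on_image_mem_iff[OF inj _ R, of "(i, j)"] that by simp
  have l: "card {v \<in> V. (h i, v) \<in> map_prod h k ` R} = card {j \<in> J. (i, j) \<in> R}" if "i \<in> I" for i
  proof -
    have "{v \<in> V. (h i, v) \<in> map_prod h k ` R} = k ` {j \<in> J. (h i, k j) \<in> map_prod h k ` R}"
      unfolding ki(2)[symmetric] by (rule Collect_image)
    also have "{j \<in> J. (h i, k j) \<in> map_prod h k ` R} = {j \<in> J. (i, j) \<in> R}"
      using m[OF that] by (intro Collect_cong conj_cong HOL.refl)
    finally have "{v \<in> V. (h i, v) \<in> map_prod h k ` R} = k ` {j \<in> J. (i, j) \<in> R}" .
    then show ?thesis using inj_on_subset[OF ki(1)] by (simp add: card_image)
  qed
  have r: "card {u \<in> U. (u, k j) \<in> map_prod h k ` R} = card {i \<in> I. (i, j) \<in> R}" if "j \<in> J" for j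
  proof -
    have "{u \<in> U. (u, k j) \<in> map_prod h k ` R} = h ` {i \<in> I. (h i, k j) \<in> map_prod h k ` R}"
      unfolding hi(2)[symmetric] by (rule Collect_image)
    also have "{i \<in> I. (h i, k j) \<in> map_prod h k ` R} = {i \<in> I. (i, j) \<in> R}"
      using m[OF _ that] by (intro Collect_cong conj_cong HOL.refl)
    finally have "{u \<in> U. (u, k j) \<in> map_prod h k ` R} = h ` {i \<in> I. (i, j) \<in> R}" .
    then show ?thesis using inj_on_subset[OF hi(1)] by (simp add: card_image)
  qed
  have "map_prod h k ` R \<subseteq> U \<times> V" using R hi(2) ki(2) by auto
  then show "map_prod h k ` R \<in> bipartite_relations U V f g \<longleftrightarrow> R \<in> bipartite_relations I J (f \<circ> h) (g \<circ> k)"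
    unfolding bipartite_relations_def mem_Collect_eq hi(2)[symmetric] ki(2)[symmetric] ball_simps
    using R l r unfolding hi(2)[symmetric] ki(2)[symmetric] by simp
qed

text \<open>Lists with equal multisets of entries are permutations of each other, which yields a
  labelling of \<open>U\<close> matching the degrees. It absorbs the arbitrary order in which a
  partition is listed.\<close>

lemma list_enumeration:
  assumes "finite U" and "mset A = image_mset f (mset_set U)"
  obtains h where "bij_betw h {..<length A} U" "\<forall>i < length A. f (h i) = A ! i"
proof -
  obtain xs where xs: "set xs = U" "distinct xs" using finite_distinct_list[OF assms(1)] by blast
  then have "mset_set U = mset xs" using mset_set_set by metis
  then have "mset A = mset (map f xs)" using assms(2) by simp
  then obtain p where p: "p permutes {..<length (map f xs)}" "permute_list p (map f xs) = A"
    by (rule mset_eq_permutation)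
  then have len: "length A = length xs" by (metis length_map length_permute_list)
  have b: "bij_betw (\<lambda>i. xs ! p i) {..<length xs} U"
    using bij_betw_trans[OF permutes_imp_bij bij_betw_nth[OF xs(2) _ xs(1)[symmetric]], of p "{..<length xs}"] p(1)
    by (simp add: comp_def)
  show thesis
  proof
    show "bij_betw (\<lambda>i. xs ! p i) {..<length A} U" using b len by simp
    show "\<forall>i < length A. f (xs ! p i) = A ! i"
    proof (intro allI impI)
      fix i assume i: "i < length A"
      then have "p i < length xs" using permutes_in_image[OF p(1), of i] len by simp
      then show "f (xs ! p i) = A ! i"
        using p i len by (metis length_map nth_map permute_list_nth)
    qed
  qed
qed

lemma bip_count_eq_relations:
  assumes U: "finite U" "mset A = image_mset f (mset_set U)"
    and V: "finite V" "mset B = image_mset g (mset_set V)"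
  shows "bip_count A B = card (bipartite_relations U V f g)"
proof -
  obtain h where h: "bij_betw h {..<length A} U" "\<forall>i < length A. f (h i) = A ! i"
    by (rule list_enumeration[OF U]) (rule that)
  obtain k where k: "bij_betw k {..<length B} V" "\<forall>i < length B. g (k i) = B ! i"
    by (rule list_enumeration[OF V]) (rule that)
  have "bipartite_relations {..<length A} {..<length B} ((!) A) ((!) B)
      = bipartite_relations {..<length A} {..<length B} (f \<circ> h) (g \<circ> k)"
    unfolding bipartite_relations_def using h(2) k(2) by simp
  then show ?thesis
    unfolding bip_count_relations card_bipartite_relations_bij[OF h(1) k(1)] by simp
qed

section \<open>Ranks in finite linear orders, and permutations recovered from edge sets\<close>

definition rank_in :: "('a \<Rightarrow> 'a \<Rightarrow> bool) \<Rightarrow> 'a set \<Rightarrow> 'a \<Rightarrow> nat" where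
  "rank_in r E e = Suc (card {e' \<in> E. r e' e})"

lemma rank_in_mono:
  assumes "finite E" "transp r" "irreflp r" and e: "e \<in> E" "r e e'"
  shows "rank_in r E e < rank_in r E e'"
proof -
  have "{x \<in> E. r x e} \<subset> {x \<in> E. r x e'}"
    using assms by (auto dest: transpD irreflpD)
  then show ?thesis unfolding rank_in_def using assms(1) by (simp add: psubset_card_mono)
qed

lemma rank_in_bij:
  assumes fin: "finite E" and r: "transp r" "irreflp r" "totalp_on E r"
  shows "bij_betw (rank_in r E) E {1..card E}"
proof -
  have inj: "inj_on (rank_in r E) E"
  proof (rule inj_onI, rule ccontr)
    fix x y assume xy: "x \<in> E" "y \<in> E" "rank_in r E x = rank_in r E y" "x \<noteq> y"
    then have "r x y \<or> r y x" using r(3) by (auto dest: totalp_onD)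
    then show False using rank_in_mono[OF fin r(1,2), of x y] rank_in_mono[OF fin r(1,2), of y x] xy by auto
  qed
  have "rank_in r E ` E \<subseteq> {1..card E}"
  proof (rule image_subsetI)
    fix x assume x: "x \<in> E"
    have "{e' \<in> E. r e' x} \<subset> E" using x r(2) by (auto dest: irreflpD)
    then have "card {e' \<in> E. r e' x} < card E" using fin by (rule psubset_card_mono[rotated])
    then show "rank_in r E x \<in> {1..card E}" by (simp add: rank_in_def)
  qed
  moreover have "card (rank_in r E ` E) = card {1..card E}" using inj by (simp add: card_image)
  ultimately have "rank_in r E ` E = {1..card E}" by (intro card_subset_eq) auto
  with inj show ?thesis by (simp add: bij_betw_def)
qed

text \<open>The elements before \<open>f x\<close> are \<open>f 1, ..., f (x - 1)\<close>, so an
  increasing enumeration is inverse to the rank function.\<close>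

lemma rank_in_enumeration:
  assumes "bij_betw f {1..n} E" and r: "transp r" "irreflp r"
    and mono: "\<And>x y. x \<in> {1..n} \<Longrightarrow> y \<in> {1..n} \<Longrightarrow> x < y \<Longrightarrow> r (f x) (f y)" and x: "x \<in> {1..n}"
  shows "rank_in r E (f x) = x"
proof -
  have f: "inj_on f {1..n}" "f ` {1..n} = E" using assms(1) by (auto simp: bij_betw_def)
  have iff: "r (f y) (f x) \<longleftrightarrow> y < x" if "y \<in> {1..n}" for y
  proof
    assume ryx: "r (f y) (f x)"
    show "y < x"
    proof (rule ccontr)
      assume "\<not> y < x"
      then have "r (f x) (f x)"
        using ryx mono[OF x that] r(1) by (cases "x = y") (auto dest: transpD)
      then show False using r(2) by (auto dest: irreflpD)
    qed
  qed (use mono that x in blast)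
  have "{e' \<in> E. r e' (f x)} = f ` {1..<x}"
    unfolding f(2)[symmetric] using iff x by auto
  moreover have "inj_on f {1..<x}" by (rule inj_on_subset[OF f(1)]) (use x in auto)
  ultimately show ?thesis using x by (simp add: rank_in_def card_image)
qed

text \<open>If one map \<open>q\<close> had \<open>q x < p x\<close> for the other map
  \<open>p\<close>, then at least \<open>x\<close> points would have \<open>q\<close>-value below
  \<open>p x\<close>, but fewer than \<open>x\<close> have \<open>p\<close>-value below it, while
  equal fibre sizes make the two counts equal.\<close>

lemma mono_eq_if_card_fibres_eq:
  fixes p p' :: "nat \<Rightarrow> nat"
  assumes "mono_on {1..n} p" "mono_on {1..n} p'"
    and fib: "\<And>u. card {x \<in> {1..n}. p x = u} = card {x \<in> {1..n}. p' x = u}"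
    and x: "x \<in> {1..n}"
  shows "p x = p' x"
proof -
  have below: "card {x \<in> {1..n}. q x < u} = (\<Sum>v<u. card {x \<in> {1..n}. q x = v})" for q :: "nat \<Rightarrow> nat" and u
  proof -
    have "{x \<in> {1..n}. q x < u} = (\<Union>v\<in>{..<u}. {x \<in> {1..n}. q x = v})" by auto
    then show ?thesis by (simp only:) (subst card_UN_disjoint, auto)
  qed
  have le: "p x \<le> q x" if m: "mono_on {1..n} p" "mono_on {1..n} q"
    and f: "\<And>u. card {x \<in> {1..n}. p x = u} = card {x \<in> {1..n}. q x = u}" for p q :: "nat \<Rightarrow> nat"
  proof (rule ccontr)
    assume "\<not> p x \<le> q x"
    then have qp: "q x < p x" by simp
    have "{y \<in> {1..n}. p y < p x} \<subseteq> {1..<x}"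
    proof
      fix y assume y: "y \<in> {y \<in> {1..n}. p y < p x}"
      then have "\<not> x \<le> y" using mono_onD[OF m(1) x, of y] by auto
      with y show "y \<in> {1..<x}" by auto
    qed
    then have "card {y \<in> {1..n}. p y < p x} \<le> card {1..<x}" by (intro card_mono) auto
    moreover have "{1..x} \<subseteq> {y \<in> {1..n}. q y < p x}"
    proof
      fix y assume "y \<in> {1..x}"
      then show "y \<in> {y \<in> {1..n}. q y < p x}" using mono_onD[OF m(2) _ x, of y] x qp by auto
    qed
    then have "card {1..x} \<le> card {y \<in> {1..n}. q y < p x}" by (intro card_mono) auto
    moreover have "card {y \<in> {1..n}. p y < p x} = card {y \<in> {1..n}. q y < p x}"
      unfolding below using f by simp
    ultimately have "x \<le> x - 1" by simp
    then show False using x by (cases x) (auto simp: One_nat_def)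
  qed
  show ?thesis using le[OF assms(1,2) fib] le[OF assms(2,1) fib[symmetric]] by (rule antisym)
qed

text \<open>The edges of a bipartite graph are enumerated in two ways, by the two lexicographic orders below;
  comparing the enumerations gives the permutation.\<close>

definition row_order :: "nat \<times> nat \<Rightarrow> nat \<times> nat \<Rightarrow> bool" where
  "row_order e e' \<longleftrightarrow> fst e < fst e' \<or> fst e = fst e' \<and> snd e' < snd e"

definition column_order :: "nat \<times> nat \<Rightarrow> nat \<times> nat \<Rightarrow> bool" where
  "column_order e e' \<longleftrightarrow> snd e < snd e' \<or> snd e = snd e' \<and> fst e < fst e'"

lemma row_order: "transp row_order" "irreflp row_order" "totalp_on E row_order"
  by (auto simp: row_order_def transp_on_def irreflp_on_def totalp_on_def)

lemma column_order: "transp column_order" "irreflp column_order" "totalp_on E column_order"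
  by (auto simp: column_order_def transp_on_def irreflp_on_def totalp_on_def)

text \<open>The edge of a point \<open>x\<close> is \<open>(p x, q (w x))\<close>. Its rank in
  \<open>row_order\<close> is \<open>x\<close> and its rank in \<open>column_order\<close> is
  \<open>w x\<close>, so the edge set determines \<open>w\<close>. Ties are broken in opposite
  senses because \<open>w\<close> decreases on fibres of \<open>p\<close> while its inverse
  increases on fibres of \<open>q\<close>.\<close>

lemma card_perms_eq_bipartite_relations:
  fixes p q :: "nat \<Rightarrow> nat"
  assumes p: "mono_on {1..n} p" and q: "mono_on {1..n} q"
  shows "card {w. w permutes {1..n} \<and>
      (\<forall>x\<in>{1..n}. \<forall>y\<in>{1..n}. x < y \<longrightarrow> p x = p y \<longrightarrow> w y < w x) \<and>
      (\<forall>x\<in>{1..n}. \<forall>y\<in>{1..n}. x < y \<longrightarrow> q (w x) = q (w y) \<longrightarrow> w x < w y)}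
    = card (bipartite_relations (p ` {1..n}) (q ` {1..n})
        (\<lambda>u. card {x \<in> {1..n}. p x = u}) (\<lambda>v. card {x \<in> {1..n}. q x = v}))"
    (is "card ?W = card ?B")
proof -
  define e where "e w x = (p x, q (w x))" for w :: "nat \<Rightarrow> nat" and x
  have Wp: "w permutes {1..n}" if "w \<in> ?W" for w using that by simp
  have W1: "w y < w x" if "w \<in> ?W" "x \<in> {1..n}" "y \<in> {1..n}" "x < y" "p x = p y" for w x y
  proof -
    have "\<forall>x\<in>{1..n}. \<forall>y\<in>{1..n}. x < y \<longrightarrow> p x = p y \<longrightarrow> w y < w x" using that(1) by blast
    with that(2-5) show ?thesis by simp
  qed
  have W2: "w x < w y" if "w \<in> ?W" "x \<in> {1..n}" "y \<in> {1..n}" "x < y" "q (w x) = q (w y)" for w x y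
  proof -
    have "\<forall>x\<in>{1..n}. \<forall>y\<in>{1..n}. x < y \<longrightarrow> q (w x) = q (w y) \<longrightarrow> w x < w y" using that(1) by blast
    with that(2-5) show ?thesis by simp
  qed
  have e_inj: "inj_on (e w) {1..n}" if w: "w \<in> ?W" for w
  proof -
    have F: False if xy: "x \<in> {1..n}" "y \<in> {1..n}" "x < y" "e w x = e w y" for x y
    proof -
      have "p x = p y" "q (w x) = q (w y)" using xy(4) by (auto simp: e_def)
      then have "w y < w x" "w x < w y" using W1[OF w xy(1-3)] W2[OF w xy(1-3)] by simp_all
      then show False by simp
    qed
    show ?thesis
    proof (rule inj_onI)
      fix x y assume xy: "x \<in> {1..n}" "y \<in> {1..n}" "e w x = e w y"
      show "x = y"
        using F[OF xy(1,2) _ xy(3)] F[OF xy(2,1) _ xy(3)[symmetric]] by (meson linorder_neqE_nat)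
    qed
  qed
  have w_in: "w x \<in> {1..n} \<longleftrightarrow> x \<in> {1..n}" if "w \<in> ?W" for w x
    by (rule permutes_in_image[OF Wp[OF that]])
  have e_row: "row_order (e w x) (e w y)" if w: "w \<in> ?W" and xy: "x \<in> {1..n}" "y \<in> {1..n}" "x < y" for w x y
  proof (cases "p x = p y")
    case True
    then have "w y < w x" using W1[OF w xy] by simp
    \<comment> \<open>As \<open>w\<close> decreases on a fibre of \<open>p\<close>, the second
      coordinate decreases weakly there, and strictly because edges are distinct.\<close>
    then have "q (w y) \<le> q (w x)"
      using mono_onD[OF q, of "w y" "w x"] w_in[OF w, of x] w_in[OF w, of y] xy(1,2) by linarith
    moreover have "q (w y) \<noteq> q (w x)" using inj_onD[OF e_inj[OF w], of x y] True xy by (auto simp: e_def)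
    ultimately show ?thesis using True by (simp add: row_order_def e_def)
  next
    case False
    then show ?thesis using mono_onD[OF p, of x y] xy by (simp add: row_order_def e_def)
  qed
  have e_column: "column_order (e w x) (e w y)"
    if w: "w \<in> ?W" and xy: "x \<in> {1..n}" "y \<in> {1..n}" "w x < w y" for w x y
  proof (cases "q (w x) = q (w y)")
    case True
    have "\<not> y < x" using W2[OF w xy(2,1)] xy(3) True by fastforce
    then have "p x \<le> p y" using mono_onD[OF p, of x y] xy by simp
    moreover have "p x \<noteq> p y" using inj_onD[OF e_inj[OF w], of x y] True xy by (auto simp: e_def)
    ultimately show ?thesis using True by (simp add: column_order_def e_def)
  next
    case False
    have "q (w x) \<le> q (w y)"
      using mono_onD[OF q, of "w x" "w y"] w_in[OF w, of x] w_in[OF w, of y] xy by linarith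
    with False show ?thesis by (simp add: column_order_def e_def)
  qed
  have row: "rank_in row_order (e w ` {1..n}) (e w x) = x" if w: "w \<in> ?W" and x: "x \<in> {1..n}" for w x
    by (rule rank_in_enumeration[OF inj_on_imp_bij_betw[OF e_inj[OF w]] row_order(1,2) e_row[OF w] x])
  have column: "rank_in column_order (e w ` {1..n}) (e w x) = w x" if w: "w \<in> ?W" and x: "x \<in> {1..n}" for w x
  proof -
    have wp: "w permutes {1..n}" by (rule Wp[OF w])
    have b: "bij_betw (e w \<circ> inv' w) {1..n} (e w ` {1..n})"
      by (rule bij_betw_trans[OF permutes_imp_bij[OF permutes_inv[OF wp]] inj_on_imp_bij_betw[OF e_inj[OF w]]])
    have "rank_in column_order (e w ` {1..n}) ((e w \<circ> inv' w) (w x)) = w x"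
    proof (rule rank_in_enumeration[OF b column_order(1,2)])
      fix y z assume yz: "y \<in> {1..n}" "z \<in> {1..n}" "y < z"
      then show "column_order ((e w \<circ> inv' w) y) ((e w \<circ> inv' w) z)"
        using e_column[OF w, of "inv' w y" "inv' w z"] permutes_in_image[OF permutes_inv[OF wp]]
        by (simp add: permutes_inverses[OF wp])
    qed (use x w_in[OF w] in simp)
    then show ?thesis by (simp add: permutes_inverses[OF wp])
  qed
  have "bij_betw (\<lambda>w. e w ` {1..n}) ?W ?B"
  proof (rule bij_betw_imageI)
    show "inj_on (\<lambda>w. e w ` {1..n}) ?W"
    proof (rule inj_onI)
      fix w w' assume w: "w \<in> ?W" and w': "w' \<in> ?W" and eq: "e w ` {1..n} = e w' ` {1..n}"
      have wp: "w permutes {1..n}" "w' permutes {1..n}" using Wp[OF w] Wp[OF w'] .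
      show "w = w'"
      proof
        fix x show "w x = w' x"
        proof (cases "x \<in> {1..n}")
          case True
          then obtain x' where x': "x' \<in> {1..n}" "e w x = e w' x'" using eq by blast
          then have "x = x'" using row[OF w True] row[OF w' x'(1)] eq by simp
          then show ?thesis using column[OF w True] column[OF w' x'(1)] eq x' by simp
        next
          case False
          then show ?thesis using wp permutes_not_in by metis
        qed
      qed
    qed
    show "(\<lambda>w. e w ` {1..n}) ` ?W = ?B"
    proof
      show "(\<lambda>w. e w ` {1..n}) ` ?W \<subseteq> ?B"
      proof (rule image_subsetI)
        fix w assume w: "w \<in> ?W"
        then have wp: "w permutes {1..n}" by (rule Wp)
        have "card {v \<in> q ` {1..n}. (u, v) \<in> e w ` {1..n}} = card {x \<in> {1..n}. p x = u}" for u
        proof -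
          have "{v \<in> q ` {1..n}. (u, v) \<in> e w ` {1..n}} = (\<lambda>x. q (w x)) ` {x \<in> {1..n}. p x = u}"
            using w_in[OF w] by (auto simp: e_def)
          moreover have "inj_on (\<lambda>x. q (w x)) {x \<in> {1..n}. p x = u}"
          proof (rule inj_onI)
            fix x y assume "x \<in> {x \<in> {1..n}. p x = u}" "y \<in> {x \<in> {1..n}. p x = u}" "q (w x) = q (w y)"
            then show "x = y" by (intro inj_onD[OF e_inj[OF w]]) (simp_all add: e_def)
          qed
          ultimately show ?thesis by (simp add: card_image)
        qed
        moreover have "card {u \<in> p ` {1..n}. (u, v) \<in> e w ` {1..n}} = card {x \<in> {1..n}. q x = v}" for v
        proof -
          have "{u \<in> p ` {1..n}. (u, v) \<in> e w ` {1..n}} = p ` {x \<in> {1..n}. q (w x) = v}"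
            by (auto simp: e_def)
          moreover have "inj_on p {x \<in> {1..n}. q (w x) = v}"
          proof (rule inj_onI)
            fix x y assume "x \<in> {x \<in> {1..n}. q (w x) = v}" "y \<in> {x \<in> {1..n}. q (w x) = v}" "p x = p y"
            then show "x = y" by (intro inj_onD[OF e_inj[OF w]]) (simp_all add: e_def)
          qed
          ultimately have "card {u \<in> p ` {1..n}. (u, v) \<in> e w ` {1..n}} = card {x \<in> {1..n}. q (w x) = v}"
            by (simp add: card_image)
          also have "\<dots> = card (w ` {x \<in> {1..n}. q (w x) = v})"
            by (rule card_image[symmetric, OF permutes_inj_on[OF wp]])
          also have "w ` {x \<in> {1..n}. q (w x) = v} = {x \<in> {1..n}. q x = v}"
            using Collect_image[of w "{1..n}" "\<lambda>x. q x = v"] unfolding permutes_image[OF wp] by simp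
          finally show ?thesis .
        qed
        moreover have "e w ` {1..n} \<subseteq> p ` {1..n} \<times> q ` {1..n}" using w_in[OF w] by (auto simp: e_def)
        ultimately show "e w ` {1..n} \<in> ?B" unfolding bipartite_relations_def by blast
      qed
      \<comment> \<open>The prescribed degrees force \<open>E\<close> to have \<open>n\<close>
        edges. They are enumerated by rows and by columns, and the preimage \<open>w\<close> sends
        the row rank of an edge to its column rank.\<close>
      show "?B \<subseteq> (\<lambda>w. e w ` {1..n}) ` ?W"
      proof
        fix E assume "E \<in> ?B"
        then have E: "E \<subseteq> p ` {1..n} \<times> q ` {1..n}"
          and dp: "\<And>u. u \<in> p ` {1..n} \<Longrightarrow> card {v \<in> q ` {1..n}. (u, v) \<in> E} = card {x \<in> {1..n}. p x = u}"
          and dq: "\<And>v. v \<in> q ` {1..n} \<Longrightarrow> card {u \<in> p ` {1..n}. (u, v) \<in> E} = card {x \<in> {1..n}. q x = v}"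
          unfolding bipartite_relations_def by auto
        have fin: "finite E" by (rule finite_subset[OF E]) auto
        have fstE: "card {x \<in> E. fst x = u} = card {x \<in> {1..n}. p x = u}" for u
        proof (cases "u \<in> p ` {1..n}")
          case True
          have "{x \<in> E. fst x = u} = Pair u ` {v \<in> q ` {1..n}. (u, v) \<in> E}" using E by force
          then show ?thesis using dp[OF True] by (simp add: card_image inj_on_def)
        next
          case False
          then have "{x \<in> E. fst x = u} = {}" "{x \<in> {1..n}. p x = u} = {}" using E by auto
          then show ?thesis by (simp only: card.empty)
        qed
        have sndE: "card {x \<in> E. snd x = v} = card {x \<in> {1..n}. q x = v}" for v
        proof (cases "v \<in> q ` {1..n}")
          case True
          have "{x \<in> E. snd x = v} = (\<lambda>u. (u, v)) ` {u \<in> p ` {1..n}. (u, v) \<in> E}" using E by force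
          then show ?thesis using dq[OF True] by (simp add: card_image inj_on_def)
        next
          case False
          then have "{x \<in> E. snd x = v} = {}" "{x \<in> {1..n}. q x = v} = {}" using E by auto
          then show ?thesis by (simp only: card.empty)
        qed
        have cardE: "card E = n"
        proof -
          have "card E = (\<Sum>u\<in>p ` {1..n}. card {x \<in> E. fst x = u})"
          proof -
            have "fst x \<in> p ` {1..n}" if "x \<in> E" for x
              using subsetD[OF E that] by (simp only: mem_Times_iff)
            then have "E = (\<Union>u\<in>p ` {1..n}. {x \<in> E. fst x = u})" by blast
            moreover have "card (\<Union>u\<in>p ` {1..n}. {x \<in> E. fst x = u}) = (\<Sum>u\<in>p ` {1..n}. card {x \<in> E. fst x = u})"
              by (rule card_UN_disjoint) (use fin in auto)
            ultimately show ?thesis by simp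
          qed
          also have "\<dots> = (\<Sum>u\<in>p ` {1..n}. card {x \<in> {1..n}. p x = u})" using fstE by simp
          also have "\<dots> = card (\<Union>u\<in>p ` {1..n}. {x \<in> {1..n}. p x = u})"
            by (rule card_UN_disjoint[symmetric]) auto
          also have "(\<Union>u\<in>p ` {1..n}. {x \<in> {1..n}. p x = u}) = {1..n}" by auto
          finally show ?thesis by simp
        qed
        let ?r = "rank_in row_order E" and ?c = "rank_in column_order E"
        have rb: "bij_betw ?r E {1..n}" and cb: "bij_betw ?c E {1..n}"
          using rank_in_bij[OF fin row_order] rank_in_bij[OF fin column_order] cardE by auto
        have r_iff: "?r x < ?r y \<longleftrightarrow> row_order x y" if "x \<in> E" "y \<in> E" for x y
          using rank_in_mono[OF fin row_order(1,2), of x y] rank_in_mono[OF fin row_order(1,2), of y x]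
            totalp_onD[OF row_order(3)[of E] that] that by (metis less_asym less_irrefl)
        have c_iff: "?c x < ?c y \<longleftrightarrow> column_order x y" if "x \<in> E" "y \<in> E" for x y
          using rank_in_mono[OF fin column_order(1,2), of x y] rank_in_mono[OF fin column_order(1,2), of y x]
            totalp_onD[OF column_order(3)[of E] that] that by (metis less_asym less_irrefl)
        define f where "f = inv_into E ?r"
        define g where "g = inv_into E ?c"
        have fb: "bij_betw f {1..n} E" and gb: "bij_betw g {1..n} E"
          unfolding f_def g_def using bij_betw_inv_into rb cb by blast+
        have fE: "f x \<in> E" and gE: "g x \<in> E" if "x \<in> {1..n}" for x
          using bij_betwE[OF fb] bij_betwE[OF gb] that by blast+
        have rf: "?r (f x) = x" and cg: "?c (g x) = x" if "x \<in> {1..n}" for x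
          unfolding f_def g_def using that bij_betw_inv_into_right[OF rb] bij_betw_inv_into_right[OF cb] by blast+
        have fr: "f (?r x) = x" and gc: "g (?c x) = x" if "x \<in> E" for x
          unfolding f_def g_def using that bij_betw_inv_into_left[OF rb] bij_betw_inv_into_left[OF cb] by blast+
        \<comment> \<open>The first coordinates along the row enumeration increase weakly and occur
          as often as the values of \<open>p\<close>, so they are those values.\<close>
        have pf: "p x = fst (f x)" if x: "x \<in> {1..n}" for x
        proof (rule mono_eq_if_card_fibres_eq[OF p _ _ x])
          show "mono_on {1..n} (\<lambda>x. fst (f x))"
          proof (rule mono_onI)
            fix x y assume xy: "x \<in> {1..n}" "y \<in> {1..n}" "x \<le> y"
            then show "fst (f x) \<le> fst (f y)"
              using r_iff[OF fE[OF xy(1)] fE[OF xy(2)]] rf by (cases "x = y") (auto simp: row_order_def)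
          qed
          fix u
          have "bij_betw f {x \<in> {1..n}. fst (f x) = u} {x \<in> E. fst x = u}"
            by (rule bij_betw_Collect[OF fb]) (rule HOL.refl)
          from bij_betw_same_card[OF this]
          show "card {x \<in> {1..n}. p x = u} = card {x \<in> {1..n}. fst (f x) = u}"
            unfolding fstE[of u] by (rule HOL.sym)
        qed
        have qg: "q x = snd (g x)" if x: "x \<in> {1..n}" for x
        proof (rule mono_eq_if_card_fibres_eq[OF q _ _ x])
          show "mono_on {1..n} (\<lambda>x. snd (g x))"
          proof (rule mono_onI)
            fix x y assume xy: "x \<in> {1..n}" "y \<in> {1..n}" "x \<le> y"
            then show "snd (g x) \<le> snd (g y)"
              using c_iff[OF gE[OF xy(1)] gE[OF xy(2)]] cg by (cases "x = y") (auto simp: column_order_def)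
          qed
          fix u
          have "bij_betw g {x \<in> {1..n}. snd (g x) = u} {x \<in> E. snd x = u}"
            by (rule bij_betw_Collect[OF gb]) (rule HOL.refl)
          from bij_betw_same_card[OF this]
          show "card {x \<in> {1..n}. q x = u} = card {x \<in> {1..n}. snd (g x) = u}"
            unfolding sndE[of u] by (rule HOL.sym)
        qed
        define w where "w x = (if x \<in> {1..n} then ?c (f x) else x)" for x
        have "bij_betw w {1..n} {1..n}"
          using bij_betw_trans[OF fb cb] by (rule bij_betw_cong[THEN iffD1, rotated]) (simp add: w_def)
        then have wp: "w permutes {1..n}" by (auto simp: permutes_altdef w_def)
        have qw: "q (w x) = snd (f x)" if "x \<in> {1..n}" for x
        proof -
          have "w x = ?c (f x)" using that by (simp add: w_def)
          then show ?thesis using qg[of "w x"] gc[OF fE[OF that]] permutes_in_image[OF wp, of x] that by metis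
        qed
        have "w \<in> ?W"
        proof (intro CollectI conjI ballI impI wp)
          fix x y assume xy: "x \<in> {1..n}" "y \<in> {1..n}" "x < y"
          have ro: "row_order (f x) (f y)" using r_iff[OF fE[OF xy(1)] fE[OF xy(2)]] rf xy by simp
          have wc: "w a = ?c (f a)" if "a \<in> {1..n}" for a using that by (simp add: w_def)
          \<comment> \<open>In a common row the earlier edge has the larger second coordinate, hence
            the larger column rank; in a common column it has the smaller first coordinate, hence
            the smaller column rank.\<close>
          show "w y < w x" if "p x = p y"
            unfolding wc[OF xy(1)] wc[OF xy(2)] c_iff[OF fE[OF xy(2)] fE[OF xy(1)]]
            using ro that pf xy by (auto simp: row_order_def column_order_def)
          show "w x < w y" if "q (w x) = q (w y)"
            unfolding wc[OF xy(1)] wc[OF xy(2)] c_iff[OF fE[OF xy(1)] fE[OF xy(2)]]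
            using ro that qw xy by (auto simp: row_order_def column_order_def)
        qed
        moreover have "e w ` {1..n} = E"
        proof -
          have "e w ` {1..n} = f ` {1..n}"
            by (rule image_cong) (simp_all add: e_def pf qw)
          then show ?thesis using fb by (simp add: bij_betw_def)
        qed
        ultimately show "E \<in> (\<lambda>w. e w ` {1..n}) ` ?W" by blast
      qed
    qed
  qed
  then show ?thesis by (rule bij_betw_same_card)
qed

section \<open>Orbits and degree sequences\<close>

text \<open>\<open>block K\<close> numbers the orbits of the subgroup generated by the transpositions
  \<open>(i i+1)\<close> with \<open>i \<in> K\<close> from left to right, starting with 0.\<close>

definition block :: "nat set \<Rightarrow> nat \<Rightarrow> nat" where
  "block K x = card ({1..<x} - K)"

lemma block_mono: "x \<le> y \<Longrightarrow> block K x \<le> block K y"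
  unfolding block_def by (intro card_mono) auto

lemma block_Suc:
  assumes "1 \<le> x"
  shows "block K (Suc x) = (if x \<in> K then block K x else Suc (block K x))"
proof -
  have "{1..<Suc x} = insert x {1..<x}" using assms by auto
  then show ?thesis by (simp add: block_def insert_Diff_if)
qed

text \<open>Block numbers jump precisely at the positions outside \<open>K\<close>.\<close>

lemma block_eq_iff:
  assumes "1 \<le> x" "x \<le> y"
  shows "block K x = block K y \<longleftrightarrow> {x..<y} \<subseteq> K"
proof
  assume eq: "block K x = block K y"
  show "{x..<y} \<subseteq> K"
  proof
    fix i assume i: "i \<in> {x..<y}"
    then have "block K x \<le> block K i" "block K (Suc i) \<le> block K y" by (auto intro: block_mono)
    with eq block_Suc[of i K] i assms show "i \<in> K" by (auto split: if_splits)
  qed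
next
  show "{x..<y} \<subseteq> K \<Longrightarrow> block K x = block K y"
    using assms(2)
  proof (induction y)
    case (Suc y)
    show ?case
    proof (cases "x = Suc y")
      case False
      then have xy: "x \<le> y" "{x..<y} \<subseteq> K" "y \<in> K" using Suc.prems by auto
      then show ?thesis using Suc.IH block_Suc[of y K] assms(1) by simp
    qed simp
  qed simp
qed

lemma block_adj: "i \<in> K \<Longrightarrow> 1 \<le> i \<Longrightarrow> block K (adj i x) = block K x"
  by (auto simp: transpose_def block_Suc)

text \<open>Each generator swaps two points of one block, so block numbers are constant on
  orbits.\<close>

lemma generate_adj_block:
  assumes K: "K \<subseteq> {1..<n}" and "g \<in> generate (sym_group n) (adj ` K)"
  shows "g permutes {1..n} \<and> block K (g x) = block K x"
  using assms(2)
proof (induction arbitrary: x rule: generate.induct)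
  case one
  show ?case unfolding sym_group_one by (intro conjI permutes_id) simp
next
  case (incl h)
  then obtain i where "i \<in> K" "h = adj i" by blast
  then show ?case using K adj_permutes[of i n] block_adj[of i K x] by auto
next
  case (inv h)
  then obtain i where i: "i \<in> K" "h = adj i" by blast
  then have p: "adj i permutes {1..n}" using K adj_permutes[of i n] by blast
  then have "inv\<^bsub>sym_group n\<^esub> h = adj i" using i sym_group_inv_equality[of "adj i" n] by (simp add: sym_group_carrier)
  then show ?case using i K p block_adj[of i K x] by auto
next
  case (eng h1 h2)
  have "h1 permutes {1..n}" "h2 permutes {1..n}" "block K (h1 (h2 x)) = block K x" using eng.IH by simp_all
  then show ?case unfolding sym_group_mult by (intro conjI permutes_compose) simp_all
qed

text \<open>Consecutive transpositions carry a point along a run of \<open>K\<close>. Both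
  directions are built in one induction, which avoids passing to group inverses.\<close>

lemma generate_adj_moves:
  assumes "x \<le> y" and "{x..<y} \<subseteq> K"
  shows "(\<exists>g \<in> generate (sym_group n) (adj ` K). g x = y) \<and> (\<exists>g \<in> generate (sym_group n) (adj ` K). g y = x)"
proof -
  have id: "id \<in> generate (sym_group n) (adj ` K)" using generate.one[of "sym_group n"] by (simp only: sym_group_one)
  show ?thesis
    using assms
  proof (induction y)
    case 0
    then show ?case using id by (metis id_apply le_zero_eq)
  next
    case (Suc y)
    show ?case
    proof (cases "x = Suc y")
      case True
      then show ?thesis using id by (metis id_apply)
    next
      case False
      then have xy: "x \<le> y" "{x..<y} \<subseteq> K" "y \<in> K" using Suc.prems by auto
      then obtain g h where g: "g \<in> generate (sym_group n) (adj ` K)" "g x = y"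
        and h: "h \<in> generate (sym_group n) (adj ` K)" "h y = x"
        using Suc.IH by blast
      have a: "adj y \<in> generate (sym_group n) (adj ` K)" using xy(3) by (intro generate.incl imageI)
      have "adj y \<circ> g \<in> generate (sym_group n) (adj ` K)" "h \<circ> adj y \<in> generate (sym_group n) (adj ` K)"
        using generate.eng[OF a g(1)] generate.eng[OF h(1) a] by (simp_all add: sym_group_mult)
      moreover have "(adj y \<circ> g) x = Suc y" "(h \<circ> adj y) (Suc y) = x" using g h by simp_all
      ultimately show ?thesis by blast
    qed
  qed
qed

definition block_fibre :: "nat \<Rightarrow> nat set \<Rightarrow> nat \<Rightarrow> nat set" where
  "block_fibre n K u = {x \<in> {1..n}. block K x = u}"

lemma perm_orbits_eq:
  assumes K: "K \<subseteq> {1..<n}"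
  shows "perm_orbits n (sigma n ` K) = block_fibre n K ` block K ` {1..n}"
proof -
  let ?H = "generate (sym_group n) (adj ` K)"
  have "braid_perm (sigma n i) = adj i" if "i \<in> K" for i
    using braid_perm_class[of "[i]" n] that K by (auto simp: sigma_def)
  then have im: "braid_perm ` sigma n ` K = adj ` K" by (simp add: image_image)
  have orb: "{g x | g. g \<in> ?H} = block_fibre n K (block K x)" if x: "x \<in> {1..n}" for x
  proof
    show "{g x | g. g \<in> ?H} \<subseteq> block_fibre n K (block K x)"
    proof clarify
      fix g assume "g \<in> ?H"
      then have "g permutes {1..n}" "block K (g x) = block K x" using generate_adj_block[OF K] by blast+
      then show "g x \<in> block_fibre n K (block K x)"
        using permutes_in_image[of g "{1..n}" x] x by (simp add: block_fibre_def)
    qed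
    show "block_fibre n K (block K x) \<subseteq> {g x | g. g \<in> ?H}"
    proof
      fix y assume "y \<in> block_fibre n K (block K x)"
      then have y: "y \<in> {1..n}" "block K y = block K x" by (auto simp: block_fibre_def)
      have "\<exists>g \<in> ?H. g x = y"
      proof (cases "x \<le> y")
        case True
        then show ?thesis using generate_adj_moves[OF True] block_eq_iff[of x y K] x y by auto
      next
        case False
        then have "y \<le> x" by simp
        then show ?thesis using generate_adj_moves[of y x K n] block_eq_iff[of y x K] x y by auto
      qed
      then show "y \<in> {g x | g. g \<in> ?H}" by blast
    qed
  qed
  have "perm_orbits n (sigma n ` K) = (\<lambda>x. {g x | g. g \<in> ?H}) ` {1..n}"
    unfolding perm_orbits_def im orbits_def orbit_def Setcompr_eq_image by simp
  also have "\<dots> = (\<lambda>x. block_fibre n K (block K x)) ` {1..n}" by (rule image_cong[OF HOL.refl orb])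
  finally show ?thesis by (simp add: image_image)
qed

definition block_sizes :: "nat \<Rightarrow> nat set \<Rightarrow> nat multiset" where
  "block_sizes n K = image_mset (\<lambda>u. card (block_fibre n K u)) (mset_set (block K ` {1..n}))"

lemma block_fibre_nonempty: "u \<in> block K ` {1..n} \<Longrightarrow> block_fibre n K u \<noteq> {}"
  by (auto simp: block_fibre_def)

lemma finite_block_fibre [simp]: "finite (block_fibre n K u)"
  by (simp add: block_fibre_def)

text \<open>Distinct orbits are disjoint and so have distinct least elements; the definite
  description in \<open>deg_seq\<close> thus returns each orbit once. Only the multiset is tracked,
  since \<open>phi\<close> forgets the order.\<close>

lemma mset_deg_seq:
  assumes K: "K \<subseteq> {1..<n}"
  shows "mset (deg_seq n (sigma n ` K)) = block_sizes n K"
proof -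
  let ?U = "block K ` {1..n}"
  let ?O = "block_fibre n K ` ?U"
  have inj: "inj_on (block_fibre n K) ?U"
    by (rule inj_onI) (metis (mono_tags, lifting) block_fibre_nonempty block_fibre_def ex_in_conv mem_Collect_eq)
  have Min_in: "Min X \<in> X" if "X \<in> ?O" for X
    using that block_fibre_nonempty[of _ K n] by (auto intro!: Min_in simp del: One_nat_def)
  have minj: "inj_on Min ?O"
  proof (rule inj_onI)
    fix X Y assume X: "X \<in> ?O" and Y: "Y \<in> ?O" and m: "Min X = Min Y"
    obtain u v where uv: "X = block_fibre n K u" "Y = block_fibre n K v" using X Y by blast
    have "Min X \<in> X" "Min X \<in> Y" using Min_in[OF X] Min_in[OF Y] m by simp_all
    then have "u = v" unfolding uv by (simp add: block_fibre_def)
    then show "X = Y" using uv by simp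
  qed
  have the: "(THE Ob. Ob \<in> ?O \<and> Min Ob = Min X) = X" if "X \<in> ?O" for X
    using that inj_onD[OF minj] by (intro the_equality) blast+
  have "mset (deg_seq n (sigma n ` K))
      = image_mset (\<lambda>m. card (THE Ob. Ob \<in> ?O \<and> Min Ob = m)) (mset_set (Min ` ?O))"
  proof -
    have "mset (sorted_list_of_set A) = mset_set A" for A :: "nat set"
      by (metis mset_sorted_list_of_multiset sorted_list_of_mset_set)
    then show ?thesis unfolding deg_seq_def perm_orbits_eq[OF K] by simp
  qed
  also have "\<dots> = image_mset (\<lambda>X. card (THE Ob. Ob \<in> ?O \<and> Min Ob = Min X)) (mset_set ?O)"
    unfolding image_mset_mset_set[OF minj, symmetric] by (simp add: image_mset.compositionality comp_def)
  also have "\<dots> = image_mset card (mset_set ?O)"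
    by (intro image_mset_cong) (simp add: the)
  also have "\<dots> = block_sizes n K"
    unfolding image_mset_mset_set[OF inj, symmetric] block_sizes_def
    by (simp add: image_mset.compositionality comp_def)
  finally show ?thesis .
qed

lemma sum_mset_block_sizes: "sum_mset (block_sizes n K) = n"
proof -
  have "sum_mset (block_sizes n K) = (\<Sum>u\<in>block K ` {1..n}. card (block_fibre n K u))"
    by (simp add: block_sizes_def sum_unfold_sum_mset)
  also have "\<dots> = card (\<Union>u\<in>block K ` {1..n}. block_fibre n K u)"
    by (rule card_UN_disjoint[symmetric]) (auto simp: block_fibre_def)
  also have "(\<Union>u\<in>block K ` {1..n}. block_fibre n K u) = {1..n}" by (auto simp: block_fibre_def)
  finally show ?thesis by simp
qed

lemma block_sizes_partition: "block_sizes n K \<in> partitions n"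
  unfolding partitions_def using sum_mset_block_sizes[of n K] block_fibre_nonempty[of _ K n]
  by (auto simp: block_sizes_def)

lemma size_block_sizes: "size (block_sizes n K) = card (block K ` {1..n})"
  by (simp add: block_sizes_def)

text \<open>Having \<open>n\<close> parts forces the block numbers to be injective. Applied to
  complements, this shows that the special row of \<open>N_tilde\<close> is met only by the empty
  state.\<close>

lemma block_sizes_ones_iff:
  assumes K: "K \<subseteq> {1..<n}"
  shows "block_sizes n K = replicate_mset n 1 \<longleftrightarrow> K = {}"
proof
  assume eq: "block_sizes n K = replicate_mset n 1"
  have "card (block K ` {1..n}) = card {1..n}" using arg_cong[OF eq, of size] by (simp add: size_block_sizes)
  then have inj: "inj_on (block K) {1..n}" by (intro eq_card_imp_inj_on) simp_all
  have "i \<notin> K" for i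
  proof
    assume i: "i \<in> K"
    then have "block K i = block K (Suc i)" using K block_Suc[of i K] by auto
    moreover have "i \<in> {1..n}" "Suc i \<in> {1..n}" using i K by auto
    ultimately show False using inj_onD[OF inj] by fastforce
  qed
  then show "K = {}" by blast
next
  assume e: "K = {}"
  have b: "block K x = x - 1" for x by (simp add: block_def e)
  have inj: "inj_on (block K) {1..n}" by (rule inj_onI) (auto simp: b)
  have "card (block_fibre n K u) = 1" if u: "u \<in> block K ` {1..n}" for u
  proof -
    obtain x where x: "x \<in> {1..n}" "u = block K x" using u by blast
    have "block_fibre n K u = {x}" using x inj_onD[OF inj] by (auto simp: block_fibre_def)
    then show ?thesis by simp
  qed
  then have "block_sizes n K = image_mset (\<lambda>_. 1) (mset_set (block K ` {1..n}))"
    unfolding block_sizes_def by (intro image_mset_cong) simp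
  also have "\<dots> = replicate_mset (card (block K ` {1..n})) 1" by (simp add: image_mset_const_eq)
  finally show "block_sizes n K = replicate_mset n 1" using card_image[OF inj] by simp
qed

text \<open>A single part means that the block number never jumps. It allows the empty state to be
  recognised from its partition, as is needed for \<open>v_vec\<close> to factor through
  \<open>phi\<close>.\<close>

lemma block_sizes_full_iff:
  assumes K: "K \<subseteq> {1..<n}" and n: "n \<ge> 1"
  shows "block_sizes n K = {#n#} \<longleftrightarrow> K = {1..<n}"
proof
  assume eq: "block_sizes n K = {#n#}"
  have "card (block K ` {1..n}) = 1" using arg_cong[OF eq, of size] by (simp add: size_block_sizes)
  then obtain u where u: "block K ` {1..n} = {u}" by (rule card_1_singletonE)
  have "block K 1 = u" "block K n = u" using u n by (auto simp: set_eq_iff)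
  then have "{1..<n} \<subseteq> K" using block_eq_iff[of 1 n K] n by simp
  with K show "K = {1..<n}" by blast
next
  assume K: "K = {1..<n}"
  have b: "block K x = 0" if "x \<in> {1..n}" for x using that by (auto simp: block_def K)
  then have "block K ` {1..n} = {0}" using n by force
  moreover have "block_fibre n K 0 = {1..n}" using b by (auto simp: block_fibre_def)
  ultimately show "block_sizes n K = {#n#}" by (simp add: block_sizes_def)
qed

definition generator_indices :: "nat \<Rightarrow> nat list set set \<Rightarrow> nat set" where
  "generator_indices n X = {i \<in> {1..<n}. sigma n i \<in> X}"

lemma sigma_generator_indices: "X \<in> states n \<Longrightarrow> sigma n ` generator_indices n X = X"
  by (auto simp: states_def atoms_def generator_indices_def)

lemma generator_indices_subset: "generator_indices n X \<subseteq> {1..<n}"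
  by (auto simp: generator_indices_def)

lemma phi_eq: "phi n X = block_sizes n ({1..<n} - generator_indices n X)"
proof -
  have "atoms n - X = sigma n ` ({1..<n} - generator_indices n X)"
    by (auto simp: atoms_def generator_indices_def)
  then show ?thesis unfolding phi_def using mset_deg_seq[of "{1..<n} - generator_indices n X" n] by simp
qed

lemma phi_complement: "phi n (atoms n - X) = block_sizes n (generator_indices n X)"
proof -
  have "{1..<n} - generator_indices n (atoms n - X) = generator_indices n X"
    by (auto simp: atoms_def generator_indices_def)
  then show ?thesis by (simp add: phi_eq)
qed

lemma phi_partition: "phi n X \<in> partitions n"
  unfolding phi_eq by (rule block_sizes_partition)

lemma phi_complement_ones_iff:
  assumes "X \<in> states n"
  shows "phi n (atoms n - X) = replicate_mset n 1 \<longleftrightarrow> X = {}"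
  unfolding phi_complement block_sizes_ones_iff[OF generator_indices_subset]
  using sigma_generator_indices[OF assms] by (auto simp: generator_indices_def)

lemma phi_full_iff:
  assumes "X \<in> states n" and "n \<ge> 1"
  shows "phi n X = {#n#} \<longleftrightarrow> X = {}"
proof -
  have "phi n X = {#n#} \<longleftrightarrow> generator_indices n X = {}"
    unfolding phi_eq using block_sizes_full_iff[of "{1..<n} - generator_indices n X" n] assms(2)
      generator_indices_subset[of n X] by blast
  then show ?thesis using sigma_generator_indices[OF assms(1)] by (auto simp: generator_indices_def)
qed

section \<open>Descent conditions as order conditions on blocks\<close>

lemma transp_chain:
  assumes "transp R" and "x < (y :: nat)" and "\<And>i. i \<in> {x..<y} \<Longrightarrow> R (f i) (f (Suc i))"
  shows "R (f x) (f y)"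
  using assms(2,3)
proof (induction y)
  case (Suc y)
  show ?case
  proof (cases "x = y")
    case False
    then have "R (f x) (f y)" using Suc by auto
    moreover have "R (f y) (f (Suc y))" using Suc.prems by auto
    ultimately show ?thesis by (rule transpD[OF assms(1)])
  qed (use Suc in auto)
qed simp

lemma descending_blocks_iff:
  assumes w: "w permutes {1..n}" and J: "J \<subseteq> {1..<n}"
  shows "(\<forall>x\<in>{1..n}. \<forall>y\<in>{1..n}. x < y \<longrightarrow> block J x = block J y \<longrightarrow> w y < w x) \<longleftrightarrow>
    (\<forall>i\<in>J. w (Suc i) < w i)" (is "?L \<longleftrightarrow> ?R")
proof
  assume l: ?L
  show ?R
  proof
    fix i assume i: "i \<in> J"
    then have "i \<in> {1..n}" "Suc i \<in> {1..n}" "block J i = block J (Suc i)" using J block_Suc[of i J] by auto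
    with l show "w (Suc i) < w i" by simp
  qed
next
  assume r: ?R
  have tr: "transp (\<lambda>a b :: nat. b < a)" by (auto simp: transp_on_def)
  show ?L
  proof (intro ballI impI)
    fix x y assume "x \<in> {1..n}" "y \<in> {1..n}" "x < y" "block J x = block J y"
    then have "{x..<y} \<subseteq> J" using block_eq_iff[of x y J] by simp
    then show "w y < w x" using transp_chain[OF tr \<open>x < y\<close>, of w] r by blast
  qed
qed

text \<open>Here the blocks partition the values of \<open>w\<close>, so the comparisons of
  neighbours are chained for \<open>inv' w\<close>.\<close>

lemma ascending_inverse_blocks_iff:
  assumes w: "w permutes {1..n}" and K: "K \<subseteq> {1..<n}"
  shows "(\<forall>x\<in>{1..n}. \<forall>y\<in>{1..n}. x < y \<longrightarrow> block K (w x) = block K (w y) \<longrightarrow> w x < w y) \<longleftrightarrow>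
    (\<forall>k\<in>K. inv' w k < inv' w (Suc k))" (is "?L \<longleftrightarrow> ?R")
proof
  assume l: ?L
  show ?R
  proof (rule ballI, rule ccontr)
    fix k assume k: "k \<in> K" and "\<not> inv' w k < inv' w (Suc k)"
    then have lt: "inv' w (Suc k) < inv' w k" using inv_neq[OF w, of k] by simp
    have "k \<in> {1..n}" "Suc k \<in> {1..n}" "block K (Suc k) = block K k" using k K block_Suc[of k K] by auto
    moreover from this have "inv' w k \<in> {1..n}" "inv' w (Suc k) \<in> {1..n}"
      using permutes_in_image[OF permutes_inv[OF w]] by blast+
    ultimately have "w (inv' w (Suc k)) < w (inv' w k)"
      using l[rule_format, of "inv' w (Suc k)" "inv' w k"] lt unfolding permutes_inverses(1)[OF w] by blast
    then show False by (simp add: permutes_inverses(1)[OF w])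
  qed
next
  assume r: ?R
  have tr: "transp (\<lambda>a b :: nat. a < b)" by (auto simp: transp_on_def)
  show ?L
  proof (intro ballI impI, rule ccontr)
    fix x y assume xy: "x \<in> {1..n}" "y \<in> {1..n}" "x < y" "block K (w x) = block K (w y)" "\<not> w x < w y"
    have "w x \<noteq> w y" using xy(3) permutes_inj[OF w] by (auto dest: injD)
    then have lt: "w y < w x" using xy by simp
    have "w y \<in> {1..n}" using xy permutes_in_image[OF w] by blast
    then have "{w y..<w x} \<subseteq> K" using block_eq_iff[of "w y" "w x" K] lt xy(4) by simp
    then have "inv' w (w y) < inv' w (w x)" using transp_chain[OF tr lt, of "inv' w"] r by blast
    then show False using xy(3) by (simp add: permutes_inverses(2)[OF w])
  qed
qed

text \<open>The start condition excludes left descents outside \<open>X\<close>, hence the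
  complement in \<open>?K\<close>, while the finish condition prescribes right descents in
  \<open>Z\<close>, hence \<open>?J\<close>. Both become order conditions on blocks.\<close>

lemma card_simples_eq_bip_count:
  assumes Z: "Z \<in> states n" and X: "X \<in> states n"
  shows "card {s \<in> simples n. start_set n s \<subseteq> X \<and> Z \<subseteq> finish_set n s}
    = bip_count_part (phi n (atoms n - Z)) (phi n X)"
proof -
  let ?J = "generator_indices n Z" and ?K = "{1..<n} - generator_indices n X"
  have J: "?J \<subseteq> {1..<n}" and K: "?K \<subseteq> {1..<n}" using generator_indices_subset by auto
  have iff: "start_set n (perm_braid n w) \<subseteq> X \<and> Z \<subseteq> finish_set n (perm_braid n w) \<longleftrightarrow>
      (\<forall>x\<in>{1..n}. \<forall>y\<in>{1..n}. x < y \<longrightarrow> block ?J x = block ?J y \<longrightarrow> w y < w x) \<and>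
      (\<forall>x\<in>{1..n}. \<forall>y\<in>{1..n}. x < y \<longrightarrow> block ?K (w x) = block ?K (w y) \<longrightarrow> w x < w y)"
    if w: "w permutes {1..n}" for w
  proof -
    have "start_set n (perm_braid n w) \<subseteq> X \<longleftrightarrow> (\<forall>k\<in>?K. inv' w k < inv' w (Suc k))"
    proof -
      have "start_set n (perm_braid n w) \<subseteq> X \<longleftrightarrow> (\<forall>k\<in>?K. \<not> inv' w (Suc k) < inv' w k)"
        unfolding start_set_perm_braid[OF w] generator_indices_def by blast
      also have "\<dots> \<longleftrightarrow> (\<forall>k\<in>?K. inv' w k < inv' w (Suc k))"
        using inv_neq[OF w] by (meson linorder_neqE_nat less_asym)
      finally show ?thesis .
    qed
    moreover have "Z \<subseteq> finish_set n (perm_braid n w) \<longleftrightarrow> (\<forall>i\<in>?J. w (Suc i) < w i)"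
    proof -
      have "Z \<subseteq> finish_set n (perm_braid n w) \<longleftrightarrow> sigma n ` ?J \<subseteq> sigma n ` {i \<in> {1..<n}. w (Suc i) < w i}"
        unfolding finish_set_perm_braid[OF w] sigma_generator_indices[OF Z] ..
      also have "\<dots> \<longleftrightarrow> ?J \<subseteq> {i \<in> {1..<n}. w (Suc i) < w i}"
        using inj_onD[OF inj_sigma[of n]] J by blast
      also have "\<dots> \<longleftrightarrow> (\<forall>i\<in>?J. w (Suc i) < w i)" using J by blast
      finally show ?thesis .
    qed
    ultimately show ?thesis
      unfolding descending_blocks_iff[OF w J] ascending_inverse_blocks_iff[OF w K] by blast
  qed
  let ?W = "{w. w permutes {1..n} \<and>
      (\<forall>x\<in>{1..n}. \<forall>y\<in>{1..n}. x < y \<longrightarrow> block ?J x = block ?J y \<longrightarrow> w y < w x) \<and>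
      (\<forall>x\<in>{1..n}. \<forall>y\<in>{1..n}. x < y \<longrightarrow> block ?K (w x) = block ?K (w y) \<longrightarrow> w x < w y)}"
  have "{s \<in> simples n. start_set n s \<subseteq> X \<and> Z \<subseteq> finish_set n s} = perm_braid n ` ?W"
    unfolding simples_eq Collect_image using iff by (intro arg_cong[where f = "image _"]) (simp only: mem_Collect_eq cong: conj_cong)
  moreover have "inj_on (perm_braid n) ?W"
    by (rule inj_on_subset[OF perm_braid_inj]) (rule Collect_mono, rule impI, erule conjunct1)
  ultimately have "card {s \<in> simples n. start_set n s \<subseteq> X \<and> Z \<subseteq> finish_set n s} = card ?W"
    by (simp only: card_image)
  also have "\<dots> = card (bipartite_relations (block ?J ` {1..n}) (block ?K ` {1..n})
      (\<lambda>u. card {x \<in> {1..n}. block ?J x = u}) (\<lambda>v. card {x \<in> {1..n}. block ?K x = v}))"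
    by (rule card_perms_eq_bipartite_relations) (simp_all add: mono_on_def block_mono)
  also have "\<dots> = bip_count_part (phi n (atoms n - Z)) (phi n X)"
    unfolding bip_count_part_def
  proof (rule bip_count_eq_relations[symmetric])
    show "mset (sorted_list_of_multiset (phi n (atoms n - Z))) =
        image_mset (\<lambda>u. card {x \<in> {1..n}. block ?J x = u}) (mset_set (block ?J ` {1..n}))"
      unfolding phi_complement block_sizes_def block_fibre_def by simp
    show "mset (sorted_list_of_multiset (phi n X)) =
        image_mset (\<lambda>u. card {x \<in> {1..n}. block ?K x = u}) (mset_set (block ?K ` {1..n}))"
      unfolding phi_eq block_sizes_def block_fibre_def by simp
  qed simp_all
  finally show ?thesis .
qed

lemma card_simples: "card (simples n) = fact n"
  using card_image[OF perm_braid_inj, of n] card_permutations[of "{1..n}" n] by (simp add: simples_eq)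

lemma finite_simples: "finite (simples n)"
  unfolding simples_eq by (intro finite_imageI finite_permutations) simp

section \<open>Matrices\<close>

lemma mat_mul_assoc:
  "finite K \<Longrightarrow> finite L \<Longrightarrow> (A \<cdot>\<^bsub>K\<^esub> B) \<cdot>\<^bsub>L\<^esub> C = A \<cdot>\<^bsub>K\<^esub> (B \<cdot>\<^bsub>L\<^esub> C)"
  unfolding mat_mul_def
  by (intro ext) (simp add: sum_distrib_left sum_distrib_right mult.assoc sum.swap[of _ L K])

lemma mat_mul_cong:
  assumes "mat_eq I K A A'" and "mat_eq K J B B'"
  shows "mat_eq I J (A \<cdot>\<^bsub>K\<^esub> B) (A' \<cdot>\<^bsub>K\<^esub> B')"
  using assms unfolding mat_eq_def mat_mul_def by (auto intro!: sum.cong)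

lemma mat_eq_refl [simp]: "mat_eq I J A A"
  by (simp add: mat_eq_def)

lemma mat_eq_sym: "mat_eq I J A B \<Longrightarrow> mat_eq I J B A"
  by (simp add: mat_eq_def)

lemma mat_eq_trans: "mat_eq I J A B \<Longrightarrow> mat_eq I J B C \<Longrightarrow> mat_eq I J A C"
  by (simp add: mat_eq_def)

lemma mat_mul_id_left: "finite I \<Longrightarrow> mat_eq I J (mat_id \<cdot>\<^bsub>I\<^esub> A) A"
  unfolding mat_eq_def mat_mul_def mat_id_def by (simp add: if_distrib[of "\<lambda>c. c * _"] cong: if_cong)

lemma mat_mul_id_right: "finite J \<Longrightarrow> mat_eq I J (A \<cdot>\<^bsub>J\<^esub> mat_id) A"
  unfolding mat_eq_def mat_mul_def mat_id_def by (simp add: if_distrib[of "\<lambda>c. _ * c"] cong: if_cong)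

text \<open>Inverses are unique only up to \<open>mat_eq\<close>, since entries outside
  \<open>I\<close> are arbitrary. The usual computation \<open>N' = N' M N = N\<close> is carried
  out in that sense.\<close>

lemma mat_inv_eq:
  assumes "finite I" and N: "is_mat_inverse I M N"
  shows "mat_eq I I (mat_inv I M) N"
proof -
  let ?N = "mat_inv I M"
  have N': "is_mat_inverse I M ?N" unfolding mat_inv_def by (rule someI[where P = "is_mat_inverse I M", OF N])
  have "mat_eq I I ?N (?N \<cdot>\<^bsub>I\<^esub> (M \<cdot>\<^bsub>I\<^esub> N))"
    using N mat_eq_sym mat_eq_trans mat_mul_id_right[OF assms(1)] mat_mul_cong[OF mat_eq_refl]
    unfolding is_mat_inverse_def by meson
  also have "?N \<cdot>\<^bsub>I\<^esub> (M \<cdot>\<^bsub>I\<^esub> N) = (?N \<cdot>\<^bsub>I\<^esub> M) \<cdot>\<^bsub>I\<^esub> N"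
    by (simp add: mat_mul_assoc assms(1))
  finally have 1: "mat_eq I I ?N ((?N \<cdot>\<^bsub>I\<^esub> M) \<cdot>\<^bsub>I\<^esub> N)" .
  have "mat_eq I I ((?N \<cdot>\<^bsub>I\<^esub> M) \<cdot>\<^bsub>I\<^esub> N) (mat_id \<cdot>\<^bsub>I\<^esub> N)"
    using N' unfolding is_mat_inverse_def by (intro mat_mul_cong) auto
  from mat_eq_trans[OF 1 mat_eq_trans[OF this mat_mul_id_left[OF assms(1)]]] show ?thesis .
qed

text \<open>Expand the product of the factors \<open>1 - 1\<close> over \<open>A\<close>.\<close>

lemma sum_alternating_Pow:
  assumes "finite A"
  shows "(\<Sum>B\<in>Pow A. (- 1) ^ card B) = (if A = {} then 1 else (0 :: int))"
  using prod_diff_conv_sum[OF assms, of "\<lambda>_. 1 :: int" "\<lambda>_. 1"] assms by (simp add: power_0_left)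

text \<open>This is the Moebius function of the Boolean lattice, \<open>S_mat\<close> being its zeta
  function.\<close>

definition moebius_mat :: "(state, state) imat" where
  "moebius_mat = (\<lambda>X Y. if X \<subseteq> Y then (- 1) ^ card (Y - X) else 0)"

lemma sum_moebius_interval:
  assumes "finite Y" and "X \<subseteq> Y"
  shows "(\<Sum>Z\<in>{Z. X \<subseteq> Z \<and> Z \<subseteq> Y}. (- 1) ^ card (Z - X)) = (if X = Y then 1 else (0 :: int))"
    and "(\<Sum>Z\<in>{Z. X \<subseteq> Z \<and> Z \<subseteq> Y}. (- 1) ^ card (Y - Z)) = (if X = Y then 1 else (0 :: int))"
proof -
  have "(\<Sum>Z\<in>{Z. X \<subseteq> Z \<and> Z \<subseteq> Y}. (- 1) ^ card (Z - X)) = (\<Sum>B\<in>Pow (Y - X). (- 1) ^ card B :: int)"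
    by (rule sum.reindex_bij_witness[of _ "\<lambda>B. B \<union> X" "\<lambda>Z. Z - X"]) (use assms in \<open>auto intro!: arg_cong[where f = card]\<close>)
  then show "(\<Sum>Z\<in>{Z. X \<subseteq> Z \<and> Z \<subseteq> Y}. (- 1) ^ card (Z - X)) = (if X = Y then 1 else (0 :: int))"
    using sum_alternating_Pow[of "Y - X"] assms by auto
  have "(\<Sum>Z\<in>{Z. X \<subseteq> Z \<and> Z \<subseteq> Y}. (- 1) ^ card (Y - Z)) = (\<Sum>B\<in>Pow (Y - X). (- 1) ^ card B :: int)"
    by (rule sum.reindex_bij_witness[of _ "\<lambda>B. Y - B" "\<lambda>Z. Y - Z"]) (use assms in \<open>auto intro!: arg_cong[where f = card]\<close>)
  then show "(\<Sum>Z\<in>{Z. X \<subseteq> Z \<and> Z \<subseteq> Y}. (- 1) ^ card (Y - Z)) = (if X = Y then 1 else (0 :: int))"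
    using sum_alternating_Pow[of "Y - X"] assms by auto
qed

lemma finite_atoms [simp]: "finite (atoms n)"
  by (simp add: atoms_def)

lemma finite_states [simp]: "finite (states n)"
  by (simp add: states_def)

lemma finite_state: "X \<in> states n \<Longrightarrow> finite X"
  unfolding states_def using finite_subset[OF _ finite_atoms] by blast

lemma S_mat_inverse: "is_mat_inverse (states n) S_mat moebius_mat"
  unfolding is_mat_inverse_def mat_eq_def
proof (intro conjI ballI)
  fix X Y assume X: "X \<in> states n" and Y: "Y \<in> states n"
  have int: "{Z. X \<subseteq> Z \<and> Z \<subseteq> Y} = {Z \<in> states n. X \<subseteq> Z \<and> Z \<subseteq> Y}" using Y by (auto simp: states_def)
  have none: "{Z. X \<subseteq> Z \<and> Z \<subseteq> Y} = {}" if "\<not> X \<subseteq> Y" using that by blast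
  have "(S_mat \<cdot>\<^bsub>states n\<^esub> moebius_mat) X Y = (\<Sum>Z\<in>states n. if X \<subseteq> Z \<and> Z \<subseteq> Y then (- 1) ^ card (Y - Z) else 0)"
    unfolding mat_mul_def S_mat_def moebius_mat_def by (rule sum.cong) simp_all
  also have "\<dots> = (\<Sum>Z\<in>{Z. X \<subseteq> Z \<and> Z \<subseteq> Y}. (- 1) ^ card (Y - Z))"
    unfolding int by (rule sum.inter_filter[symmetric]) simp
  also have "\<dots> = mat_id X Y"
  proof (cases "X \<subseteq> Y")
    case True
    show ?thesis unfolding sum_moebius_interval(2)[OF finite_state[OF Y] True] mat_id_def ..
  next
    case False
    then have "X \<noteq> Y" by blast
    then show ?thesis unfolding none[OF False] by (simp add: mat_id_def)
  qed
  finally show "(S_mat \<cdot>\<^bsub>states n\<^esub> moebius_mat) X Y = mat_id X Y" .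
  have "(moebius_mat \<cdot>\<^bsub>states n\<^esub> S_mat) X Y = (\<Sum>Z\<in>states n. if X \<subseteq> Z \<and> Z \<subseteq> Y then (- 1) ^ card (Z - X) else 0)"
    unfolding mat_mul_def S_mat_def moebius_mat_def by (rule sum.cong) simp_all
  also have "\<dots> = (\<Sum>Z\<in>{Z. X \<subseteq> Z \<and> Z \<subseteq> Y}. (- 1) ^ card (Z - X))"
    unfolding int by (rule sum.inter_filter[symmetric]) simp
  also have "\<dots> = mat_id X Y"
  proof (cases "X \<subseteq> Y")
    case True
    show ?thesis unfolding sum_moebius_interval(1)[OF finite_state[OF Y] True] mat_id_def ..
  next
    case False
    then have "X \<noteq> Y" by blast
    then show ?thesis unfolding none[OF False] by (simp add: mat_id_def)
  qed
  finally show "(moebius_mat \<cdot>\<^bsub>states n\<^esub> S_mat) X Y = mat_id X Y" .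
qed

section \<open>The automaton and its transition matrix\<close>

lemma transition_in_states: "transition n X s \<in> states n"
  by (auto simp: transition_def states_def finish_set_def)

text \<open>The empty state absorbs every simple element, so the row of \<open>S T\<close> indexed by the empty set
  counts all of them; this is why that row of the matrix of bipartite graphs is replaced
  by \<open>n!\<close>.\<close>

lemma S_mat_T_mat:
  assumes Z: "Z \<in> states n" and X: "X \<in> states n"
  shows "(S_mat \<cdot>\<^bsub>states n\<^esub> T_mat n) Z X = N_tilde n (phi n (atoms n - Z)) (phi n X)"
proof -
  have "(S_mat \<cdot>\<^bsub>states n\<^esub> T_mat n) Z X
      = int (\<Sum>Y\<in>{Y \<in> states n. Z \<subseteq> Y}. card {s \<in> simples n. transition n X s = Y})"
  proof -
    have "(S_mat \<cdot>\<^bsub>states n\<^esub> T_mat n) Z X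
        = (\<Sum>Y\<in>states n. if Z \<subseteq> Y then int (card {s \<in> simples n. transition n X s = Y}) else 0)"
      unfolding mat_mul_def S_mat_def T_mat_def by (rule sum.cong) simp_all
    also have "\<dots> = (\<Sum>Y\<in>{Y \<in> states n. Z \<subseteq> Y}. int (card {s \<in> simples n. transition n X s = Y}))"
      by (rule sum.inter_filter[symmetric]) simp
    finally show ?thesis by (simp only: of_nat_sum)
  qed
  also have "(\<Sum>Y\<in>{Y \<in> states n. Z \<subseteq> Y}. card {s \<in> simples n. transition n X s = Y})
      = card (\<Union>Y\<in>{Y \<in> states n. Z \<subseteq> Y}. {s \<in> simples n. transition n X s = Y})"
    by (rule card_UN_disjoint[symmetric]) (use finite_simples in auto)
  also have "(\<Union>Y\<in>{Y \<in> states n. Z \<subseteq> Y}. {s \<in> simples n. transition n X s = Y})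
      = {s \<in> simples n. Z \<subseteq> transition n X s}"
    using transition_in_states by blast
  finally have eq: "(S_mat \<cdot>\<^bsub>states n\<^esub> T_mat n) Z X = int (card {s \<in> simples n. Z \<subseteq> transition n X s})" .
  show ?thesis
  proof (cases "Z = {}")
    case True
    have "phi n (atoms n - Z) = replicate_mset n 1" using phi_complement_ones_iff[OF Z] True by simp
    then show ?thesis unfolding eq using True by (simp add: N_tilde_def card_simples)
  next
    case False
    \<comment> \<open>A rejected letter leads to \<open>{}\<close>, which does not contain the
      nonempty \<open>Z\<close>, so only legal letters are counted.\<close>
    then have "{s \<in> simples n. Z \<subseteq> transition n X s} = {s \<in> simples n. start_set n s \<subseteq> X \<and> Z \<subseteq> finish_set n s}"
      by (auto simp: transition_def split: if_splits)
    then show ?thesis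
      unfolding eq using card_simples_eq_bip_count[OF Z X] phi_complement_ones_iff[OF Z] False
      by (simp add: N_tilde_def)
  qed
qed

text \<open>A letter that passes the test in the empty state has empty starting set, hence is 1, and
  its finishing set is again empty.\<close>

lemma foldl_transition_empty:
  "ws \<in> lists (simples n) \<Longrightarrow> foldl (transition n) {} ws = {}"
proof (induction ws)
  case (Cons s ws)
  then obtain w where w: "w permutes {1..n}" "s = perm_braid n w" unfolding simples_eq by auto
  have "transition n {} s = {}"
  proof (cases "start_set n s = {}")
    case True
    have "w = id"
    proof (rule ccontr)
      assume "w \<noteq> id"
      then obtain i where "i \<in> {1..<n}" "inv' w (Suc i) < inv' w i" using exists_left_descent[OF w(1)] by blast
      then show False using True start_set_perm_braid[OF w(1)] w(2) by blast
    qed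
    then show ?thesis unfolding w(2) transition_def finish_set_perm_braid[OF w(1)] by simp
  qed (simp add: transition_def)
  then show ?case using Cons by simp
qed simp

lemma finish_set_nonempty:
  assumes w: "w permutes {1..n}" and "w \<noteq> id"
  shows "finish_set n (perm_braid n w) \<noteq> {}"
proof -
  obtain i where i: "i \<in> {1..<n}" "\<not> w i < w (Suc i)" using permutes_id_if_ascending[OF w] assms(2) by blast
  have "w i \<noteq> w (Suc i)" using permutes_inj[OF w] by (metis injD n_not_Suc_n)
  with i show ?thesis unfolding finish_set_perm_braid[OF w] by auto
qed

lemma finish_set_id: "finish_set n (perm_braid n id) = {}"
  unfolding finish_set_perm_braid[OF permutes_id] by simp

text \<open>The state holds the finishing set of the last letter, and by
  \<open>normal_list_Cons_Cons_iff\<close> the next letter has to be tested against nothing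
  else.\<close>

lemma accepted_from_finish_set:
  assumes "w permutes {1..n}" "w \<noteq> id" "L \<in> lists (perms n)"
  shows "foldl (transition n) (finish_set n (perm_braid n w)) (map (perm_braid n) L) \<noteq> {} \<longleftrightarrow>
    normal_list n (w # L)"
  using assms
proof (induction L arbitrary: w)
  case Nil
  then show "foldl (transition n) (finish_set n (perm_braid n w)) (map (perm_braid n) []) \<noteq> {}
      \<longleftrightarrow> normal_list n [w]"
  proof -
    have w: "w permutes {1..n}" "w \<noteq> id" using Nil(1,2) .
    show ?thesis using w finish_set_nonempty[OF w] by simp
  qed
next
  case (Cons v L)
  have w: "w permutes {1..n}" "w \<noteq> id" using Cons.prems(1,2) .
  from Cons.prems have v: "v permutes {1..n}" and L: "L \<in> lists (perms n)" by auto
  have simples: "map (perm_braid n) L \<in> lists (simples n)" using L by (auto simp: simples_eq)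
  show ?case
  proof (cases "v \<noteq> id \<and> start_set n (perm_braid n v) \<subseteq> finish_set n (perm_braid n w)")
    case True
    then have t: "transition n (finish_set n (perm_braid n w)) (perm_braid n v) = finish_set n (perm_braid n v)"
      by (simp add: transition_def)
    from True have "v \<noteq> id" by simp
    from Cons.IH[OF v this L]
    have "foldl (transition n) (finish_set n (perm_braid n w)) (map (perm_braid n) (v # L)) \<noteq> {}
        \<longleftrightarrow> normal_list n (v # L)"
      unfolding list.map foldl.simps t .
    also have "\<dots> \<longleftrightarrow> normal_list n (w # v # L)"
      unfolding normal_list_Cons_Cons_iff[OF w(1) v] using True w(2) by blast
    finally show ?thesis .
  next
    case False
    \<comment> \<open>The letter 1 passes the test, but its finishing set is empty, so it leads to
      failure just like an illegal letter.\<close>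
    then have "transition n (finish_set n (perm_braid n w)) (perm_braid n v) = {}"
      using finish_set_id by (auto simp: transition_def)
    moreover have "\<not> normal_list n (w # v # L)"
      unfolding normal_list_Cons_Cons_iff[OF w(1) v] using False by auto
    ultimately show ?thesis using foldl_transition_empty[OF simples] by simp
  qed
qed

text \<open>The initial state imposes no condition on the first letter. It must be nonempty for the
  empty word to be accepted, which is where \<open>n \<ge> 2\<close> enters.\<close>

lemma accepted_iff_normal_list:
  assumes "n \<ge> 2" and L: "L \<in> lists (perms n)"
  shows "foldl (transition n) (atoms n) (map (perm_braid n) L) \<noteq> {} \<longleftrightarrow> normal_list n L"
proof (cases L)
  case Nil
  then show ?thesis using assms(1) by (simp add: atoms_def)
next
  case (Cons w M)
  then have w: "w permutes {1..n}" and M: "M \<in> lists (perms n)" using L by auto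
  have "start_set n (perm_braid n w) \<subseteq> atoms n" by (auto simp: start_set_def)
  then have t: "transition n (atoms n) (perm_braid n w) = finish_set n (perm_braid n w)"
    by (simp add: transition_def)
  show ?thesis
  proof (cases "w = id")
    case True
    have "map (perm_braid n) M \<in> lists (simples n)" using M by (auto simp: simples_eq)
    then show ?thesis using Cons t foldl_transition_empty finish_set_id True by simp
  next
    case False
    show ?thesis using Cons t accepted_from_finish_set[OF w False M] by simp
  qed
qed

text \<open>Columns of \<open>T_mat\<close> are indexed by the source state, so the factor
  multiplied on the left is the last letter read, and words grow as \<open>ws @ [s]\<close>.\<close>

lemma mat_pow_T_mat:
  assumes X: "X \<in> states n" and "Y \<in> states n"
  shows "mat_pow (states n) (T_mat n) k Y X
    = int (card {ws \<in> lists (simples n). length ws = k \<and> foldl (transition n) X ws = Y})"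
  using assms(2)
proof (induction k arbitrary: Y)
  case 0
  have "{ws \<in> lists (simples n). length ws = 0 \<and> foldl (transition n) X ws = Y} = (if X = Y then {[]} else {})"
    by auto
  then show ?case by (simp add: mat_id_def)
next
  case (Suc k)
  let ?A = "\<lambda>Z. {ws \<in> lists (simples n). length ws = k \<and> foldl (transition n) X ws = Z}"
  let ?B = "\<lambda>Z. {s \<in> simples n. transition n Z s = Y}"
  have fin: "finite (?A Z)" for Z
    by (rule finite_subset[OF _ finite_lists_length_eq[OF finite_simples[of n], of k]]) auto
  have in_states: "foldl (transition n) X ws \<in> states n" for ws
    by (induction ws rule: rev_induct) (auto simp: X transition_in_states)
  have "mat_pow (states n) (T_mat n) (Suc k) Y X = (\<Sum>Z\<in>states n. int (card (?B Z)) * int (card (?A Z)))"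
    using Suc.IH by (simp add: mat_mul_def T_mat_def)
  also have "\<dots> = int (\<Sum>Z\<in>states n. card ((\<lambda>(ws, s). ws @ [s]) ` (?A Z \<times> ?B Z)))"
    by (simp add: card_image inj_on_def card_cartesian_product mult.commute)
  also have "(\<Sum>Z\<in>states n. card ((\<lambda>(ws, s). ws @ [s]) ` (?A Z \<times> ?B Z)))
      = card (\<Union>Z\<in>states n. (\<lambda>(ws, s). ws @ [s]) ` (?A Z \<times> ?B Z))"
    by (rule card_UN_disjoint[symmetric]) (use fin finite_simples in auto)
  also have "(\<Union>Z\<in>states n. (\<lambda>(ws, s). ws @ [s]) ` (?A Z \<times> ?B Z))
      = {ws \<in> lists (simples n). length ws = Suc k \<and> foldl (transition n) X ws = Y}"
  proof
    show "(\<Union>Z\<in>states n. (\<lambda>(ws, s). ws @ [s]) ` (?A Z \<times> ?B Z))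
        \<subseteq> {ws \<in> lists (simples n). length ws = Suc k \<and> foldl (transition n) X ws = Y}" by auto
    show "{ws \<in> lists (simples n). length ws = Suc k \<and> foldl (transition n) X ws = Y}
        \<subseteq> (\<Union>Z\<in>states n. (\<lambda>(ws, s). ws @ [s]) ` (?A Z \<times> ?B Z))"
    proof
      fix ws assume ws: "ws \<in> {ws \<in> lists (simples n). length ws = Suc k \<and> foldl (transition n) X ws = Y}"
      then obtain vs s where vs: "ws = vs @ [s]" by (cases ws rule: rev_cases) auto
      then have "(vs, s) \<in> ?A (foldl (transition n) X vs) \<times> ?B (foldl (transition n) X vs)" using ws by auto
      then show "ws \<in> (\<Union>Z\<in>states n. (\<lambda>(ws, s). ws @ [s]) ` (?A Z \<times> ?B Z))"
        using in_states[of vs] vs by force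
    qed
  qed
  finally show ?case .
qed

text \<open>Accepted words of length \<open>k\<close> are the normal forms of that length, one for
  each element. For \<open>n = 1\<close> the initial state is empty and the right side vanishes,
  whereas the trivial monoid has one element of length 0.\<close>

lemma growth_coefficient:
  assumes n: "n \<ge> 2"
  shows "int (card {g \<in> carrier (braid_monoid n). simple_length n g = k})
    = (v_vec \<cdot>\<^bsub>states n\<^esub> mat_pow (states n) (T_mat n) k \<cdot>\<^bsub>states n\<^esub> u_vec n) () ()"
proof -
  let ?A = "\<lambda>Y. {ws \<in> lists (simples n). length ws = k \<and> foldl (transition n) (atoms n) ws = Y}"
  have atoms: "atoms n \<in> states n" by (simp add: states_def)
  have fin: "finite (?A Y)" for Y
    by (rule finite_subset[OF _ finite_lists_length_eq[OF finite_simples[of n], of k]]) auto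
  have in_states: "foldl (transition n) (atoms n) ws \<in> states n" for ws
    by (induction ws rule: rev_induct) (auto simp: atoms transition_in_states)
  have "(v_vec \<cdot>\<^bsub>states n\<^esub> mat_pow (states n) (T_mat n) k \<cdot>\<^bsub>states n\<^esub> u_vec n) () ()
      = (\<Sum>Y\<in>states n. v_vec () Y * mat_pow (states n) (T_mat n) k Y (atoms n))"
    using atoms by (simp add: mat_mul_def[of _ _ "u_vec n"] u_vec_def if_distrib[of "\<lambda>c. _ * c"] mat_mul_def cong: if_cong)
  also have "\<dots> = (\<Sum>Y\<in>states n. if Y \<noteq> {} then int (card (?A Y)) else 0)"
    by (rule sum.cong) (auto simp: v_vec_def mat_pow_T_mat[OF atoms])
  also have "\<dots> = int (\<Sum>Y\<in>{Y \<in> states n. Y \<noteq> {}}. card (?A Y))"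
    unfolding of_nat_sum by (rule sum.inter_filter[symmetric]) simp
  also have "(\<Sum>Y\<in>{Y \<in> states n. Y \<noteq> {}}. card (?A Y)) = card (\<Union>Y\<in>{Y \<in> states n. Y \<noteq> {}}. ?A Y)"
    by (rule card_UN_disjoint[symmetric]) (use fin in auto)
  also have "(\<Union>Y\<in>{Y \<in> states n. Y \<noteq> {}}. ?A Y) = map (perm_braid n) ` {L. normal_list n L \<and> length L = k}"
  proof -
    have "(\<Union>Y\<in>{Y \<in> states n. Y \<noteq> {}}. ?A Y)
        = {ws \<in> lists (simples n). length ws = k \<and> foldl (transition n) (atoms n) ws \<noteq> {}}"
      using in_states by blast
    also have "\<dots> = {ws \<in> map (perm_braid n) ` lists (perms n). length ws = k \<and> foldl (transition n) (atoms n) ws \<noteq> {}}"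
      unfolding simples_eq lists_image ..
    also have "\<dots> = map (perm_braid n) ` {L \<in> lists (perms n). length L = k \<and> normal_list n L}"
      unfolding Collect_image using accepted_iff_normal_list[OF n]
      by (intro arg_cong[where f = "image _"] Collect_cong) auto
    also have "{L \<in> lists (perms n). length L = k \<and> normal_list n L} = {L. normal_list n L \<and> length L = k}"
      using normal_list_lists by blast
    finally show ?thesis .
  qed
  also have "card (map (perm_braid n) ` {L. normal_list n L \<and> length L = k}) = card {L. normal_list n L \<and> length L = k}"
  proof (rule card_image, rule inj_onI)
    fix L M assume L: "L \<in> {L. normal_list n L \<and> length L = k}" and M: "M \<in> {L. normal_list n L \<and> length L = k}"
      and "map (perm_braid n) L = map (perm_braid n) M"
    then have "perms_prod n L = perms_prod n M" by (simp add: perms_prod_def)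
    then show "L = M" using L M normal_form_perms_prod by (metis mem_Collect_eq)
  qed
  also have "card {L. normal_list n L \<and> length L = k} = card {g \<in> carrier (braid_monoid n). simple_length n g = k}"
  proof (rule bij_betw_same_card[of "perms_prod n"], rule bij_betw_byWitness[where f' = "normal_form n"])
    show "perms_prod n ` {L. normal_list n L \<and> length L = k} \<subseteq> {g \<in> carrier (braid_monoid n). simple_length n g = k}"
      using perms_prod_carrier[OF normal_list_lists] normal_form_perms_prod simple_length_eq by auto
    show "normal_form n ` {g \<in> carrier (braid_monoid n). simple_length n g = k} \<subseteq> {L. normal_list n L \<and> length L = k}"
      using normal_form_normal simple_length_eq by auto
  qed (use normal_form_perms_prod perms_prod_normal_form in auto)
  finally show ?thesis by simp
qed

theorem proposition4p8:
  fixes n :: nat and \<psi> :: "nat multiset \<Rightarrow> state"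
  assumes n: "n \<ge> 1"
    and psi: "\<And>\<alpha>. \<alpha> \<in> partitions n \<Longrightarrow> \<psi> \<alpha> \<in> states n \<and> phi n (\<psi> \<alpha>) = \<alpha>"
  shows
    "(mat_invertible (states n) S_mat \<and>
      mat_eq (states n) (states n) (mat_inv (states n) S_mat)
        (\<lambda>X Y. if X \<subseteq> Y then (- 1) ^ card (Y - X) else 0))
     \<and>
     (mat_eq (states n) (states n) (T_mat n)
        (mat_inv (states n) S_mat \<cdot>\<^bsub>states n\<^esub> C_mat n \<cdot>\<^bsub>states n\<^esub> mat_transpose (P_mat n)
           \<cdot>\<^bsub>partitions n\<^esub> N_tilde n \<cdot>\<^bsub>partitions n\<^esub> P_mat n) \<and>
      mat_eq (partitions n) (partitions n) (T_tilde n \<psi>)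
        (P_mat n \<cdot>\<^bsub>states n\<^esub> T_mat n \<cdot>\<^bsub>states n\<^esub> Q_mat \<psi>) \<and>
      mat_eq (partitions n) (partitions n) (P_mat n \<cdot>\<^bsub>states n\<^esub> T_mat n \<cdot>\<^bsub>states n\<^esub> Q_mat \<psi>)
        (P_mat n \<cdot>\<^bsub>states n\<^esub> mat_inv (states n) S_mat \<cdot>\<^bsub>states n\<^esub> C_mat n
           \<cdot>\<^bsub>states n\<^esub> mat_transpose (P_mat n) \<cdot>\<^bsub>partitions n\<^esub> N_tilde n))
     \<and>
     (phi n (atoms n) = replicate_mset n 1 \<and>
      phi n {} = {#n#} \<and>
      (\<forall>k. mat_eq UNIV UNIV
         (v_vec \<cdot>\<^bsub>states n\<^esub> mat_pow (states n) (T_mat n) k \<cdot>\<^bsub>states n\<^esub> u_vec n)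
         (v_tilde n \<cdot>\<^bsub>partitions n\<^esub> mat_pow (partitions n) (T_tilde n \<psi>) k
            \<cdot>\<^bsub>partitions n\<^esub> u_tilde n)) \<and>
      (n \<ge> 2 \<longrightarrow> growth_function n =
         Abs_fps (\<lambda>k. (v_tilde n \<cdot>\<^bsub>partitions n\<^esub> mat_pow (partitions n) (T_tilde n \<psi>) k
            \<cdot>\<^bsub>partitions n\<^esub> u_tilde n) () ())))"
proof -
  let ?S = "states n" and ?P = "partitions n"
  let ?Sinv = "mat_inv ?S S_mat"
  \<comment> \<open>The section \<open>\<psi>\<close> makes \<open>phi n\<close> surjective onto the
    partitions, so there are finitely many of them.\<close>
  have finP: "finite ?P"
    by (rule finite_subset[of _ "phi n ` ?S"]) (use psi in force)+
  note assoc = mat_mul_assoc[OF finite_states finite_states] mat_mul_assoc[OF finite_states finP]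
    mat_mul_assoc[OF finP finite_states] mat_mul_assoc[OF finP finP]
  note pick = if_distrib[of "\<lambda>c. c * _"] if_distrib[of "\<lambda>c. _ * c"]
  \<comment> \<open>\<open>R\<close> is the value of \<open>S T\<close> found by counting, and
    \<open>R'\<close> is its version with columns indexed by partitions.\<close>
  define R where "R Z X = N_tilde n (phi n (atoms n - Z)) (phi n X)" for Z X
  define R' where "R' Z \<beta> = N_tilde n (phi n (atoms n - Z)) \<beta>" for Z \<beta>
  have inv: "is_mat_inverse ?S S_mat ?Sinv"
    unfolding mat_inv_def by (rule someI[where P = "is_mat_inverse ?S S_mat", OF S_mat_inverse])
  \<comment> \<open>Multiplication by \<open>C_mat n\<close> complements the row index, and
    \<open>mat_transpose (P_mat n)\<close> pulls rows back along \<open>phi\<close>.\<close>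
  have C_part: "(C_mat n \<cdot>\<^bsub>?S\<^esub> (mat_transpose (P_mat n) \<cdot>\<^bsub>?P\<^esub> B)) Z x = B (phi n (atoms n - Z)) x"
    if "Z \<in> ?S" for B :: "nat multiset \<Rightarrow> 'x \<Rightarrow> int" and Z x
  proof -
    have "(mat_transpose (P_mat n) \<cdot>\<^bsub>?P\<^esub> B) Y x = B (phi n Y) x" for Y
      unfolding mat_mul_def mat_transpose_def P_mat_def using finP phi_partition[of n Y] by (simp add: pick cong: if_cong)
    then have "(C_mat n \<cdot>\<^bsub>?S\<^esub> (mat_transpose (P_mat n) \<cdot>\<^bsub>?P\<^esub> B)) Z x
        = (\<Sum>Y\<in>?S. if Y = atoms n - Z then B (phi n Y) x else 0)"
      unfolding mat_mul_def[of "C_mat n"] using that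
      by (intro sum.cong) (auto simp: states_def C_mat_def)
    also have "\<dots> = B (phi n (atoms n - Z)) x" by (simp add: states_def)
    finally show ?thesis .
  qed
  have NP: "(N_tilde n \<cdot>\<^bsub>?P\<^esub> P_mat n) \<alpha> X = N_tilde n \<alpha> (phi n X)" for \<alpha> X
    unfolding mat_mul_def P_mat_def using finP phi_partition[of n X] by (simp add: pick cong: if_cong)
  have CPN: "mat_eq ?S ?P (C_mat n \<cdot>\<^bsub>?S\<^esub> (mat_transpose (P_mat n) \<cdot>\<^bsub>?P\<^esub> N_tilde n)) R'"
    unfolding mat_eq_def R'_def by (intro ballI C_part)
  have CPNP: "mat_eq ?S ?S (C_mat n \<cdot>\<^bsub>?S\<^esub> (mat_transpose (P_mat n) \<cdot>\<^bsub>?P\<^esub> (N_tilde n \<cdot>\<^bsub>?P\<^esub> P_mat n))) R"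
    unfolding mat_eq_def R_def by (simp add: C_part NP)
  have ST: "mat_eq ?S ?S (S_mat \<cdot>\<^bsub>?S\<^esub> T_mat n) R"
    unfolding mat_eq_def R_def using S_mat_T_mat by blast
  have T: "mat_eq ?S ?S (T_mat n) (?Sinv \<cdot>\<^bsub>?S\<^esub> R)"
  proof -
    have "mat_eq ?S ?S (?Sinv \<cdot>\<^bsub>?S\<^esub> (S_mat \<cdot>\<^bsub>?S\<^esub> T_mat n)) (mat_id \<cdot>\<^bsub>?S\<^esub> T_mat n)"
      unfolding assoc[symmetric] using inv by (intro mat_mul_cong) (auto simp: is_mat_inverse_def)
    then have "mat_eq ?S ?S (?Sinv \<cdot>\<^bsub>?S\<^esub> (S_mat \<cdot>\<^bsub>?S\<^esub> T_mat n)) (T_mat n)"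
      using mat_mul_id_left[OF finite_states] by (rule mat_eq_trans)
    then show ?thesis using mat_mul_cong[OF mat_eq_refl ST] by (meson mat_eq_sym mat_eq_trans)
  qed
  \<comment> \<open>The columns of \<open>R\<close> depend on \<open>X\<close> only through
    \<open>phi n X\<close>, and left multiplication preserves this. So the choice of
    \<open>\<psi>\<close> within a fibre is immaterial.\<close>
  have T_phi: "T_mat n Y X = T_mat n Y X'" if "Y \<in> ?S" "X \<in> ?S" "X' \<in> ?S" "phi n X = phi n X'" for X X' Y
  proof -
    have "T_mat n Y X = (?Sinv \<cdot>\<^bsub>?S\<^esub> R) Y X" "T_mat n Y X' = (?Sinv \<cdot>\<^bsub>?S\<^esub> R) Y X'"
      using T that by (auto simp: mat_eq_def)
    then show ?thesis using that(4) by (simp add: mat_mul_def R_def)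
  qed
  have PA: "(P_mat n \<cdot>\<^bsub>?S\<^esub> A) \<beta> x = (\<Sum>Y\<in>{Y \<in> ?S. phi n Y = \<beta>}. A Y x)" for A :: "state \<Rightarrow> 'x \<Rightarrow> int" and \<beta> x
  proof -
    have "(P_mat n \<cdot>\<^bsub>?S\<^esub> A) \<beta> x = (\<Sum>Y\<in>?S. if phi n Y = \<beta> then A Y x else 0)"
      unfolding mat_mul_def P_mat_def by (intro sum.cong) auto
    also have "\<dots> = (\<Sum>Y\<in>{Y \<in> ?S. phi n Y = \<beta>}. A Y x)" by (rule sum.inter_filter[symmetric]) simp
    finally show ?thesis .
  qed
  have AQ: "(A \<cdot>\<^bsub>?S\<^esub> Q_mat \<psi>) i \<alpha> = A i (\<psi> \<alpha>)" if "\<alpha> \<in> ?P" for A :: "'x \<Rightarrow> state \<Rightarrow> int" and i \<alpha>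
    unfolding mat_mul_def Q_mat_def using psi[OF that] by (simp add: pick cong: if_cong)
  have part1: "mat_invertible ?S S_mat \<and> mat_eq ?S ?S ?Sinv (\<lambda>X Y. if X \<subseteq> Y then (- 1) ^ card (Y - X) else 0)"
    using S_mat_inverse[of n] mat_inv_eq[OF finite_states S_mat_inverse]
    unfolding mat_invertible_def moebius_mat_def by blast
  have T_fac: "mat_eq ?S ?S (T_mat n)
        (?Sinv \<cdot>\<^bsub>?S\<^esub> C_mat n \<cdot>\<^bsub>?S\<^esub> mat_transpose (P_mat n) \<cdot>\<^bsub>?P\<^esub> N_tilde n \<cdot>\<^bsub>?P\<^esub> P_mat n)"
    unfolding assoc using T mat_mul_cong[OF mat_eq_refl mat_eq_sym[OF CPNP]] by (rule mat_eq_trans)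
  have Tt: "mat_eq ?P ?P (T_tilde n \<psi>) (P_mat n \<cdot>\<^bsub>?S\<^esub> T_mat n \<cdot>\<^bsub>?S\<^esub> Q_mat \<psi>)"
    unfolding mat_eq_def T_tilde_def by (simp add: AQ PA)
  have PTQ: "mat_eq ?P ?P (P_mat n \<cdot>\<^bsub>?S\<^esub> T_mat n \<cdot>\<^bsub>?S\<^esub> Q_mat \<psi>)
        (P_mat n \<cdot>\<^bsub>?S\<^esub> ?Sinv \<cdot>\<^bsub>?S\<^esub> C_mat n \<cdot>\<^bsub>?S\<^esub> mat_transpose (P_mat n) \<cdot>\<^bsub>?P\<^esub> N_tilde n)"
  proof -
    have "mat_eq ?S ?P (T_mat n \<cdot>\<^bsub>?S\<^esub> Q_mat \<psi>) (?Sinv \<cdot>\<^bsub>?S\<^esub> R')"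
      unfolding mat_eq_def
    proof (intro ballI)
      fix Y \<alpha> assume Y: "Y \<in> ?S" and \<alpha>: "\<alpha> \<in> ?P"
      have "(T_mat n \<cdot>\<^bsub>?S\<^esub> Q_mat \<psi>) Y \<alpha> = (?Sinv \<cdot>\<^bsub>?S\<^esub> R) Y (\<psi> \<alpha>)"
        using T Y psi[OF \<alpha>] by (simp add: AQ[OF \<alpha>] mat_eq_def)
      also have "\<dots> = (?Sinv \<cdot>\<^bsub>?S\<^esub> R') Y \<alpha>" using psi[OF \<alpha>] by (simp add: mat_mul_def R_def R'_def)
      finally show "(T_mat n \<cdot>\<^bsub>?S\<^esub> Q_mat \<psi>) Y \<alpha> = (?Sinv \<cdot>\<^bsub>?S\<^esub> R') Y \<alpha>" .
    qed
    from mat_eq_trans[OF this mat_mul_cong[OF mat_eq_refl mat_eq_sym[OF CPN]]]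
    show ?thesis unfolding assoc by (rule mat_mul_cong[OF mat_eq_refl])
  qed
  have atoms: "atoms n \<in> ?S" and empty: "{} \<in> ?S" by (auto simp: states_def)
  have phi_atoms: "phi n (atoms n) = replicate_mset n 1"
    using phi_complement_ones_iff[OF empty] by simp
  have phi_empty: "phi n {} = {#n#}" using phi_full_iff[OF empty n] by simp
  have PT: "mat_eq ?P ?S (P_mat n \<cdot>\<^bsub>?S\<^esub> T_mat n) (T_tilde n \<psi> \<cdot>\<^bsub>?P\<^esub> P_mat n)"
    unfolding mat_eq_def
  proof (intro ballI)
    fix \<beta> X assume X: "X \<in> ?S"
    have "(T_tilde n \<psi> \<cdot>\<^bsub>?P\<^esub> P_mat n) \<beta> X = T_tilde n \<psi> \<beta> (phi n X)"
      unfolding mat_mul_def P_mat_def using finP phi_partition[of n X] by (simp add: pick cong: if_cong)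
    also have "\<dots> = (\<Sum>Y\<in>{Y \<in> ?S. phi n Y = \<beta>}. T_mat n Y X)"
      unfolding T_tilde_def using psi[OF phi_partition[of n X]] X by (intro sum.cong T_phi) auto
    finally show "(P_mat n \<cdot>\<^bsub>?S\<^esub> T_mat n) \<beta> X = (T_tilde n \<psi> \<cdot>\<^bsub>?P\<^esub> P_mat n) \<beta> X" using PA by simp
  qed
  \<comment> \<open>\<open>P_mat n\<close> is pushed through the power one factor at a time by
    \<open>PT\<close>; on reaching \<open>u_vec n\<close> it turns it into
    \<open>u_tilde n\<close>.\<close>
  have power: "mat_eq ?P UNIV (P_mat n \<cdot>\<^bsub>?S\<^esub> (mat_pow ?S (T_mat n) k \<cdot>\<^bsub>?S\<^esub> u_vec n))
      (mat_pow ?P (T_tilde n \<psi>) k \<cdot>\<^bsub>?P\<^esub> u_tilde n)" for k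
  proof (induction k)
    case 0
    have pu: "mat_eq ?P UNIV (P_mat n \<cdot>\<^bsub>?S\<^esub> u_vec n) (u_tilde n)"
      unfolding mat_eq_def mat_mul_def P_mat_def u_vec_def u_tilde_def using atoms by (simp add: pick cong: if_cong)
    have "mat_eq ?P UNIV (P_mat n \<cdot>\<^bsub>?S\<^esub> (mat_id \<cdot>\<^bsub>?S\<^esub> u_vec n)) (P_mat n \<cdot>\<^bsub>?S\<^esub> u_vec n)"
      by (rule mat_mul_cong[OF mat_eq_refl mat_mul_id_left[OF finite_states]])
    from mat_eq_trans[OF this mat_eq_trans[OF pu mat_eq_sym[OF mat_mul_id_left[OF finP]]]]
    show ?case unfolding mat_pow.simps .
  next
    case (Suc k)
    let ?w = "mat_pow ?S (T_mat n) k \<cdot>\<^bsub>?S\<^esub> u_vec n"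
    have "mat_eq ?P UNIV (P_mat n \<cdot>\<^bsub>?S\<^esub> T_mat n \<cdot>\<^bsub>?S\<^esub> ?w) (T_tilde n \<psi> \<cdot>\<^bsub>?P\<^esub> P_mat n \<cdot>\<^bsub>?S\<^esub> ?w)"
      by (rule mat_mul_cong[OF PT mat_eq_refl])
    moreover have "mat_eq ?P UNIV (T_tilde n \<psi> \<cdot>\<^bsub>?P\<^esub> (P_mat n \<cdot>\<^bsub>?S\<^esub> ?w))
        (T_tilde n \<psi> \<cdot>\<^bsub>?P\<^esub> (mat_pow ?P (T_tilde n \<psi>) k \<cdot>\<^bsub>?P\<^esub> u_tilde n))"
      by (rule mat_mul_cong[OF mat_eq_refl Suc.IH])
    ultimately show ?case unfolding mat_pow.simps assoc by (rule mat_eq_trans)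
  qed
  have vec: "mat_eq UNIV UNIV (v_vec \<cdot>\<^bsub>?S\<^esub> mat_pow ?S (T_mat n) k \<cdot>\<^bsub>?S\<^esub> u_vec n)
      (v_tilde n \<cdot>\<^bsub>?P\<^esub> mat_pow ?P (T_tilde n \<psi>) k \<cdot>\<^bsub>?P\<^esub> u_tilde n)" for k
  proof -
    let ?w = "mat_pow ?S (T_mat n) k \<cdot>\<^bsub>?S\<^esub> u_vec n"
    \<comment> \<open>The row vector factors through \<open>P_mat n\<close> because the empty state
      is the only one in the fibre over \<open>[n]\<close>.\<close>
    have v: "mat_eq UNIV ?S v_vec (v_tilde n \<cdot>\<^bsub>?P\<^esub> P_mat n)"
      unfolding mat_eq_def
    proof (intro ballI)
      fix i :: unit and X assume X: "X \<in> ?S"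
      have "(v_tilde n \<cdot>\<^bsub>?P\<^esub> P_mat n) i X = v_tilde n i (phi n X)"
        unfolding mat_mul_def P_mat_def using finP phi_partition[of n X] by (simp add: pick cong: if_cong)
      then show "v_vec i X = (v_tilde n \<cdot>\<^bsub>?P\<^esub> P_mat n) i X"
        using phi_full_iff[OF X n] by (simp add: v_vec_def v_tilde_def phi_empty)
    qed
    have "mat_eq UNIV UNIV (v_vec \<cdot>\<^bsub>?S\<^esub> ?w) (v_tilde n \<cdot>\<^bsub>?P\<^esub> P_mat n \<cdot>\<^bsub>?S\<^esub> ?w)"
      by (rule mat_mul_cong[OF v mat_eq_refl])
    moreover have "mat_eq UNIV UNIV (v_tilde n \<cdot>\<^bsub>?P\<^esub> (P_mat n \<cdot>\<^bsub>?S\<^esub> ?w))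
        (v_tilde n \<cdot>\<^bsub>?P\<^esub> (mat_pow ?P (T_tilde n \<psi>) k \<cdot>\<^bsub>?P\<^esub> u_tilde n))"
      by (rule mat_mul_cong[OF mat_eq_refl power])
    ultimately show ?thesis unfolding assoc by (rule mat_eq_trans)
  qed
  have growth: "growth_function n = Abs_fps (\<lambda>k. (v_tilde n \<cdot>\<^bsub>?P\<^esub> mat_pow ?P (T_tilde n \<psi>) k \<cdot>\<^bsub>?P\<^esub> u_tilde n) () ())"
    if "n \<ge> 2"
    unfolding growth_function_def using growth_coefficient[OF that] vec by (simp add: mat_eq_def)
  show ?thesis
    using part1 T_fac Tt PTQ phi_atoms phi_empty vec growth by blast
qed

end
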